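(* There exist constants $C>0$ and $\varepsilon_0>0$, depending only on the geometric and analytic data of $M$, such that the following holds. Let $0<\varepsilon<\varepsilon_0$, $q\in\{0,\dots,d\}$, $r>0$, and let $\mathcal A=\{B_M(y_1,\varepsilon),\ldots,B_M(y_m,\varepsilon)\}$ be a degree-$q$, radius-$r$ homological certificate for $M$. Then, for every $z\in M$ and $\delta\in(0,1)$, $$\mathbb P_z\big(H_q(\Gamma_T^r)\cong H_q(M)\big)\ge1-\delta\quad\text{whenever}\quad T\ge C\Big(s_0+\kappa_d(\varepsilon)^{-1}\big(\log m+\log\tfrac1\delta\big)\Big).$$ If $\mathcal A$ is a full homological certificate at radius $r$, the same condition gives simultaneous recovery of all homology groups, i.e. $\mathbb P_z\big(H_{q'}(\Gamma_T^r)\cong H_{q'}(M)\text{ for all }q'=0,\dots,d\big)\ge1-\delta$.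
   Context: Setting. $d\ge2$; homology has coefficients in a fixed field. $M\subset\mathbb R^d$ is the closure of a bounded connected open set. $d_M(x,y)$ is the infimum of the lengths of rectifiable curves in $M$ joining $x$ to $y$; $B_M(x,\varepsilon)=\{y\in M:d_M(x,y)<\varepsilon\}$; $\mu(A)=|A|/|M|$ is normalized Lebesgue measure on $M$. $M$ satisfies the following assumptions. (1) Positive reach: $\operatorname{reach}(M)>0$, i.e. every $z$ with $0<\operatorname{dist}(z,M)<\operatorname{reach}(M)$ has a unique nearest point in $M$. (2) There are $c_{ie}\ge1$, $\rho_{ie}>0$ with $d_M(x,y)\le c_{ie}|x-y|$ whenever $x,y\in M$, $|x-y|<\rho_{ie}$. (3) There are $c_{vol},C_{vol},\rho_{vol}>0$ with $c_{vol}\varepsilon^d\le\mu(B_M(x,\varepsilon))\le C_{vol}\varepsilon^d$ for all $x\in M$, $0<\varepsilon<\rho_{vol}$. (4) $M$ is an admissible reflecting domain: its boundary is regular enough that reflected Brownian motion in $M$ exists and is unique in law, has a symmetric Neumann heat kernel, the Neumann semigroup on $L^2(M,\mu)$ is compact, the Neumann spectrum is discrete with positive spectral gap, and there are $\rho_{ch}>0$, $L_{ch}\ge1$ such that every $x\in M$ has a neighbourhood $U_x\subset M$ and a chart $\Psi_x$ on $U_x$, bi-Lipschitz with constant $L_{ch}$ and with Jacobian determinants of $\Psi_x,\Psi_x^{-1}$ uniformly bounded above and below, mapping $U_x$ onto a Euclidean ball if $\operatorname{dist}(x,\partial M)\ge\rho_{ch}$ and onto a half-ball with $\partial M$ carried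 into the flat face if $\operatorname{dist}(x,\partial M)<\rho_{ch}$. (A compact connected Lipschitz domain with uniform chart constants suffices for (4).) (5) Heat-kernel domination: there are $s_0>0$, $a_{hk}\ge1$ such that the transition density $p_t(x,y)$ of the process below with respect to $\mu$ satisfies $p_t(x,y)\le a_{hk}$ for all $t\ge s_0$, $x,y\in M$. Process. $X=(X_t)_{t\ge0}$ is reflected Brownian motion in $M$: the conservative $\mu$-symmetric Hunt process with continuous paths associated with the Dirichlet form $\mathcal E(f,g)=\frac12\int_M\nabla f\cdot\nabla g\,d\mu$, $f,g\in H^1(M)$. $\mathbb P_z$ is its law started at $z$. Notation. $\Gamma_T=\{X_t:0\le t\le T\}$; for compact $S\subset\mathbb R^d$, $S^r=\{x\in\mathbb R^d:\operatorname{dist}(x,S)\le r\}$. $\kappa_2(\varepsilon)=(\log\varepsilon^{-1})^{-1}$ and $\kappa_d(\varepsilon)=\varepsilon^{d-2}$ for $d\ge3$. Certificates. For a continuous path $\gamma:[0,T]\to M$ put $\operatorname{Tr}(\gamma)=\gamma([0,T])$. A finite family $\mathcal A=\{A_1,\dots,A_m\}$ of measurable subsets of $M$ is a degree-$q$, radius-$r$ homological certificate for $M$ if every continuous path $\gamma:[0,T]\to M$ (any $T$) with $\operatorname{Tr}(\gamma)\cap A_i\ne\varnothing$ for all $i$ satisfies $H_q(\operatorname{Tr}(\gamma)^r)\cong H_q(M)$; it is a full homological certificate at radius $r$ if this holds simultaneously for every $q=0,\dots,d$. *)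

theory Defs
  imports "HOL-Probability.Probability" "HOL-Homology.Homology"
begin

section \<open>Singular homology with coefficients in a field\<close>

text \<open>
  The library's homology groups have integer coefficients. The chains below use the library's
  singular simplices and faces, with coefficients in a field \<open>'k\<close>.
\<close>

type_synonym ('a, 'k) fchain = "((nat \<Rightarrow> real) \<Rightarrow> 'a) \<Rightarrow>\<^sub>0 'k"

definition fchain_boundary :: "nat \<Rightarrow> ('a, 'k::field) fchain \<Rightarrow> ('a, 'k) fchain" where
  "fchain_boundary p c =
     (if p = 0 then 0
      else \<Sum>\<sigma>\<in>Poly_Mapping.keys c. \<Sum>k\<le>p.
             Poly_Mapping.single (singular_face p k \<sigma>) ((-1) ^ k * Poly_Mapping.lookup c \<sigma>))"

definition fchains :: "nat \<Rightarrow> 'a topology \<Rightarrow> ('a, 'k::field) fchain set" where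
  "fchains p X = {c. Poly_Mapping.keys c \<subseteq> singular_simplex_set p X}"

definition fcycles :: "nat \<Rightarrow> 'a topology \<Rightarrow> ('a, 'k::field) fchain set" where
  "fcycles p X = {c \<in> fchains p X. fchain_boundary p c = 0}"

definition fboundaries :: "nat \<Rightarrow> 'a topology \<Rightarrow> ('a, 'k::field) fchain set" where
  "fboundaries p X = fchain_boundary (Suc p) ` fchains (Suc p) X"

text \<open>
  The quotient space of cycles by boundaries. Its elements are cosets, and the fields \<open>mult\<close> and
  \<open>one\<close> of the record, which a vector space does not use, are filled with a dummy value. Adding
  the boundaries in the scalar multiplication keeps the result a full coset when the scalar is 0.
\<close>

definition homology_space ::
    "nat \<Rightarrow> 'a topology \<Rightarrow> ('k::field, ('a, 'k) fchain set) module" where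
  "homology_space p X =
     \<lparr>carrier = (\<lambda>c. {c + b | b. b \<in> fboundaries p X}) ` fcycles p X,
      mult = (\<lambda>_ _. fboundaries p X),
      one = fboundaries p X,
      zero = fboundaries p X,
      add = (\<lambda>u v. {x + y | x y. x \<in> u \<and> y \<in> v}),
      smult = (\<lambda>a u. {Poly_Mapping.map ((*) a) x + b | x b. x \<in> u \<and> b \<in> fboundaries p X})\<rparr>"

definition linear_iso :: "('k, 'v) module \<Rightarrow> ('k, 'w) module \<Rightarrow> ('v \<Rightarrow> 'w) set" where
  "linear_iso V W =
     {f \<in> iso (add_monoid V) (add_monoid W).
        \<forall>a. \<forall>x\<in>carrier V. f (a \<odot>\<^bsub>V\<^esub> x) = a \<odot>\<^bsub>W\<^esub> f x}"

definition homology_iso ::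
    "'k::field itself \<Rightarrow> nat \<Rightarrow> 'a::topological_space set \<Rightarrow> 'a set \<Rightarrow> bool" where
  "homology_iso _ q S S' \<longleftrightarrow>
     linear_iso (homology_space q (top_of_set S) :: ('k, ('a, 'k) fchain set) module)
                (homology_space q (top_of_set S') :: ('k, ('a, 'k) fchain set) module) \<noteq> {}"


section \<open>Geometry of the domain\<close>

definition closed_domain :: "(real^'n) set \<Rightarrow> bool" where
  "closed_domain M \<longleftrightarrow>
     (\<exists>U. open U \<and> connected U \<and> bounded U \<and> U \<noteq> {} \<and> M = closure U)"

definition reach :: "'a::metric_space set \<Rightarrow> ennreal" where
  "reach M = (SUP \<rho>\<in>{\<rho>. 0 \<le> \<rho> \<and> (\<forall>z. 0 < infdist z M \<and> infdist z M < \<rho>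
                          \<longrightarrow> (\<exists>!x. x \<in> M \<and> dist z x = infdist z M))}. ennreal \<rho>)"

definition curve_length :: "(real \<Rightarrow> 'a::metric_space) \<Rightarrow> ennreal" where
  "curve_length g = (SUP ts\<in>{ts. sorted ts \<and> set ts \<subseteq> {0..1}}.
                       \<Sum>i<length ts - 1. ennreal (dist (g (ts ! i)) (g (ts ! Suc i))))"

text \<open>The value is \<open>\<top>\<close> if no rectifiable curve in \<open>M\<close> joins the two points.\<close>

definition intrinsic_dist :: "'a::metric_space set \<Rightarrow> 'a \<Rightarrow> 'a \<Rightarrow> ennreal" where
  "intrinsic_dist M x y =
     (INF g\<in>{g. path g \<and> path_image g \<subseteq> M \<and> pathstart g = x \<and> pathfinish g = y
                 \<and> curve_length g < \<top>}. curve_length g)"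

definition intrinsic_ball :: "'a::metric_space set \<Rightarrow> 'a \<Rightarrow> real \<Rightarrow> 'a set" where
  "intrinsic_ball M x \<epsilon> = {y \<in> M. intrinsic_dist M x y < ennreal \<epsilon>}"

definition intrinsic_comparable :: "(real^'n) set \<Rightarrow> bool" where
  "intrinsic_comparable M \<longleftrightarrow>
     (\<exists>c\<ge>1. \<exists>\<rho>>0. \<forall>x\<in>M. \<forall>y\<in>M. norm (x - y) < \<rho>
        \<longrightarrow> intrinsic_dist M x y \<le> ennreal (c * norm (x - y)))"

text \<open>Normalized Lebesgue measure, as a measure whose space is \<open>M\<close>.\<close>

definition vol :: "(real^'n) set \<Rightarrow> (real^'n) measure" where
  "vol M = uniform_measure (restrict_space lborel M) M"

definition volume_regular :: "(real^'n) set \<Rightarrow> bool" where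
  "volume_regular M \<longleftrightarrow>
     (\<exists>c>0. \<exists>C>0. \<exists>\<rho>>0. \<forall>x\<in>M. \<forall>\<epsilon>. 0 < \<epsilon> \<and> \<epsilon> < \<rho>
        \<longrightarrow> c * \<epsilon> ^ CARD('n) \<le> measure (vol M) (intrinsic_ball M x \<epsilon>)
          \<and> measure (vol M) (intrinsic_ball M x \<epsilon>) \<le> C * \<epsilon> ^ CARD('n))"

text \<open>
  Uniform bi-Lipschitz charts. Chart neighbourhoods are relatively open in \<open>M\<close>. A bi-Lipschitz map
  is differentiable only almost everywhere, so the Jacobian bounds are imposed at the points of
  differentiability; on the boundary, a null set, nothing is imposed.
\<close>

definition jacobian_bounded :: "real \<Rightarrow> (real^'n) set \<Rightarrow> (real^'n \<Rightarrow> real^'n) \<Rightarrow> bool" where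
  "jacobian_bounded J U \<Psi> \<longleftrightarrow>
     (\<forall>u\<in>interior U. \<forall>D. (\<Psi> has_derivative D) (at u)
        \<longrightarrow> 1 / J \<le> \<bar>det (matrix D)\<bar> \<and> \<bar>det (matrix D)\<bar> \<le> J)"

definition uniform_charts :: "(real^'n) set \<Rightarrow> bool" where
  "uniform_charts M \<longleftrightarrow>
     (\<exists>\<rho>>0. \<exists>L\<ge>1. \<exists>J\<ge>1. \<forall>x\<in>M. \<exists>U \<Psi>.
        x \<in> U \<and> openin (top_of_set M) U
        \<and> (\<forall>u\<in>U. \<forall>v\<in>U. dist u v / L \<le> dist (\<Psi> u) (\<Psi> v) \<and> dist (\<Psi> u) (\<Psi> v) \<le> L * dist u v)
        \<and> jacobian_bounded J U \<Psi> \<and> jacobian_bounded J (\<Psi> ` U) (inv_into U \<Psi>)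
        \<and> (\<rho> \<le> infdist x (frontier M) \<longrightarrow> (\<exists>c. \<exists>R>0. \<Psi> ` U = ball c R))
        \<and> (infdist x (frontier M) < \<rho> \<longrightarrow>
             (\<exists>c e. \<exists>R>0. norm e = 1 \<and> \<Psi> ` U = {v \<in> ball c R. 0 \<le> (v - c) \<bullet> e}
                \<and> \<Psi> ` (U \<inter> frontier M) \<subseteq> {v. (v - c) \<bullet> e = 0})))"


section \<open>The Neumann Dirichlet form\<close>

definition L2 :: "'a measure \<Rightarrow> ('a \<Rightarrow> 'b::euclidean_space) \<Rightarrow> bool" where
  "L2 \<mu> f \<longleftrightarrow> f \<in> borel_measurable \<mu> \<and> integrable \<mu> (\<lambda>x. (norm (f x))\<^sup>2)"

text \<open>
  Test functions are of class \<open>C\<^sup>1\<close> with compact support in the interior of \<open>M\<close>; smooth test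
  functions give the same Sobolev space. The weak gradient is normalized to vanish on the frontier
  of \<open>M\<close>, which is a null set if \<open>M\<close> has charts as above.
\<close>

definition weak_gradient :: "(real^'n) set \<Rightarrow> (real^'n \<Rightarrow> real) \<Rightarrow> (real^'n \<Rightarrow> real^'n) \<Rightarrow> bool" where
  "weak_gradient M f G \<longleftrightarrow>
     (\<forall>x. x \<notin> interior M \<longrightarrow> G x = 0)
     \<and> (\<forall>\<phi> d\<phi>. (\<forall>x. GDERIV \<phi> x :> d\<phi> x) \<and> continuous_on UNIV d\<phi>
          \<and> compact (closure {x. \<phi> x \<noteq> 0}) \<and> closure {x. \<phi> x \<noteq> 0} \<subseteq> interior M
          \<longrightarrow> (LINT x|vol M. f x *\<^sub>R d\<phi> x) = - (LINT x|vol M. \<phi> x *\<^sub>R G x))"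

definition sobolev :: "(real^'n) set \<Rightarrow> (real^'n \<Rightarrow> real) set" where
  "sobolev M = {f. L2 (vol M) f \<and> (\<exists>G. L2 (vol M) G \<and> weak_gradient M f G)}"

definition grad :: "(real^'n) set \<Rightarrow> (real^'n \<Rightarrow> real) \<Rightarrow> real^'n \<Rightarrow> real^'n" where
  "grad M f = (SOME G. L2 (vol M) G \<and> weak_gradient M f G)"

definition dirichlet_form :: "(real^'n) set \<Rightarrow> (real^'n \<Rightarrow> real) \<Rightarrow> (real^'n \<Rightarrow> real) \<Rightarrow> real" where
  "dirichlet_form M f g = 1 / 2 * (LINT x|vol M. grad M f x \<bullet> grad M g x)"

text \<open>
  The nonnegative self-adjoint operator of the form, as a relation between \<open>u\<close> and its image \<open>w\<close>.
  Its spectrum is real, so only real spectral parameters occur; it is closed, so an everywhere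
  defined inverse is automatically bounded. Functions are identified when equal almost everywhere.
\<close>

definition neumann_operator :: "(real^'n) set \<Rightarrow> (real^'n \<Rightarrow> real) \<Rightarrow> (real^'n \<Rightarrow> real) \<Rightarrow> bool" where
  "neumann_operator M u w \<longleftrightarrow>
     u \<in> sobolev M \<and> L2 (vol M) w
     \<and> (\<forall>v\<in>sobolev M. dirichlet_form M u v = (LINT x|vol M. w x * v x))"

definition neumann_eigenspace :: "(real^'n) set \<Rightarrow> real \<Rightarrow> (real^'n \<Rightarrow> real) set" where
  "neumann_eigenspace M \<theta> = {u. neumann_operator M u (\<lambda>x. \<theta> * u x)}"

definition neumann_resolvent_set :: "(real^'n) set \<Rightarrow> real set" where
  "neumann_resolvent_set M =
     {\<theta>. (\<forall>f. L2 (vol M) f \<longrightarrow>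
            (\<exists>u w. neumann_operator M u w \<and> (AE x in vol M. w x - \<theta> * u x = f x)))
        \<and> (\<forall>u\<in>neumann_eigenspace M \<theta>. AE x in vol M. u x = 0)}"

definition neumann_spectrum :: "(real^'n) set \<Rightarrow> real set" where
  "neumann_spectrum M = - neumann_resolvent_set M"

definition discrete_neumann_spectrum :: "(real^'n) set \<Rightarrow> bool" where
  "discrete_neumann_spectrum M \<longleftrightarrow>
     (\<forall>\<theta>\<in>neumann_spectrum M.
        \<theta> isolated_in neumann_spectrum M
        \<and> (\<exists>u\<in>neumann_eigenspace M \<theta>. \<not> (AE x in vol M. u x = 0))
        \<and> (\<exists>B. finite B \<and> (\<forall>u\<in>neumann_eigenspace M \<theta>. \<exists>c.
              AE x in vol M. u x = (\<Sum>b\<in>B. c b * b x))))"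

definition positive_spectral_gap :: "(real^'n) set \<Rightarrow> bool" where
  "positive_spectral_gap M \<longleftrightarrow>
     (\<forall>u\<in>neumann_eigenspace M 0. \<exists>c. AE x in vol M. u x = c)
     \<and> (\<exists>g>0. neumann_spectrum M - {0} \<subseteq> {g..})"


section \<open>Reflected Brownian motion\<close>

text \<open>The space of continuous paths from \<open>[0, \<infinity>)\<close> to \<open>M\<close>, with the coordinate \<open>\<sigma>\<close>-algebra.\<close>

definition path_space :: "(real^'n) set \<Rightarrow> (real \<Rightarrow> real^'n) measure" where
  "path_space M = restrict_space (\<Pi>\<^sub>M t\<in>{0..}. borel) {\<omega>. continuous_on {0..} \<omega> \<and> \<omega> ` {0..} \<subseteq> M}"

definition path_shift :: "real \<Rightarrow> (real \<Rightarrow> 'a) \<Rightarrow> real \<Rightarrow> 'a" where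
  "path_shift s \<omega> = (\<lambda>t\<in>{0..}. \<omega> (s + t))"

definition natural_filtration :: "(real^'n) set \<Rightarrow> ennreal \<Rightarrow> (real \<Rightarrow> real^'n) measure" where
  "natural_filtration M t = sigma (space (path_space M))
     {{\<omega> \<in> space (path_space M). \<omega> s \<in> A} | s A. 0 \<le> s \<and> ennreal s \<le> t \<and> A \<in> sets borel}"

text \<open>Inserting \<open>\<top>\<close> only matters at \<open>t = \<top>\<close>, where \<open>{t<..}\<close> is empty.\<close>

definition right_filtration :: "(real^'n) set \<Rightarrow> ennreal \<Rightarrow> (real \<Rightarrow> real^'n) measure" where
  "right_filtration M t = sigma (space (path_space M))
     (\<Inter>u\<in>insert \<top> {t<..}. sets (natural_filtration M u))"

lemma space_natural_filtration [simp]: "space (natural_filtration M t) = space (path_space M)"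
  unfolding natural_filtration_def by (rule space_measure_of) auto

lemma sets_right_filtration:
  "sets (right_filtration M t) = (\<Inter>u\<in>insert \<top> {t<..}. sets (natural_filtration M u))"
proof -
  have "sigma_algebra (space (path_space M))
          (\<Inter>u\<in>insert \<top> {t<..}. sets (natural_filtration M u))"
  proof (rule sigma_algebra_iff2[THEN iffD2], intro conjI)
    show "(\<Inter>u\<in>insert \<top> {t<..}. sets (natural_filtration M u)) \<subseteq> Pow (space (path_space M))"
      using sets.space_closed[of "natural_filtration M \<top>"] by auto
  next
    have "space (path_space M) - s \<in> sets (natural_filtration M u)"
      if "s \<in> sets (natural_filtration M u)" for s u
      using sets.compl_sets[OF that] by simp
    then show "\<forall>s\<in>\<Inter>u\<in>insert \<top> {t<..}. sets (natural_filtration M u).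
      space (path_space M) - s \<in> (\<Inter>u\<in>insert \<top> {t<..}. sets (natural_filtration M u))"
      by blast
  qed auto
  then show ?thesis
    unfolding right_filtration_def by (rule sigma_algebra.sets_measure_of_eq)
qed

lemma filtration_right_filtration: "filtration (space (path_space M)) (right_filtration M)"
proof
  show "space (right_filtration M i) = space (path_space M)" for i
    unfolding right_filtration_def using sets.space_closed[of "natural_filtration M \<top>"]
    by (intro space_measure_of) auto
qed (auto simp: sets_right_filtration)

text \<open>
  A conservative Hunt process with continuous paths in \<open>M\<close>, given by its laws \<open>P z\<close> on path space.
  Quasi-left-continuity is automatic for continuous paths, and conservativeness is contained in
  \<open>P z\<close> being a probability measure on paths with infinite lifetime.
\<close>

definition continuous_hunt_process ::
    "(real^'n) set \<Rightarrow> (real^'n \<Rightarrow> (real \<Rightarrow> real^'n) measure) \<Rightarrow> bool" where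
  "continuous_hunt_process M P \<longleftrightarrow>
     P \<in> restrict_space borel M \<rightarrow>\<^sub>M prob_algebra (path_space M)
     \<and> (\<forall>z\<in>M. AE \<omega> in P z. \<omega> 0 = z)
     \<and> (\<forall>z\<in>M. \<forall>\<tau>. stopping_time (right_filtration M) \<tau> \<longrightarrow>
          (\<forall>\<Lambda>\<in>sets (filtration.pre_sigma (space (path_space M)) (right_filtration M) \<tau>).
           \<forall>B\<in>sets (path_space M).
             emeasure (P z) {\<omega> \<in> \<Lambda>. \<tau> \<omega> < \<top> \<and> path_shift (enn2real (\<tau> \<omega>)) \<omega> \<in> B}
             = (\<integral>\<^sup>+\<omega>. indicator {\<omega> \<in> \<Lambda>. \<tau> \<omega> < \<top>} \<omega>
                        * emeasure (P (\<omega> (enn2real (\<tau> \<omega>)))) B \<partial>P z)))"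

definition transition_semigroup ::
    "(real^'n \<Rightarrow> (real \<Rightarrow> real^'n) measure) \<Rightarrow> real \<Rightarrow> (real^'n \<Rightarrow> real) \<Rightarrow> real^'n \<Rightarrow> real" where
  "transition_semigroup P t f x = (LINT \<omega>|P x. f (\<omega> t))"

definition symmetric_process ::
    "(real^'n) set \<Rightarrow> (real^'n \<Rightarrow> (real \<Rightarrow> real^'n) measure) \<Rightarrow> bool" where
  "symmetric_process M P \<longleftrightarrow>
     (\<forall>t\<ge>0. \<forall>f g. L2 (vol M) f \<and> L2 (vol M) g \<longrightarrow>
        (LINT x|vol M. transition_semigroup P t f x * g x)
        = (LINT x|vol M. f x * transition_semigroup P t g x))"

text \<open>
  The Dirichlet form of a symmetric semigroup \<open>T\<^sub>t\<close> is the limit of \<open>\<langle>f - T\<^sub>t f, g\<rangle> / t\<close> as \<open>t\<close>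
  decreases to 0; its domain consists of the \<open>f\<close> for which the limit with \<open>g = f\<close> is finite.
\<close>

definition approx_form ::
    "(real^'n) set \<Rightarrow> (real^'n \<Rightarrow> (real \<Rightarrow> real^'n) measure) \<Rightarrow> real
       \<Rightarrow> (real^'n \<Rightarrow> real) \<Rightarrow> (real^'n \<Rightarrow> real) \<Rightarrow> real" where
  "approx_form M P t f g = (LINT x|vol M. (f x - transition_semigroup P t f x) * g x) / t"

definition associated_neumann_form ::
    "(real^'n) set \<Rightarrow> (real^'n \<Rightarrow> (real \<Rightarrow> real^'n) measure) \<Rightarrow> bool" where
  "associated_neumann_form M P \<longleftrightarrow>
     (\<forall>f. L2 (vol M) f \<longrightarrow>
        (f \<in> sobolev M \<longleftrightarrow> (\<exists>l. ((\<lambda>t. approx_form M P t f f) \<longlongrightarrow> l) (at_right 0))))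
     \<and> (\<forall>f\<in>sobolev M. \<forall>g\<in>sobolev M.
          ((\<lambda>t. approx_form M P t f g) \<longlongrightarrow> dirichlet_form M f g) (at_right 0))"

definition neumann_heat_kernel ::
    "(real^'n) set \<Rightarrow> (real^'n \<Rightarrow> (real \<Rightarrow> real^'n) measure)
       \<Rightarrow> (real \<Rightarrow> real^'n \<Rightarrow> real^'n \<Rightarrow> real) \<Rightarrow> bool" where
  "neumann_heat_kernel M P p \<longleftrightarrow>
     (\<forall>t>0. (\<lambda>(x, y). p t x y) \<in> borel_measurable (vol M \<Otimes>\<^sub>M vol M)
        \<and> (\<forall>x\<in>M. \<forall>y\<in>M. 0 \<le> p t x y \<and> p t x y = p t y x)
        \<and> (\<forall>x\<in>M. distr (P x) (vol M) (\<lambda>\<omega>. \<omega> t) = density (vol M) (\<lambda>y. ennreal (p t x y))))"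

text \<open>
  A Dirichlet form determines its Hunt process only up to an exceptional set of starting points.
  Requiring a transition density from every starting point removes this ambiguity.
\<close>

definition reflected_BM ::
    "(real^'n) set \<Rightarrow> (real^'n \<Rightarrow> (real \<Rightarrow> real^'n) measure) \<Rightarrow> bool" where
  "reflected_BM M P \<longleftrightarrow>
     continuous_hunt_process M P \<and> symmetric_process M P \<and> associated_neumann_form M P
     \<and> (\<exists>p. neumann_heat_kernel M P p)"

definition L2_compact :: "'a measure \<Rightarrow> (('a \<Rightarrow> real) \<Rightarrow> 'a \<Rightarrow> real) \<Rightarrow> bool" where
  "L2_compact \<mu> A \<longleftrightarrow>
     (\<forall>f :: nat \<Rightarrow> 'a \<Rightarrow> real. (\<forall>n. L2 \<mu> (f n) \<and> (LINT x|\<mu>. (f n x)\<^sup>2) \<le> 1) \<longrightarrow>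
        (\<exists>g r. L2 \<mu> g \<and> strict_mono (r :: nat \<Rightarrow> nat)
           \<and> (\<lambda>n. LINT x|\<mu>. (A (f (r n)) x - g x)\<^sup>2) \<longlonglongrightarrow> 0))"

definition admissible_reflecting_domain :: "(real^'n) set \<Rightarrow> bool" where
  "admissible_reflecting_domain M \<longleftrightarrow>
     (\<exists>P. reflected_BM M P
        \<and> (\<forall>P'. reflected_BM M P' \<longrightarrow> (\<forall>z\<in>M. P' z = P z))
        \<and> (\<forall>t>0. L2_compact (vol M) (transition_semigroup P t)))
     \<and> discrete_neumann_spectrum M \<and> positive_spectral_gap M
     \<and> uniform_charts M"


section \<open>Certificates and recovery\<close>

definition thickening :: "'a::metric_space set \<Rightarrow> real \<Rightarrow> 'a set" where
  "thickening S r = {x. infdist x S \<le> r}"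

definition homological_certificate ::
    "'k::field itself \<Rightarrow> nat \<Rightarrow> real \<Rightarrow> (real^'n) set \<Rightarrow> 'i set \<Rightarrow> ('i \<Rightarrow> (real^'n) set) \<Rightarrow> bool" where
  "homological_certificate K q r M I A \<longleftrightarrow>
     finite I \<and> (\<forall>i\<in>I. A i \<subseteq> M \<and> A i \<in> sets lebesgue)
     \<and> (\<forall>T::real. \<forall>\<gamma>. 0 \<le> T \<and> continuous_on {0..T} \<gamma> \<and> \<gamma> ` {0..T} \<subseteq> M
           \<and> (\<forall>i\<in>I. \<gamma> ` {0..T} \<inter> A i \<noteq> {})
           \<longrightarrow> homology_iso K q (thickening (\<gamma> ` {0..T}) r) M)"

definition full_homological_certificate ::
    "'k::field itself \<Rightarrow> real \<Rightarrow> (real^'n) set \<Rightarrow> 'i set \<Rightarrow> ('i \<Rightarrow> (real^'n) set) \<Rightarrow> bool" where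
  "full_homological_certificate K r M I A \<longleftrightarrow>
     (\<forall>q\<le>CARD('n). homological_certificate K q r M I A)"

definition kappa :: "nat \<Rightarrow> real \<Rightarrow> real" where
  "kappa d \<epsilon> = (if d = 2 then inverse (ln (inverse \<epsilon>)) else \<epsilon> ^ (d - 2))"

text \<open>
  The recovery event is not evidently measurable, so its probability is understood as an inner
  probability; on measurable events this is the ordinary probability.
\<close>

definition inner_prob :: "'a measure \<Rightarrow> 'a set \<Rightarrow> real" where
  "inner_prob N A = Sup {measure N E | E. E \<in> sets N \<and> E \<subseteq> A}"

lemma (in prob_space) inner_prob_measurable:
  assumes "A \<in> sets M"
  shows "inner_prob M A = prob A"
  unfolding inner_prob_def
  by (rule cSup_eq_maximum) (use assms in \<open>auto intro: finite_measure_mono\<close>)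

end

theory Submission
  imports Defs
begin

text \<open>
  A path that meets every ball of the certificate recovers the homology, so the theorem is a
  statement about hitting times: by a union bound over the \<open>m\<close> balls it is enough that each of them
  is missed until time \<open>T\<close> with probability at most \<open>\<delta> / m\<close>. This follows from one uniform estimate:
  within a time \<open>t\<^sub>1\<close> that does not depend on \<open>\<epsilon>\<close>, the process hits a given ball of radius \<open>\<epsilon>\<close> with
  probability at least \<open>c \<kappa>\<^sub>d(\<epsilon>)\<close>, from every starting point. Over \<open>j\<close> consecutive blocks of length
  \<open>t\<^sub>1\<close> the ball is then missed with probability at most \<open>(1 - c \<kappa>\<^sub>d(\<epsilon>)) ^ j\<close>. Iterating blocks leaves
  no multiplicative constant in front of the exponential, which matters because for \<open>m = 1\<close> and
  \<open>\<delta>\<close> close to 1 the time \<open>T\<close> exceeds \<open>C s\<^sub>0\<close> only slightly (\<open>uniform_hitting_bound\<close>,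
  \<open>recovery_of_hitting_bound\<close>).

  The first part of a block is spent on mixing. A bounded transition density makes the semigroup at
  time \<open>s \<ge> s\<^sub>0\<close> bounded from \<open>L\<^sup>1\<close> to \<open>L\<^sup>\<infinity>\<close>. Together with compactness, and with the fact that only
  constants have zero energy, this makes it a strict contraction on functions of mean zero
  (\<open>spectral_gap\<close>), and after a fixed time the law of the process dominates half of the volume
  measure (\<open>minorization\<close>). It remains to bound from below the probability, started from the volume
  measure, of hitting the ball in unit time.

  For this the process is observed on the dyadic grids \<open>2\<^sup>-\<^sup>n \<int>\<close> only. The hitting probabilities then
  satisfy a recursion in terms of the semigroup, and they increase with \<open>n\<close>. Started from the
  stationary measure, the probability that the first visit falls on the \<open>k\<close>-th grid point does not
  increase with \<open>k\<close>; hence the discrete Dirichlet energy of the hitting function is at most its mean.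
  In the limit this gives a function \<open>u\<close> with \<open>u = 1\<close> on the ball and \<open>\<E>(u, u) \<le> \<integral>u\<close>
  (\<open>dyadic_hit_limit\<close>, \<open>hit_limit_energy_bounded\<close>).

  Finally every such \<open>u\<close> has \<open>\<integral>u \<ge> c \<kappa>\<^sub>d(\<epsilon>)\<close>, which is a lower bound for a capacity
  (\<open>small_ball_capacity\<close>). The charts provide, from every point of \<open>M\<close>, a Lipschitz path along which
  \<open>M\<close> contains balls of radius proportional to the distance travelled
  (\<open>uniform_inward_paths_of_charts\<close>). Average \<open>u\<close> against bumps that travel along this path and grow
  with the balls. The average is of order 1 on the small ball, and at scale 1 it is at most a
  constant times \<open>\<integral>u\<close>; the difference of two consecutive averages is an integral of \<open>\<nabla>u\<close> against a
  field of size \<open>t\<^sup>1\<^sup>-\<^sup>d\<close> on a ball of radius \<open>t\<close>. By the Cauchy-Schwarz inequality the total difference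
  is at most a constant times the root of \<open>\<E>(u, u) \<Sum> t\<^sup>2\<^sup>-\<^sup>d\<close>, where \<open>t\<close> runs through the geometric
  scales between \<open>\<epsilon>\<close> and 1, and this sum is comparable to \<open>1 / \<kappa>\<^sub>d(\<epsilon>)\<close>.
\<close>

section \<open>Symmetric Markov semigroups and their energy\<close>

definition bounded_measurable :: "'a measure \<Rightarrow> ('a \<Rightarrow> real) \<Rightarrow> bool" where
  "bounded_measurable \<mu> f \<longleftrightarrow> f \<in> borel_measurable \<mu> \<and> (\<exists>c. \<forall>x\<in>space \<mu>. \<bar>f x\<bar> \<le> c)"

lemma bounded_measurableI:
  assumes "f \<in> borel_measurable \<mu>" "\<And>x. x \<in> space \<mu> \<Longrightarrow> \<bar>f x\<bar> \<le> c"
  shows "bounded_measurable \<mu> f"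
  using assms unfolding bounded_measurable_def by blast

lemma bounded_measurableD [measurable_dest]:
  "bounded_measurable \<mu> f \<Longrightarrow> f \<in> borel_measurable \<mu>"
  unfolding bounded_measurable_def by blast

lemma bounded_measurable_const [simp, intro]: "bounded_measurable \<mu> (\<lambda>_. c)"
  by (rule bounded_measurableI[of _ _ "\<bar>c\<bar>"]) auto

lemma bounded_measurable_add [intro]:
  assumes "bounded_measurable \<mu> f" "bounded_measurable \<mu> g"
  shows "bounded_measurable \<mu> (\<lambda>x. f x + g x)"
proof -
  obtain c d where "\<forall>x\<in>space \<mu>. \<bar>f x\<bar> \<le> c" "\<forall>x\<in>space \<mu>. \<bar>g x\<bar> \<le> d"
    using assms unfolding bounded_measurable_def by blast
  then have "\<bar>f x + g x\<bar> \<le> c + d" if "x \<in> space \<mu>" for x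
    using that by (fastforce intro: order_trans[OF abs_triangle_ineq] add_mono)
  moreover have "(\<lambda>x. f x + g x) \<in> borel_measurable \<mu>"
    using assms[THEN bounded_measurableD] by measurable
  ultimately show ?thesis by (rule bounded_measurableI[rotated])
qed

lemma bounded_measurable_mult [intro]:
  assumes "bounded_measurable \<mu> f" "bounded_measurable \<mu> g"
  shows "bounded_measurable \<mu> (\<lambda>x. f x * g x)"
proof -
  obtain c d where c: "\<forall>x\<in>space \<mu>. \<bar>f x\<bar> \<le> c" "\<forall>x\<in>space \<mu>. \<bar>g x\<bar> \<le> d"
    using assms unfolding bounded_measurable_def by blast
  have "\<bar>f x * g x\<bar> \<le> c * d" if "x \<in> space \<mu>" for x
    unfolding abs_mult using c that by (intro mult_mono) (auto intro: order_trans[OF abs_ge_zero])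
  moreover have "(\<lambda>x. f x * g x) \<in> borel_measurable \<mu>"
    using assms[THEN bounded_measurableD] by measurable
  ultimately show ?thesis by (rule bounded_measurableI[rotated])
qed

lemma bounded_measurable_diff [intro]:
  assumes "bounded_measurable \<mu> f" "bounded_measurable \<mu> g"
  shows "bounded_measurable \<mu> (\<lambda>x. f x - g x)"
  using bounded_measurable_add[OF assms(1) bounded_measurable_mult[OF bounded_measurable_const[of \<mu> "-1"] assms(2)]]
  by simp

lemma bounded_measurable_power2 [intro]:
  "bounded_measurable \<mu> f \<Longrightarrow> bounded_measurable \<mu> (\<lambda>x. (f x)\<^sup>2)"
  unfolding power2_eq_square by blast

lemma bounded_measurable_abs [intro]:
  "bounded_measurable \<mu> f \<Longrightarrow> bounded_measurable \<mu> (\<lambda>x. \<bar>f x\<bar>)"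
  unfolding bounded_measurable_def by auto

lemmas bounded_measurable_intros =
  bounded_measurable_const bounded_measurable_add bounded_measurable_diff
  bounded_measurable_mult bounded_measurable_power2 bounded_measurable_abs

lemma (in finite_measure) bounded_measurable_integrable [intro]:
  assumes "bounded_measurable M f" shows "integrable M f"
proof -
  obtain c where "\<forall>x\<in>space M. \<bar>f x\<bar> \<le> c" using assms unfolding bounded_measurable_def by blast
  then show ?thesis
    using assms[THEN bounded_measurableD] by (intro integrable_const_bound[of _ c]) auto
qed

text \<open>
  The variance is nonnegative.
\<close>

lemma (in prob_space) integral_square_le:
  assumes "integrable M f" "integrable M (\<lambda>x. (f x :: real)\<^sup>2)"
  shows "(\<integral>x. f x \<partial>M)\<^sup>2 \<le> (\<integral>x. (f x)\<^sup>2 \<partial>M)"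
  using variance_positive[of f] variance_eq[OF assms] by simp

lemma (in prob_space) bounded_limit:
  assumes F: "\<And>n. bounded_measurable M (F n)" and C: "\<And>n x. x \<in> space M \<Longrightarrow> \<bar>F n x\<bar> \<le> C"
    and lim: "\<And>x. x \<in> space M \<Longrightarrow> (\<lambda>n. F n x) \<longlonglongrightarrow> f x"
  shows "bounded_measurable M f" "(\<lambda>n. \<integral>x. F n x \<partial>M) \<longlonglongrightarrow> (\<integral>x. f x \<partial>M)"
    "(\<lambda>n. \<integral>x. (F n x)\<^sup>2 \<partial>M) \<longlonglongrightarrow> (\<integral>x. (f x)\<^sup>2 \<partial>M)"
proof -
  note F_meas [measurable] = F[THEN bounded_measurableD]
  have f_meas [measurable]: "f \<in> borel_measurable M"
    by (rule borel_measurable_LIMSEQ_real[OF lim F_meas])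
  have "\<bar>f x\<bar> \<le> C" if "x \<in> space M" for x
    using LIMSEQ_le_const2[OF tendsto_rabs[OF lim[OF that]]] C[OF that] by blast
  with f_meas show "bounded_measurable M f" by (rule bounded_measurableI)
  show "(\<lambda>n. \<integral>x. F n x \<partial>M) \<longlonglongrightarrow> (\<integral>x. f x \<partial>M)"
    by (rule integral_dominated_convergence[where w = "\<lambda>_. C"]) (use lim C in auto)
  have "(F n x)\<^sup>2 \<le> C\<^sup>2" if "x \<in> space M" for n x
    using C[OF that, of n] abs_le_square_iff by fastforce
  then show "(\<lambda>n. \<integral>x. (F n x)\<^sup>2 \<partial>M) \<longlonglongrightarrow> (\<integral>x. (f x)\<^sup>2 \<partial>M)"
    by (intro integral_dominated_convergence[where w = "\<lambda>_. C\<^sup>2"]) (use lim in \<open>auto intro!: tendsto_power\<close>)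
qed

text \<open>
  The axioms speak of bounded measurable functions only and hold at every point of the space, not
  merely almost everywhere. This suits a process started at a point, whose hitting probabilities are
  defined everywhere. The last axiom is bounded convergence.
\<close>

locale symmetric_markov_semigroup = prob_space \<mu> for \<mu> :: "'a measure" +
  fixes T :: "real \<Rightarrow> ('a \<Rightarrow> real) \<Rightarrow> 'a \<Rightarrow> real"
  assumes T_bounded [intro]: "0 \<le> t \<Longrightarrow> bounded_measurable \<mu> f \<Longrightarrow> bounded_measurable \<mu> (T t f)"
    and T_linear: "0 \<le> t \<Longrightarrow> bounded_measurable \<mu> f \<Longrightarrow> bounded_measurable \<mu> g \<Longrightarrow> x \<in> space \<mu>
        \<Longrightarrow> T t (\<lambda>y. a * f y + b * g y) x = a * T t f x + b * T t g x"
    and T_nonneg: "0 \<le> t \<Longrightarrow> bounded_measurable \<mu> f \<Longrightarrow> (\<And>y. y \<in> space \<mu> \<Longrightarrow> 0 \<le> f y)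
        \<Longrightarrow> x \<in> space \<mu> \<Longrightarrow> 0 \<le> T t f x"
    and T_one: "0 \<le> t \<Longrightarrow> x \<in> space \<mu> \<Longrightarrow> T t (\<lambda>_. 1) x = 1"
    and T_zero: "bounded_measurable \<mu> f \<Longrightarrow> x \<in> space \<mu> \<Longrightarrow> T 0 f x = f x"
    and T_add: "0 \<le> s \<Longrightarrow> 0 \<le> t \<Longrightarrow> bounded_measurable \<mu> f \<Longrightarrow> x \<in> space \<mu>
        \<Longrightarrow> T s (T t f) x = T (s + t) f x"
    and T_symmetric: "0 \<le> t \<Longrightarrow> bounded_measurable \<mu> f \<Longrightarrow> bounded_measurable \<mu> g
        \<Longrightarrow> (\<integral>x. T t f x * g x \<partial>\<mu>) = (\<integral>x. f x * T t g x \<partial>\<mu>)"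
    and T_tendsto: "0 \<le> t \<Longrightarrow> (\<And>n. bounded_measurable \<mu> (F n)) \<Longrightarrow> bounded_measurable \<mu> f
        \<Longrightarrow> (\<And>n y. y \<in> space \<mu> \<Longrightarrow> \<bar>F n y\<bar> \<le> c)
        \<Longrightarrow> (\<And>y. y \<in> space \<mu> \<Longrightarrow> (\<lambda>n. F n y) \<longlonglongrightarrow> f y)
        \<Longrightarrow> x \<in> space \<mu> \<Longrightarrow> (\<lambda>n. T t (F n) x) \<longlonglongrightarrow> T t f x"
begin

lemma T_diff:
  assumes "0 \<le> t" "bounded_measurable \<mu> f" "bounded_measurable \<mu> g" "x \<in> space \<mu>"
  shows "T t (\<lambda>y. f y - g y) x = T t f x - T t g x"
  using T_linear[OF assms, of 1 "-1"] by simp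

lemma T_mono:
  assumes "0 \<le> t" "bounded_measurable \<mu> f" "bounded_measurable \<mu> g"
    and "\<And>y. y \<in> space \<mu> \<Longrightarrow> f y \<le> g y" "x \<in> space \<mu>"
  shows "T t f x \<le> T t g x"
  using T_nonneg[of t "\<lambda>y. g y - f y" x] T_diff[of t g f x] assms by auto

lemma T_cong:
  assumes "0 \<le> t" "bounded_measurable \<mu> f" "bounded_measurable \<mu> g"
    and "\<And>y. y \<in> space \<mu> \<Longrightarrow> f y = g y" "x \<in> space \<mu>"
  shows "T t f x = T t g x"
  by (intro order_antisym T_mono) (use assms in auto)

lemma T_scale:
  assumes "0 \<le> t" "bounded_measurable \<mu> f" "x \<in> space \<mu>"
  shows "T t (\<lambda>y. c * f y) x = c * T t f x"
  using T_linear[OF assms(1,2,2,3), of c 0] by simp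

lemma T_const: "0 \<le> t \<Longrightarrow> x \<in> space \<mu> \<Longrightarrow> T t (\<lambda>_. c) x = c"
  using T_scale[of t "\<lambda>_. 1" x c] by (simp add: T_one)

lemma T_abs_le:
  assumes "0 \<le> t" "bounded_measurable \<mu> f" "\<And>y. y \<in> space \<mu> \<Longrightarrow> \<bar>f y\<bar> \<le> c" "x \<in> space \<mu>"
  shows "\<bar>T t f x\<bar> \<le> c"
proof -
  have "T t (\<lambda>_. - c) x \<le> T t f x"
    using assms by (intro T_mono) (auto simp: abs_le_iff minus_le_iff)
  moreover have "T t f x \<le> T t (\<lambda>_. c) x"
    using assms by (intro T_mono) (auto simp: abs_le_iff)
  ultimately show ?thesis using assms by (simp add: T_const)
qed

lemma integral_T:
  assumes "0 \<le> t" "bounded_measurable \<mu> f"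
  shows "(\<integral>x. T t f x \<partial>\<mu>) = (\<integral>x. f x \<partial>\<mu>)"
proof -
  have "(\<integral>x. f x * T t (\<lambda>_. 1) x \<partial>\<mu>) = (\<integral>x. f x * 1 \<partial>\<mu>)"
    by (rule Bochner_Integration.integral_cong) (auto simp: T_one assms)
  then show ?thesis
    using T_symmetric[OF assms(1,2), of "\<lambda>_. 1"] by simp
qed

text \<open>
  Jensen's inequality, by applying \<open>T t\<close> to \<open>(f - c)\<^sup>2\<close> with the constant \<open>c = T t f x\<close>.
\<close>

lemma T_square_le:
  assumes "0 \<le> t" "bounded_measurable \<mu> f" "x \<in> space \<mu>"
  shows "(T t f x)\<^sup>2 \<le> T t (\<lambda>y. (f y)\<^sup>2) x"
proof -
  let ?c = "T t f x"
  \<comment> \<open>The factors 1 give both sides the shape required by the linearity axiom.\<close>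
  have bm: "bounded_measurable \<mu> (\<lambda>y. 1 * (f y)\<^sup>2 + (- 2 * ?c) * f y)"
    using assms by (intro bounded_measurable_add bounded_measurable_mult) auto
  have "T t (\<lambda>y. (f y - ?c)\<^sup>2) x
      = T t (\<lambda>y. 1 * (1 * (f y)\<^sup>2 + (- 2 * ?c) * f y) + ?c\<^sup>2 * 1) x"
  proof (rule T_cong)
    show "bounded_measurable \<mu> (\<lambda>y. 1 * (1 * (f y)\<^sup>2 + (- 2 * ?c) * f y) + ?c\<^sup>2 * 1)"
      using bm assms by (intro bounded_measurable_add bounded_measurable_mult) auto
    show "bounded_measurable \<mu> (\<lambda>y. (f y - ?c)\<^sup>2)"
      using assms by (intro bounded_measurable_power2 bounded_measurable_diff bounded_measurable_const)
  qed (use assms in \<open>auto simp: power2_eq_square algebra_simps\<close>)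
  also have "\<dots> = 1 * T t (\<lambda>y. 1 * (f y)\<^sup>2 + (- 2 * ?c) * f y) x + ?c\<^sup>2 * T t (\<lambda>_. 1) x"
    using assms bm by (intro T_linear) auto
  also have "T t (\<lambda>y. 1 * (f y)\<^sup>2 + (- 2 * ?c) * f y) x = 1 * T t (\<lambda>y. (f y)\<^sup>2) x + (- 2 * ?c) * ?c"
    using assms by (intro T_linear bounded_measurable_power2)
  finally have "T t (\<lambda>y. (f y - ?c)\<^sup>2) x = T t (\<lambda>y. (f y)\<^sup>2) x - ?c\<^sup>2"
    using assms by (simp add: T_one power2_eq_square)
  then show ?thesis
    using T_nonneg[of t "\<lambda>y. (f y - ?c)\<^sup>2" x] assms by (simp add: bounded_measurable_intros)
qed

lemma integral_T_mult_T:
  assumes "0 \<le> s" "0 \<le> t" "bounded_measurable \<mu> f"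
  shows "(\<integral>x. T s f x * T t f x \<partial>\<mu>) = (\<integral>x. f x * T (s + t) f x \<partial>\<mu>)"
proof -
  have "(\<integral>x. T s f x * T t f x \<partial>\<mu>) = (\<integral>x. f x * T s (T t f) x \<partial>\<mu>)"
    using assms by (intro T_symmetric) auto
  also have "\<dots> = (\<integral>x. f x * T (s + t) f x \<partial>\<mu>)"
    by (rule Bochner_Integration.integral_cong) (auto simp: T_add assms)
  finally show ?thesis .
qed

text \<open>
  By symmetry and the semigroup law, \<open>corr f (2 * t)\<close> is the squared \<open>L\<^sup>2\<close>-norm of \<open>T t f\<close>. This is
  the source of its monotonicity and convexity in time.
\<close>

definition corr :: "('a \<Rightarrow> real) \<Rightarrow> real \<Rightarrow> real" where
  "corr f t = (\<integral>x. f x * T t f x \<partial>\<mu>)"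

lemma corr_zero: "bounded_measurable \<mu> f \<Longrightarrow> corr f 0 = (\<integral>x. (f x)\<^sup>2 \<partial>\<mu>)"
  unfolding corr_def power2_eq_square
  by (rule Bochner_Integration.integral_cong) (auto simp: T_zero)

lemma corr_double:
  assumes "0 \<le> t" "bounded_measurable \<mu> f"
  shows "corr f (2 * t) = (\<integral>x. (T t f x)\<^sup>2 \<partial>\<mu>)"
  using integral_T_mult_T[OF assms(1,1,2)] by (simp add: corr_def power2_eq_square)

lemma integral_T_square_le:
  assumes "0 \<le> t" "bounded_measurable \<mu> f"
  shows "(\<integral>x. (T t f x)\<^sup>2 \<partial>\<mu>) \<le> (\<integral>x. (f x)\<^sup>2 \<partial>\<mu>)"
proof -
  have "(\<integral>x. (T t f x)\<^sup>2 \<partial>\<mu>) \<le> (\<integral>x. T t (\<lambda>y. (f y)\<^sup>2) x \<partial>\<mu>)"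
    using assms by (intro integral_mono bounded_measurable_integrable) (auto intro: T_square_le)
  also have "\<dots> = (\<integral>x. (f x)\<^sup>2 \<partial>\<mu>)" using assms by (intro integral_T) auto
  finally show ?thesis .
qed

lemma corr_antimono:
  assumes "0 \<le> s" "s \<le> t" "bounded_measurable \<mu> f"
  shows "corr f t \<le> corr f s"
proof -
  have "T (t / 2) f x = T ((t - s) / 2) (T (s / 2) f) x" if "x \<in> space \<mu>" for x
    using that assms by (simp add: T_add field_simps)
  then have "corr f t = (\<integral>x. (T ((t - s) / 2) (T (s / 2) f) x)\<^sup>2 \<partial>\<mu>)"
    using corr_double[of "t / 2" f] assms by (auto intro: Bochner_Integration.integral_cong)
  also have "\<dots> \<le> (\<integral>x. (T (s / 2) f x)\<^sup>2 \<partial>\<mu>)"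
    using assms by (intro integral_T_square_le) auto
  also have "\<dots> = corr f s" using corr_double[of "s / 2" f] assms by simp
  finally show ?thesis .
qed

lemma integral_T_diff_square:
  assumes "0 \<le> s" "0 \<le> t" "bounded_measurable \<mu> f"
  shows "(\<integral>x. (T s f x - T t f x)\<^sup>2 \<partial>\<mu>) = corr f (2 * s) - 2 * corr f (s + t) + corr f (2 * t)"
proof -
  have i: "integrable \<mu> (\<lambda>x. T a f x * T b f x)" if "0 \<le> a" "0 \<le> b" for a b
    using assms that by auto
  have "(\<integral>x. (T s f x - T t f x)\<^sup>2 \<partial>\<mu>)
      = (\<integral>x. T s f x * T s f x - 2 * (T s f x * T t f x) + T t f x * T t f x \<partial>\<mu>)"
    by (rule Bochner_Integration.integral_cong) (auto simp: power2_eq_square algebra_simps)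
  also have "\<dots> = (\<integral>x. T s f x * T s f x \<partial>\<mu>) - 2 * (\<integral>x. T s f x * T t f x \<partial>\<mu>)
      + (\<integral>x. T t f x * T t f x \<partial>\<mu>)"
    using assms by (simp add: i)
  finally show ?thesis
    using assms by (simp add: integral_T_mult_T corr_def)
qed

text \<open>
  A convex decreasing function drops fastest in its first step. Midpoint convexity on the grid is
  \<open>integral_T_diff_square\<close>.
\<close>

lemma corr_grid_drop:
  assumes "0 \<le> h" "bounded_measurable \<mu> f"
  shows "corr f 0 - corr f (real k * h) \<le> real k * (corr f 0 - corr f h)"
proof -
  have step: "corr f (real j * h) - corr f (real (Suc j) * h) \<le> corr f 0 - corr f h" for j
  proof (induction j)
    case (Suc j)
    have "0 \<le> (\<integral>x. (T (real j * h / 2) f x - T (real (Suc (Suc j)) * h / 2) f x)\<^sup>2 \<partial>\<mu>)"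
      by simp
    also have "\<dots> = corr f (real j * h) - 2 * corr f (real (Suc j) * h)
        + corr f (real (Suc (Suc j)) * h)"
    proof -
      have "real j * h / 2 + real (Suc (Suc j)) * h / 2 = real (Suc j) * h"
        by (simp add: field_simps)
      then show ?thesis using assms by (subst integral_T_diff_square) auto
    qed
    finally show ?case using Suc by linarith
  qed simp
  show ?thesis
  proof (induction k)
    case (Suc k)
    then show ?case using step[of k] by (simp add: algebra_simps)
  qed simp
qed

text \<open>
  The quotient \<open>loss t f / t\<close> approximates the Dirichlet form of \<open>f\<close>.
\<close>

definition loss :: "real \<Rightarrow> ('a \<Rightarrow> real) \<Rightarrow> real" where
  "loss t f = (\<integral>x. (f x - T t f x) * f x \<partial>\<mu>)"

lemma loss_eq:
  assumes "0 \<le> t" "bounded_measurable \<mu> f"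
  shows "loss t f = corr f 0 - corr f t"
proof -
  have "loss t f = (\<integral>x. f x * f x - f x * T t f x \<partial>\<mu>)"
    unfolding loss_def by (rule Bochner_Integration.integral_cong) (auto simp: algebra_simps)
  also have "\<dots> = corr f 0 - corr f t"
    using assms by (subst Bochner_Integration.integral_diff)
      (auto simp: corr_zero power2_eq_square corr_def[of f t])
  finally show ?thesis .
qed

lemma loss_nonneg: "0 \<le> t \<Longrightarrow> bounded_measurable \<mu> f \<Longrightarrow> 0 \<le> loss t f"
  using corr_antimono[of 0 t f] by (simp add: loss_eq)

text \<open>
  Up to the factor \<open>(t + s) / t\<close>, which tends to 1 as \<open>s\<close> decreases to 0, the quotient
  \<open>loss s f / s\<close> dominates \<open>loss t f / t\<close>: round \<open>t\<close> up to a multiple of \<open>s\<close>.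
\<close>

lemma loss_le:
  assumes "0 < s" "0 \<le> t" "bounded_measurable \<mu> f"
  shows "s * loss t f \<le> (t + s) * loss s f"
proof -
  define k where "k = nat \<lceil>t / s\<rceil>"
  have k1: "t / s \<le> real k" unfolding k_def by linarith
  have "real k < t / s + 1"
    unfolding k_def using assms by (simp add: of_nat_nat) (use ceiling_correct in linarith)
  then have k2: "real k * s \<le> t + s" using assms by (simp add: field_simps)
  have "t \<le> real k * s" using k1 assms by (simp add: field_simps)
  then have "loss t f \<le> corr f 0 - corr f (real k * s)"
    using corr_antimono[of t "real k * s" f] assms by (simp add: loss_eq)
  also have "\<dots> \<le> real k * loss s f" using corr_grid_drop[of s f k] assms by (simp add: loss_eq)
  finally have "s * loss t f \<le> s * (real k * loss s f)" using assms by (intro mult_left_mono) auto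
  also have "\<dots> = (real k * s) * loss s f" by simp
  also have "\<dots> \<le> (t + s) * loss s f"
    using k2 assms by (intro mult_right_mono loss_nonneg) auto
  finally show ?thesis .
qed

text \<open>
  The limit is the supremum of the quotients, by \<open>loss_le\<close>.
\<close>

lemma loss_quotient_tendsto:
  assumes f: "bounded_measurable \<mu> f" and K: "\<And>t. 0 < t \<Longrightarrow> loss t f / t \<le> K"
  obtains l where "((\<lambda>t. loss t f / t) \<longlongrightarrow> l) (at_right 0)" "l \<le> K"
proof -
  define S where "S = (SUP t\<in>{0<..}. loss t f / t)"
  have bdd: "bdd_above ((\<lambda>t. loss t f / t) ` {0<..})" using K by (auto intro!: bdd_aboveI[of _ K])
  have le: "loss t f / t \<le> S" if "0 < t" for t
    unfolding S_def using that bdd by (intro cSUP_upper) auto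
  have "S \<le> K" unfolding S_def using K by (intro cSUP_least) auto
  moreover have "((\<lambda>t. loss t f / t) \<longlongrightarrow> S) (at_right 0)"
  proof (rule order_tendstoI)
    fix b assume "S < b"
    then have "loss t f / t < b" if "0 < t" for t using le[OF that] by linarith
    then show "\<forall>\<^sub>F t in at_right 0. loss t f / t < b"
      by (auto simp: eventually_at_filter intro!: always_eventually)
  next
    fix b assume "b < S"
    then obtain t where t: "0 < t" "b < loss t f / t"
      unfolding S_def by (subst (asm) less_cSUP_iff) (use bdd in auto)
    have "((\<lambda>s. loss t f / (t + s)) \<longlongrightarrow> loss t f / (t + 0)) (at_right 0)"
      using t by (intro tendsto_intros) auto
    then have "\<forall>\<^sub>F s in at_right 0. b < loss t f / (t + s)"
      using t by (intro order_tendstoD) auto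
    moreover have "\<forall>\<^sub>F s in at_right 0. (0::real) < s" by (simp add: eventually_at_right_less)
    ultimately show "\<forall>\<^sub>F s in at_right 0. b < loss s f / s"
    proof eventually_elim
      case (elim s)
      have "loss t f / (t + s) \<le> loss s f / s"
        using loss_le[of s t f] f t elim by (simp add: field_simps)
      then show ?case using elim by simp
    qed
  qed
  ultimately show ?thesis using that by blast
qed


end


section \<open>Hitting a set on a time grid\<close>

context symmetric_markov_semigroup
begin

text \<open>
  \<open>hit h B k x\<close> is the probability that the process started at \<open>x\<close> is in \<open>B\<close> at one of the times
  \<open>0, h, \<dots>, k h\<close>, computed by conditioning on the first step.
\<close>

primrec hit :: "real \<Rightarrow> 'a set \<Rightarrow> nat \<Rightarrow> 'a \<Rightarrow> real" where
  "hit h B 0 = indicat_real B"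
| "hit h B (Suc k) = (\<lambda>x. if x \<in> B then 1 else T h (hit h B k) x)"

lemma hit_target: "x \<in> B \<Longrightarrow> hit h B k x = 1"
  by (cases k) auto

context
  fixes h :: real and B :: "'a set"
  assumes h: "0 \<le> h" and B: "B \<in> sets \<mu>"
begin

lemma hit_bounded_aux:
  "bounded_measurable \<mu> (hit h B k) \<and> (\<forall>x\<in>space \<mu>. 0 \<le> hit h B k x \<and> hit h B k x \<le> 1)"
proof (induction k)
  case 0
  have "bounded_measurable \<mu> (hit h B 0)"
    by (rule bounded_measurableI[of _ _ 1])
      (use B in \<open>auto simp: indicator_def intro!: borel_measurable_indicator\<close>)
  then show ?case by auto
next
  case (Suc k)
  have "0 \<le> T h (hit h B k) x" if "x \<in> space \<mu>" for x
    using that h Suc by (intro T_nonneg) auto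
  moreover have "T h (hit h B k) x \<le> T h (\<lambda>_. 1) x" if "x \<in> space \<mu>" for x
    using that h Suc by (intro T_mono) auto
  ultimately have range: "0 \<le> hit h B (Suc k) x \<and> hit h B (Suc k) x \<le> 1" if "x \<in> space \<mu>" for x
    using that h by (auto simp: T_one)
  have "T h (hit h B k) \<in> borel_measurable \<mu>"
    using Suc h by (intro bounded_measurableD T_bounded) auto
  then have "bounded_measurable \<mu> (hit h B (Suc k))"
    using range B by (intro bounded_measurableI[of _ _ 1]) auto
  then show ?case using range by blast
qed

lemma hit_bounded_measurable [intro]: "bounded_measurable \<mu> (hit h B k)"
  and hit_range: "x \<in> space \<mu> \<Longrightarrow> 0 \<le> hit h B k x \<and> hit h B k x \<le> 1"
  using hit_bounded_aux by auto

lemma T_hit_le_hit_Suc: "x \<in> space \<mu> \<Longrightarrow> T h (hit h B k) x \<le> hit h B (Suc k) x"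
  using T_mono[of h "hit h B k" "\<lambda>_. 1" x] hit_range h by (auto simp: T_one)

lemma hit_le_Suc: "x \<in> space \<mu> \<Longrightarrow> hit h B k x \<le> hit h B (Suc k) x"
proof (induction k arbitrary: x)
  case 0
  then show ?case using hit_range[of x 1] by (auto simp: indicator_def)
next
  case (Suc k)
  then have "T h (hit h B k) x \<le> T h (hit h B (Suc k)) x"
    using h by (intro T_mono hit_bounded_measurable) auto
  then show ?case using Suc.prems by (auto simp: hit_target)
qed

text \<open>
  The left side ignores visits during the first \<open>j\<close> steps.
\<close>

lemma T_hit_le_hit: 
  "x \<in> space \<mu> \<Longrightarrow> T (real j * h) (hit h B k) x \<le> hit h B (j + k) x"
proof (induction j arbitrary: x)
  case 0
  then show ?case by (simp add: T_zero hit_bounded_measurable)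
next
  case (Suc j)
  have "T (real (Suc j) * h) (hit h B k) x = T h (T (real j * h) (hit h B k)) x"
    using h Suc.prems by (simp add: T_add hit_bounded_measurable algebra_simps)
  also have "\<dots> \<le> T h (hit h B (j + k)) x"
    using Suc h by (intro T_mono T_bounded hit_bounded_measurable) auto
  also have "\<dots> \<le> hit h B (Suc j + k) x" using T_hit_le_hit_Suc[OF Suc.prems] by simp
  finally show ?case .
qed

text \<open>
  After \<open>j\<close> steps without a visit, \<open>k\<close> further steps succeed with probability at least \<open>\<alpha>\<close>, wherever
  the process is.
\<close>

lemma miss_submultiplicative:
  assumes \<alpha>: "\<And>x. x \<in> space \<mu> \<Longrightarrow> \<alpha> \<le> hit h B k x" and x: "x \<in> space \<mu>"
  shows "1 - hit h B (j + k) x \<le> (1 - \<alpha>) * (1 - hit h B j x)"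
  using x
proof (induction j arbitrary: x)
  case 0
  then show ?case using \<alpha>[of x] by (auto simp: indicator_def hit_target)
next
  case (Suc j)
  show ?case
  proof (cases "x \<in> B")
    case False
    let ?u = "hit h B (j + k)" and ?v = "hit h B j"
    have "T h (\<lambda>y. (1 - \<alpha>) * (1 - ?v y) - (1 - ?u y)) x \<ge> 0"
      using Suc h by (intro T_nonneg bounded_measurable_diff bounded_measurable_mult) auto
    moreover have "T h (\<lambda>y. (1 - \<alpha>) * (1 - ?v y) - (1 - ?u y)) x
        = (1 - \<alpha>) * (1 - T h ?v x) - (1 - T h ?u x)"
      using h Suc.prems by (simp add: T_diff T_scale T_const bounded_measurable_diff
          bounded_measurable_mult hit_bounded_measurable)
    ultimately show ?thesis using False by simp
  qed (simp add: hit_target)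
qed

lemma miss_le_power:
  assumes \<alpha>: "\<And>x. x \<in> space \<mu> \<Longrightarrow> \<alpha> \<le> hit h B k x" and x: "x \<in> space \<mu>"
  shows "1 - hit h B (j * k) x \<le> (1 - \<alpha>) ^ j"
proof (induction j)
  case 0
  then show ?case by (simp add: indicator_def)
next
  case (Suc j)
  have "\<alpha> \<le> 1" using \<alpha>[OF x] hit_range[OF x, of k] by linarith
  then have "(1 - \<alpha>) * (1 - hit h B (j * k) x) \<le> (1 - \<alpha>) * (1 - \<alpha>) ^ j"
    using Suc by (intro mult_left_mono) auto
  then show ?case
    using miss_submultiplicative[OF \<alpha> x, of "j * k"] by (simp add: add.commute)
qed

text \<open>
  The increment is the stationary probability of a first visit at a given step. Off \<open>B\<close> the next
  increment is \<open>T h\<close> applied to the present one, and \<open>T h\<close> preserves integrals.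
\<close>

lemma hit_increments_antimono:
  "(\<integral>x. hit h B (Suc (Suc k)) x \<partial>\<mu>) - (\<integral>x. hit h B (Suc k) x \<partial>\<mu>)
     \<le> (\<integral>x. hit h B (Suc k) x \<partial>\<mu>) - (\<integral>x. hit h B k x \<partial>\<mu>)"
proof -
  let ?u = "hit h B"
  note [simp] = bounded_measurable_integrable[OF hit_bounded_measurable]
    bounded_measurable_integrable[OF T_bounded[OF h hit_bounded_measurable]]
  have "(\<integral>x. ?u (Suc (Suc k)) x - ?u (Suc k) x \<partial>\<mu>) \<le> (\<integral>x. T h (?u (Suc k)) x - T h (?u k) x \<partial>\<mu>)"
  proof (rule integral_mono)
    fix x assume x: "x \<in> space \<mu>"
    have "T h (?u k) x \<le> T h (?u (Suc k)) x"
      using x h hit_le_Suc by (intro T_mono hit_bounded_measurable)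
    then show "?u (Suc (Suc k)) x - ?u (Suc k) x \<le> T h (?u (Suc k)) x - T h (?u k) x"
      by (cases "x \<in> B") (simp_all del: hit.simps(2) add: hit_target, simp)
  qed (simp_all del: hit.simps)
  then show ?thesis
    by (simp add: integral_T[OF h hit_bounded_measurable] del: hit.simps)
qed

text \<open>
  Each of the \<open>k\<close> earlier increments is at least as large as this one.
\<close>

lemma hit_increment_le:
  "real k * ((\<integral>x. hit h B (Suc k) x \<partial>\<mu>) - (\<integral>x. hit h B k x \<partial>\<mu>)) \<le> (\<integral>x. hit h B k x \<partial>\<mu>)"
proof -
  define I where "I k = (\<integral>x. hit h B k x \<partial>\<mu>)" for k
  have anti: "I (Suc (Suc k)) - I (Suc k) \<le> I (Suc k) - I k" for k
    unfolding I_def by (rule hit_increments_antimono)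
  have "real k * (I (Suc k) - I k) \<le> I k - I 0"
  proof (induction k)
    case (Suc k)
    have "real (Suc k) * (I (Suc (Suc k)) - I (Suc k)) \<le> real (Suc k) * (I (Suc k) - I k)"
      using anti by (intro mult_left_mono) auto
    then show ?case using Suc by (simp add: algebra_simps)
  qed simp
  moreover have "0 \<le> I 0" unfolding I_def by simp
  ultimately show ?thesis unfolding I_def by linarith
qed

text \<open>
  The hitting function is subharmonic off \<open>B\<close>, so only the points of \<open>B\<close>, where it equals 1,
  contribute to its energy. Their contribution is the probability of leaving \<open>B\<close>, in one stationary
  step, to a point from which \<open>k\<close> steps do not lead back. It is the next increment.
\<close>

lemma loss_hit_le:
  "loss h (hit h B k) \<le> (\<integral>x. hit h B (Suc k) x \<partial>\<mu>) - (\<integral>x. hit h B k x \<partial>\<mu>)"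
proof -
  let ?u = "hit h B k"
  note [simp] = bounded_measurable_integrable[OF hit_bounded_measurable]
    bounded_measurable_integrable[OF T_bounded[OF h hit_bounded_measurable]]
  have "loss h ?u \<le> (\<integral>x. hit h B (Suc k) x - T h ?u x \<partial>\<mu>)"
    unfolding loss_def
  proof (rule integral_mono)
    show "integrable \<mu> (\<lambda>x. (?u x - T h ?u x) * ?u x)"
      using h by (intro bounded_measurable_integrable bounded_measurable_mult
          bounded_measurable_diff T_bounded hit_bounded_measurable)
    fix x assume x: "x \<in> space \<mu>"
    show "(?u x - T h ?u x) * ?u x \<le> hit h B (Suc k) x - T h ?u x"
    proof (cases "x \<in> B")
      case False
      then have "?u x - T h ?u x \<le> 0" using hit_le_Suc[OF x, of k] by simp
      then show ?thesis using False hit_range[OF x, of k] by (simp add: mult_nonpos_nonneg)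
    qed (simp add: hit_target)
  qed (simp_all del: hit.simps)
  then show ?thesis
    by (simp add: integral_T[OF h hit_bounded_measurable] del: hit.simps)
qed

end

text \<open>
  Every second point of the finer grid belongs to the coarser one.
\<close>

lemma hit_refine:
  assumes h: "0 \<le> h" and B: "B \<in> sets \<mu>" and x: "x \<in> space \<mu>"
  shows "hit h B k x \<le> hit (h / 2) B (2 * k) x"
  using x
proof (induction k arbitrary: x)
  case (Suc k)
  let ?v = "hit (h / 2) B"
  have h2: "0 \<le> h / 2" using h by simp
  note bm = hit_bounded_measurable[OF h2 B] hit_bounded_measurable[OF h B]
  have "T h (hit h B k) x \<le> T h (?v (2 * k)) x"
    using h Suc by (intro T_mono bm)
  also have "T h (?v (2 * k)) x = T (real 2 * (h / 2)) (?v (2 * k)) x" by simp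
  also have "\<dots> \<le> ?v (2 + 2 * k) x" by (rule T_hit_le_hit[OF h2 B Suc.prems])
  finally show ?case by (cases "x \<in> B") (simp_all add: hit_target)
qed simp

text \<open>
  The pointwise limit of the hitting functions for the grids of mesh \<open>2\<^sup>-\<^sup>n\<close> on the unit time
  interval. For mesh \<open>h = 1 / k\<close> the energy quotient is \<open>k * loss h\<close>, which is at most the mean by the
  two preceding estimates, and \<open>loss_le\<close> carries this bound over to a fixed time \<open>t\<close> before the
  limit in \<open>n\<close> is taken.
\<close>

lemma dyadic_hit_limit:
  assumes B: "B \<in> sets \<mu>"
  obtains u where "bounded_measurable \<mu> u"
    and "\<forall>x\<in>space \<mu>. 0 \<le> u x \<and> u x \<le> 1" and "\<forall>x\<in>B. u x = 1"
    and "(\<lambda>n. \<integral>x. hit (1 / 2 ^ n) B (2 ^ n) x \<partial>\<mu>) \<longlonglongrightarrow> (\<integral>x. u x \<partial>\<mu>)"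
    and "\<forall>t>0. loss t u / t \<le> (\<integral>x. u x \<partial>\<mu>)"
proof -
  define v where "v n = hit (1 / 2 ^ n) B (2 ^ n)" for n
  define u where "u x = lim (\<lambda>n. v n x)" for x
  have bm: "bounded_measurable \<mu> (v n)" for n
    unfolding v_def using B by (intro hit_bounded_measurable) auto
  have range: "0 \<le> v n x \<and> v n x \<le> 1" if "x \<in> space \<mu>" for n x
    unfolding v_def by (rule hit_range[OF _ B that]) simp
  have "v n x \<le> v (Suc n) x" if "x \<in> space \<mu>" for n x
    using hit_refine[OF _ B that, of "1 / 2 ^ n" "2 ^ n"] by (simp add: v_def mult.commute)
  then have inc: "incseq (\<lambda>n. v n x)" if "x \<in> space \<mu>" for x
    using that by (intro incseq_SucI)
  have lim: "(\<lambda>n. v n x) \<longlonglongrightarrow> u x" if "x \<in> space \<mu>" for x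
    unfolding u_def
    by (metis convergent_LIMSEQ_iff incseq_convergent[OF inc[OF that], of 1] range that convergent_def)
  have u_range: "0 \<le> u x \<and> u x \<le> 1" if "x \<in> space \<mu>" for x
    using LIMSEQ_le_const[OF lim[OF that]] LIMSEQ_le_const2[OF lim[OF that]] range[OF that] by blast
  have v_le: "\<bar>v n x\<bar> \<le> 1" if "x \<in> space \<mu>" for n x using range[OF that, of n] by auto
  note u = bounded_limit(1)[OF bm v_le lim] and lim_int = bounded_limit(2)[OF bm v_le lim]
  have lim_loss: "(\<lambda>n. loss t (v n)) \<longlonglongrightarrow> loss t u" if t: "0 < t" for t
    unfolding loss_def
  proof (rule integral_dominated_convergence[where w = "\<lambda>_. 1"])
    have "T t (v n) x \<le> T t (\<lambda>_. 1) x" "0 \<le> T t (v n) x" if "x \<in> space \<mu>" for n x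
      using that t range by (intro T_mono T_nonneg bm; auto)+
    then have "\<bar>v n x - T t (v n) x\<bar> * \<bar>v n x\<bar> \<le> 1 * 1" if "x \<in> space \<mu>" for n x
      using that range[OF that, of n] t
      by (intro mult_mono) (auto simp: T_one abs_le_iff, (smt (verit))+)
    then show "AE x in \<mu>. norm ((v n x - T t (v n) x) * v n x) \<le> 1" for n
      by (auto simp: abs_mult)
    have "(\<lambda>n. T t (v n) x) \<longlonglongrightarrow> T t u x" if "x \<in> space \<mu>" for x
      by (rule T_tendsto[where c = 1]) (use t bm u range lim that in auto)
    then show "AE x in \<mu>. (\<lambda>n. (v n x - T t (v n) x) * v n x) \<longlonglongrightarrow> (u x - T t u x) * u x"
      using lim by (auto intro!: tendsto_intros)
  qed (use t bm u in \<open>auto intro!: bounded_measurableD bounded_measurable_intros T_bounded\<close>)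
  have "loss t u / t \<le> (\<integral>x. u x \<partial>\<mu>)" if t: "0 < t" for t
  proof -
    have "loss t (v n) \<le> (t + 1 / 2 ^ n) * (\<integral>x. v n x \<partial>\<mu>)" for n
    proof -
      let ?h = "1 / 2 ^ n :: real"
      have "real (2 ^ n) * loss ?h (v n) \<le> real (2 ^ n) * ((\<integral>x. hit ?h B (Suc (2 ^ n)) x \<partial>\<mu>) - (\<integral>x. v n x \<partial>\<mu>))"
        unfolding v_def using B by (intro mult_left_mono loss_hit_le) auto
      also have "\<dots> \<le> (\<integral>x. v n x \<partial>\<mu>)"
        unfolding v_def using B by (intro hit_increment_le) auto
      finally have 1: "real (2 ^ n) * loss ?h (v n) \<le> (\<integral>x. v n x \<partial>\<mu>)" .
      have "loss t (v n) \<le> (t + ?h) * (2 ^ n * loss ?h (v n))"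
        using mult_left_mono[OF loss_le[of ?h t "v n"], of "2 ^ n"] t bm
        by (simp add: algebra_simps)
      also have "\<dots> \<le> (t + ?h) * (\<integral>x. v n x \<partial>\<mu>)"
        using 1 t by (intro mult_left_mono) auto
      finally show ?thesis .
    qed
    moreover have "(\<lambda>n. (t + 1 / 2 ^ n) * (\<integral>x. v n x \<partial>\<mu>)) \<longlonglongrightarrow> (t + 0) * (\<integral>x. u x \<partial>\<mu>)"
      by (intro tendsto_intros lim_int) (rule LIMSEQ_divide_realpow_zero, simp)
    ultimately have "loss t u \<le> (t + 0) * (\<integral>x. u x \<partial>\<mu>)"
      using lim_loss[OF t] by (intro LIMSEQ_le) auto
    then show ?thesis using t by (simp add: field_simps)
  qed
  moreover have "u x = 1" if "x \<in> B" for x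
    using that lim[of x] sets.sets_into_space[OF B] LIMSEQ_unique[of "\<lambda>n. v n x" "u x" 1]
    by (auto simp: v_def hit_target)
  ultimately show ?thesis
    using that[of u] u u_range lim_int unfolding v_def by blast
qed

end


section \<open>Mixing\<close>

context symmetric_markov_semigroup
begin

text \<open>
  By monotonicity the correlation is constant up to time \<open>2 * s\<close>, so \<open>T t f\<close> and \<open>f\<close> have the same
  norm and their inner product is its square.
\<close>

lemma norm_preserved_imp_invariant:
  assumes f: "bounded_measurable \<mu> f" and norm: "(\<integral>x. (f x)\<^sup>2 \<partial>\<mu>) \<le> (\<integral>x. (T s f x)\<^sup>2 \<partial>\<mu>)"
    and t: "0 \<le> t" "t \<le> s"
  shows "AE x in \<mu>. T t f x = f x"
proof -
  have eq: "corr f t' = corr f 0" if t': "0 \<le> t'" "t' \<le> 2 * s" for t'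
  proof (rule antisym)
    have "corr f 0 \<le> corr f (2 * s)" using norm t f by (simp add: corr_zero corr_double)
    also have "\<dots> \<le> corr f t'" using t' f by (intro corr_antimono)
    finally show "corr f 0 \<le> corr f t'" .
  qed (use t' f corr_antimono in auto)
  have "(\<integral>x. (T t f x - T 0 f x)\<^sup>2 \<partial>\<mu>) = 0"
    using t eq[of "2 * t"] eq[of t] integral_T_diff_square[OF t(1) order_refl f] by simp
  moreover have "integrable \<mu> (\<lambda>x. (T t f x - T 0 f x)\<^sup>2)"
    using t f by (intro bounded_measurable_integrable bounded_measurable_intros T_bounded) auto
  ultimately have "AE x in \<mu>. (T t f x - T 0 f x)\<^sup>2 = 0"
    by (subst (asm) integral_nonneg_eq_0_iff_AE) auto
  then show ?thesis
    by (rule AE_mp) (auto intro!: AE_I2 simp: T_zero f)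
qed

context
  fixes s a :: real
  assumes s: "0 < s"
    and ultracontractive: "\<And>f x. bounded_measurable \<mu> f \<Longrightarrow> x \<in> space \<mu>
        \<Longrightarrow> \<bar>T s f x\<bar> \<le> a * (\<integral>y. \<bar>f y\<bar> \<partial>\<mu>)"
begin

lemma ultracontractive_constant: "1 \<le> a"
proof -
  obtain x where x: "x \<in> space \<mu>" using not_empty by blast
  then show ?thesis
    using ultracontractive[OF bounded_measurable_const x, of 1] s by (simp add: prob_space T_one)
qed

text \<open>
  On a probability space the \<open>L\<^sup>1\<close>-norm is at most the \<open>L\<^sup>2\<close>-norm.
\<close>

lemma ultracontractive_L2:
  assumes f: "bounded_measurable \<mu> f" and x: "x \<in> space \<mu>" and K: "(\<integral>y. (f y)\<^sup>2 \<partial>\<mu>) \<le> K"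
  shows "\<bar>T s f x\<bar> \<le> a * sqrt K"
proof -
  have "(\<integral>y. \<bar>f y\<bar> \<partial>\<mu>)\<^sup>2 \<le> (\<integral>y. (f y)\<^sup>2 \<partial>\<mu>)"
    using integral_square_le[of "\<lambda>y. \<bar>f y\<bar>"] f by auto
  then have "(\<integral>y. \<bar>f y\<bar> \<partial>\<mu>) \<le> sqrt K" using K by (intro real_le_rsqrt) simp
  then have "a * (\<integral>y. \<bar>f y\<bar> \<partial>\<mu>) \<le> a * sqrt K"
    using ultracontractive_constant by (intro mult_left_mono) auto
  then show ?thesis using ultracontractive[OF f x] by linarith
qed

text \<open>
  The first step gives a Cauchy sequence in \<open>L\<^sup>2\<close>, the second turns it into pointwise ones. The limit
  \<open>g\<close> itself need not be bounded, so the second step is applied to differences of the sequence only.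
\<close>

lemma second_step_converges:
  assumes F: "\<And>n. bounded_measurable \<mu> (F n)"
    and g: "g \<in> borel_measurable \<mu>" "integrable \<mu> (\<lambda>x. (g x)\<^sup>2)"
    and lim: "(\<lambda>n. \<integral>x. (T s (F n) x - g x)\<^sup>2 \<partial>\<mu>) \<longlonglongrightarrow> 0" and x: "x \<in> space \<mu>"
  shows "convergent (\<lambda>n. T (2 * s) (F n) x)"
proof -
  define e where "e n = (\<integral>x. (T s (F n) x - g x)\<^sup>2 \<partial>\<mu>)" for n
  have TF: "bounded_measurable \<mu> (T s (F n))" for n using s F by auto
  have i: "integrable \<mu> (\<lambda>x. (T s (F n) x - g x)\<^sup>2)" for n
  proof (rule Bochner_Integration.integrable_bound)
    show "integrable \<mu> (\<lambda>x. 2 * (T s (F n) x)\<^sup>2 + 2 * (g x)\<^sup>2)"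
      using g(2) bounded_measurable_integrable[OF bounded_measurable_power2[OF TF]] by simp
    have "(p - c)\<^sup>2 \<le> 2 * p\<^sup>2 + 2 * c\<^sup>2" for p c :: real
      using zero_le_power2[of "p + c"] by (simp add: power2_eq_square algebra_simps)
    then show "AE x in \<mu>. norm ((T s (F n) x - g x)\<^sup>2) \<le> norm (2 * (T s (F n) x)\<^sup>2 + 2 * (g x)\<^sup>2)"
      by simp
    show "(\<lambda>x. (T s (F n) x - g x)\<^sup>2) \<in> borel_measurable \<mu>"
      using TF[THEN bounded_measurableD] g by measurable
  qed
  have close: "\<bar>T (2 * s) (F n) x - T (2 * s) (F m) x\<bar> \<le> a * sqrt (2 * e n + 2 * e m)" for n m
  proof -
    define w where "w = (\<lambda>y. T s (F n) y - T s (F m) y)"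
    have w: "bounded_measurable \<mu> w" unfolding w_def using TF by (intro bounded_measurable_intros)
    have "(\<integral>y. (w y)\<^sup>2 \<partial>\<mu>) \<le> (\<integral>y. 2 * (T s (F n) y - g y)\<^sup>2 + 2 * (T s (F m) y - g y)\<^sup>2 \<partial>\<mu>)"
    proof (rule integral_mono)
      fix y
      have "((p - c) - (q - c))\<^sup>2 \<le> 2 * (p - c)\<^sup>2 + 2 * (q - c)\<^sup>2" for p q c :: real
        using zero_le_power2[of "(p - c) + (q - c)"] by (simp add: power2_eq_square algebra_simps)
      then show "(w y)\<^sup>2 \<le> 2 * (T s (F n) y - g y)\<^sup>2 + 2 * (T s (F m) y - g y)\<^sup>2"
        by (simp add: w_def)
    qed (use w i in auto)
    also have "\<dots> = 2 * e n + 2 * e m" using i by (simp add: e_def)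
    finally have "\<bar>T s w x\<bar> \<le> a * sqrt (2 * e n + 2 * e m)" by (rule ultracontractive_L2[OF w x])
    moreover have "T s w x = T (2 * s) (F n) x - T (2 * s) (F m) x"
      unfolding w_def using s F x by (simp add: T_diff T_add T_bounded)
    ultimately show ?thesis by simp
  qed
  have "Cauchy (\<lambda>n. T (2 * s) (F n) x)"
  proof (rule CauchyI)
    fix \<epsilon> :: real assume \<epsilon>: "0 < \<epsilon>"
    have "0 < \<epsilon> / a" using \<epsilon> ultracontractive_constant by simp
    then have "\<forall>\<^sub>F n in sequentially. e n < (\<epsilon> / a)\<^sup>2 / 4"
      using lim unfolding e_def by (intro order_tendstoD) auto
    then obtain N where N: "\<And>n. N \<le> n \<Longrightarrow> e n < (\<epsilon> / a)\<^sup>2 / 4"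
      by (auto simp: eventually_sequentially)
    have "norm (T (2 * s) (F n) x - T (2 * s) (F m) x) < \<epsilon>" if "N \<le> n" "N \<le> m" for n m
    proof -
      have "2 * e n + 2 * e m < (\<epsilon> / a)\<^sup>2" using N[OF that(1)] N[OF that(2)] by linarith
      then have "sqrt (2 * e n + 2 * e m) < \<epsilon> / a" using \<open>0 < \<epsilon> / a\<close> by (intro real_less_lsqrt) auto
      then have "a * sqrt (2 * e n + 2 * e m) < \<epsilon>"
        using ultracontractive_constant by (simp add: field_simps)
      then show ?thesis using close[of n m] by simp
    qed
    then show "\<exists>N. \<forall>n\<ge>N. \<forall>m\<ge>N. norm (T (2 * s) (F n) x - T (2 * s) (F m) x) < \<epsilon>" by blast
  qed
  then show ?thesis by (simp add: Cauchy_convergent_iff)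
qed

text \<open>
  If the contraction were not strict, there would be functions \<open>F n\<close> of mean zero and norm 1 with the
  norm of \<open>T s (F n)\<close> tending to 1. By convexity of \<open>corr\<close>, a fixed number of further steps does not
  lower the norms in the limit either. Along a subsequence \<open>T (2 * s) (F n)\<close> converges to a bounded
  function \<open>f\<close> of mean zero and norm 1, whose norm is preserved by \<open>T s\<close>. It is therefore invariant,
  hence constant, which is absurd.
\<close>

lemma spectral_gap:
  assumes compact: "\<And>F :: nat \<Rightarrow> 'a \<Rightarrow> real.
        (\<And>n. bounded_measurable \<mu> (F n)) \<Longrightarrow> (\<And>n. (\<integral>x. (F n x)\<^sup>2 \<partial>\<mu>) \<le> 1)
        \<Longrightarrow> \<exists>g r. g \<in> borel_measurable \<mu> \<and> integrable \<mu> (\<lambda>x. (g x)\<^sup>2) \<and> strict_mono (r :: nat \<Rightarrow> nat)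
              \<and> (\<lambda>n. \<integral>x. (T s (F (r n)) x - g x)\<^sup>2 \<partial>\<mu>) \<longlonglongrightarrow> 0"
    and irreducible: "\<And>f. bounded_measurable \<mu> f \<Longrightarrow> (\<And>t. 0 \<le> t \<Longrightarrow> t \<le> s \<Longrightarrow> AE x in \<mu>. T t f x = f x)
        \<Longrightarrow> \<exists>c. AE x in \<mu>. f x = c"
  shows "\<exists>\<rho>\<ge>0. \<rho> < 1 \<and> (\<forall>f. bounded_measurable \<mu> f \<longrightarrow> (\<integral>x. f x \<partial>\<mu>) = 0
        \<longrightarrow> (\<integral>x. (T s f x)\<^sup>2 \<partial>\<mu>) \<le> \<rho> * (\<integral>x. (f x)\<^sup>2 \<partial>\<mu>))"
proof (rule ccontr)
  assume "\<not> ?thesis"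
  then have "\<exists>f. bounded_measurable \<mu> f \<and> (\<integral>x. f x \<partial>\<mu>) = 0
      \<and> \<rho> * (\<integral>x. (f x)\<^sup>2 \<partial>\<mu>) < (\<integral>x. (T s f x)\<^sup>2 \<partial>\<mu>)" if "0 \<le> \<rho>" "\<rho> < 1" for \<rho>
    using that by (meson not_le)
  from this[of "1 - 1 / real (Suc n)" for n]
  have "\<forall>n. \<exists>f. bounded_measurable \<mu> f \<and> (\<integral>x. f x \<partial>\<mu>) = 0
      \<and> (1 - 1 / real (Suc n)) * (\<integral>x. (f x)\<^sup>2 \<partial>\<mu>) < (\<integral>x. (T s f x)\<^sup>2 \<partial>\<mu>)"
    by auto
  then obtain G where G: "bounded_measurable \<mu> (G n)" "(\<integral>x. G n x \<partial>\<mu>) = 0"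
      "(1 - 1 / real (Suc n)) * (\<integral>x. (G n x)\<^sup>2 \<partial>\<mu>) < (\<integral>x. (T s (G n) x)\<^sup>2 \<partial>\<mu>)" for n
    by metis
  define q where "q n = (\<integral>x. (G n x)\<^sup>2 \<partial>\<mu>)" for n
  define F where "F n = (\<lambda>x. 1 / sqrt (q n) * G n x)" for n
  have "0 \<le> q n" for n unfolding q_def by simp
  moreover have "q n \<noteq> 0" for n
    using integral_T_square_le[of s "G n"] G(1,3)[of n] s by (auto simp: q_def)
  ultimately have q: "0 < q n" for n by (simp add: less_le)
  have F: "bounded_measurable \<mu> (F n)" for n
    unfolding F_def using G(1) by (intro bounded_measurable_intros)
  have F_norm: "corr (F n) 0 = 1" for n
  proof -
    have "corr (F n) 0 = (1 / sqrt (q n))\<^sup>2 * q n"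
      unfolding corr_zero[OF F] by (simp add: F_def power_mult_distrib q_def power_divide)
    then show ?thesis using q[of n] by (simp add: power_divide)
  qed
  have F_slow: "1 - 1 / real (Suc n) \<le> corr (F n) (2 * s)" for n
  proof -
    have "corr (F n) (2 * s) = (\<integral>x. (1 / sqrt (q n) * T s (G n) x)\<^sup>2 \<partial>\<mu>)"
      unfolding corr_double[OF less_imp_le[OF s] F]
    proof (rule Bochner_Integration.integral_cong)
      show "(T s (F n) x)\<^sup>2 = (1 / sqrt (q n) * T s (G n) x)\<^sup>2" if "x \<in> space \<mu>" for x
        unfolding F_def by (subst T_scale[OF less_imp_le[OF s] G(1) that]) (rule refl)
    qed simp
    also have "\<dots> = (\<integral>x. (T s (G n) x)\<^sup>2 \<partial>\<mu>) / q n"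
      using q[of n] by (simp add: power_mult_distrib power_divide)
    finally show ?thesis
      using G(3)[of n] pos_le_divide_eq[OF q[of n]] unfolding q_def[symmetric] by (simp only: less_imp_le)
  qed
  \<comment> \<open>Convexity of the correlation: \<open>k\<close> double steps lose at most \<open>k\<close> times as much as one.\<close>
  have F_slow': "1 - real k / real (Suc n) \<le> corr (F n) (real k * (2 * s))" for n k
  proof -
    have "1 - corr (F n) (real k * (2 * s)) \<le> real k * (1 - corr (F n) (2 * s))"
      using corr_grid_drop[of "2 * s" "F n" k] s F F_norm by simp
    also have "\<dots> \<le> real k * (1 / real (Suc n))"
      using F_slow[of n] by (intro mult_left_mono) linarith+
    finally show ?thesis by simp
  qed
  have F_le: "\<And>n. (\<integral>x. (F n x)\<^sup>2 \<partial>\<mu>) \<le> 1" using F_norm corr_zero[OF F] by simp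
  note ex = compact[of F, OF F F_le]
  obtain g r where g: "g \<in> borel_measurable \<mu>" "integrable \<mu> (\<lambda>x. (g x)\<^sup>2)"
    and r: "strict_mono (r :: nat \<Rightarrow> nat)"
    and conv: "(\<lambda>n. \<integral>x. (T s (F (r n)) x - g x)\<^sup>2 \<partial>\<mu>) \<longlonglongrightarrow> 0"
    using ex by (elim exE conjE) (rule that)
  define H where "H n = T (2 * s) (F (r n))" for n
  define f where "f x = lim (\<lambda>n. H n x)" for x
  have H: "bounded_measurable \<mu> (H n)" for n unfolding H_def using s F by auto
  have H_lim: "(\<lambda>n. H n x) \<longlonglongrightarrow> f x" if "x \<in> space \<mu>" for x
    using second_step_converges[OF F g conv that] by (simp add: H_def f_def convergent_LIMSEQ_iff)
  have H_le: "\<bar>H n x\<bar> \<le> a" if x: "x \<in> space \<mu>" for n x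
  proof -
    have TF: "bounded_measurable \<mu> (T s (F (r n)))" using s F by auto
    have "H n x = T s (T s (F (r n))) x" using s F x by (simp add: H_def T_add)
    moreover have "(\<integral>y. (T s (F (r n)) y)\<^sup>2 \<partial>\<mu>) \<le> 1"
      using integral_T_square_le[OF less_imp_le[OF s] F, of "r n"] F_le[of "r n"] by linarith
    from ultracontractive_L2[OF TF x this] have "\<bar>T s (T s (F (r n))) x\<bar> \<le> a" by simp
    ultimately show ?thesis by simp
  qed
  have f: "bounded_measurable \<mu> f" by (rule bounded_limit(1)[OF H H_le H_lim])
  have T_lim: "(\<lambda>n. \<integral>x. (T (real j * s) (H n) x)\<^sup>2 \<partial>\<mu>) \<longlonglongrightarrow> (\<integral>x. (T (real j * s) f x)\<^sup>2 \<partial>\<mu>)" for j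
  proof (rule bounded_limit(3))
    have js: "0 \<le> real j * s" using s by simp
    show "bounded_measurable \<mu> (T (real j * s) (H n))" for n using H js by auto
    show "\<bar>T (real j * s) (H n) x\<bar> \<le> a" if "x \<in> space \<mu>" for n x
      by (rule T_abs_le[OF js H H_le that])
    show "(\<lambda>n. T (real j * s) (H n) x) \<longlonglongrightarrow> T (real j * s) f x" if "x \<in> space \<mu>" for x
      by (rule T_tendsto[OF js H f H_le H_lim that])
  qed
  \<comment> \<open>The case \<open>j = 0\<close> concerns the norm of \<open>f\<close>, the case \<open>j = 1\<close> that of \<open>T s f\<close>.\<close>
  have norm1: "1 \<le> (\<integral>x. (T (real j * s) f x)\<^sup>2 \<partial>\<mu>)" for j
  proof -
    have "(\<lambda>n. 1 - real (j + 2) / real (Suc (r n))) \<longlonglongrightarrow> 1 - 0"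
      using r by (intro tendsto_intros
          LIMSEQ_subseq_LIMSEQ[OF lim_const_over_n[of "real (j+2)", THEN LIMSEQ_Suc] r, unfolded comp_def])
    moreover have "1 - real (j + 2) / real (Suc (r n)) \<le> (\<integral>x. (T (real j * s) (H n) x)\<^sup>2 \<partial>\<mu>)" for n
    proof -
      have "1 - real (j + 2) / real (Suc (r n)) \<le> corr (F (r n)) (2 * (real (j + 2) * s))"
        using F_slow'[of "j + 2" "r n"] by (simp add: mult.left_commute)
      also have "\<dots> = (\<integral>x. (T (real (j + 2) * s) (F (r n)) x)\<^sup>2 \<partial>\<mu>)"
        using s F by (intro corr_double) auto
      also have "\<dots> = (\<integral>x. (T (real j * s) (H n) x)\<^sup>2 \<partial>\<mu>)"
        using s F by (intro Bochner_Integration.integral_cong)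
          (auto simp: H_def T_add distrib_right add.commute)
      finally show ?thesis .
    qed
    ultimately have "1 - 0 \<le> (\<integral>x. (T (real j * s) f x)\<^sup>2 \<partial>\<mu>)" using T_lim[of j] by (meson LIMSEQ_le)
    then show ?thesis by simp
  qed
  have mean0: "(\<integral>x. f x \<partial>\<mu>) = 0"
  proof -
    have "(\<integral>x. H n x \<partial>\<mu>) = 0" for n
      unfolding H_def using s F by (simp add: integral_T F_def G(2))
    then show ?thesis using bounded_limit(2)[OF H H_le H_lim] by (simp add: LIMSEQ_const_iff)
  qed
  have "(\<integral>x. (f x)\<^sup>2 \<partial>\<mu>) \<le> 1"
  proof (rule LIMSEQ_le_const2[OF bounded_limit(3)[OF H H_le H_lim]])
    have "(\<integral>x. (H n x)\<^sup>2 \<partial>\<mu>) \<le> 1" for n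
      unfolding H_def using integral_T_square_le[of "2 * s" "F (r n)"] s F F_le[of "r n"] by fastforce
    then show "\<exists>N. \<forall>n\<ge>N. (\<integral>x. (H n x)\<^sup>2 \<partial>\<mu>) \<le> 1" by blast
  qed
  then have norm: "(\<integral>x. (f x)\<^sup>2 \<partial>\<mu>) \<le> (\<integral>x. (T s f x)\<^sup>2 \<partial>\<mu>)" using norm1[of 1] by simp
  have inv: "AE x in \<mu>. T t f x = f x" if "0 \<le> t" "t \<le> s" for t
    by (rule norm_preserved_imp_invariant[OF f norm that])
  have "\<exists>c. AE x in \<mu>. f x = c" by (rule irreducible[OF f]) (rule inv)
  then obtain c where c: "AE x in \<mu>. f x = c" by (elim exE) (rule that)
  have "(\<integral>x. f x \<partial>\<mu>) = (\<integral>x. c \<partial>\<mu>)"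
    using c by (intro integral_cong_AE) (auto intro: f[THEN bounded_measurableD])
  then have "c = 0" using mean0 prob_space by simp
  then have "(\<integral>x. (f x)\<^sup>2 \<partial>\<mu>) = (\<integral>x. 0 \<partial>\<mu>)"
    using c f[THEN bounded_measurableD] by (intro integral_cong_AE) auto
  moreover have "1 \<le> (\<integral>x. (f x)\<^sup>2 \<partial>\<mu>)"
    using norm1[of 0] integral_T_square_le[OF order_refl f] by simp
  ultimately show False by simp
qed

text \<open>
  One step brings \<open>v\<close> into \<open>L\<^sup>2\<close> with norm at most a multiple of its integral, \<open>k\<close> steps shrink the
  deviation from the mean geometrically, and the last step turns the \<open>L\<^sup>2\<close>-bound into a pointwise
  one. For large \<open>k\<close> the deviation is at most half of the mean.
\<close>

lemma minorization:
  assumes \<rho>: "0 \<le> \<rho>" "\<rho> < 1"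
    and gap: "\<And>f. bounded_measurable \<mu> f \<Longrightarrow> (\<integral>x. f x \<partial>\<mu>) = 0
        \<Longrightarrow> (\<integral>x. (T s f x)\<^sup>2 \<partial>\<mu>) \<le> \<rho> * (\<integral>x. (f x)\<^sup>2 \<partial>\<mu>)"
  shows "\<exists>n. \<forall>v. bounded_measurable \<mu> v \<longrightarrow> (\<forall>y\<in>space \<mu>. 0 \<le> v y)
      \<longrightarrow> (\<forall>x\<in>space \<mu>. (\<integral>y. v y \<partial>\<mu>) / 2 \<le> T (real n * s) v x)"
proof -
  note a1 = ultracontractive_constant
  \<comment> \<open>Each of the two \<open>L\<^sup>1\<close>-to-\<open>L\<^sup>\<infinity>\<close> steps costs a factor \<open>a\<close>.\<close>
  obtain k where k: "\<rho> ^ k < (1 / (2 * a\<^sup>2))\<^sup>2"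
    using real_arch_pow_inv[of "(1 / (2 * a\<^sup>2))\<^sup>2" \<rho>] \<rho> a1 by auto
  have "(\<integral>y. v y \<partial>\<mu>) / 2 \<le> T (real (k + 2) * s) v x"
    if v: "bounded_measurable \<mu> v" and v0: "\<And>y. y \<in> space \<mu> \<Longrightarrow> 0 \<le> v y" and x: "x \<in> space \<mu>" for v x
  proof -
    define I where "I = (\<integral>y. v y \<partial>\<mu>)"
    have I0: "0 \<le> I" unfolding I_def using v0 by (intro integral_nonneg_AE) auto
    have I_abs: "(\<integral>y. \<bar>v y\<bar> \<partial>\<mu>) = I"
      unfolding I_def using v0 by (intro Bochner_Integration.integral_cong) auto
    define w where "w = (\<lambda>y. T s v y - I)"
    have w: "bounded_measurable \<mu> w"
      unfolding w_def using s v by (intro bounded_measurable_intros T_bounded) auto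
    have Tv: "bounded_measurable \<mu> (T s v)" using s v by auto
    have Tv_mean: "(\<integral>y. T s v y \<partial>\<mu>) = I" using s v by (simp add: integral_T I_def)
    have w_mean: "(\<integral>y. w y \<partial>\<mu>) = 0"
      unfolding w_def using Tv by (subst Bochner_Integration.integral_diff) (auto simp: Tv_mean prob_space)
    have "(\<integral>y. (w y)\<^sup>2 \<partial>\<mu>) \<le> (\<integral>y. (T s v y)\<^sup>2 \<partial>\<mu>)"
      using variance_eq[of "T s v"] Tv bounded_measurable_power2[OF Tv]
      by (simp add: w_def Tv_mean bounded_measurable_integrable)
    also have "\<dots> \<le> (\<integral>y. (a * I)\<^sup>2 \<partial>\<mu>)"
    proof (rule integral_mono)
      fix y assume "y \<in> space \<mu>"
      then have "\<bar>T s v y\<bar> \<le> \<bar>a * I\<bar>" using ultracontractive[OF v, of y] I_abs by simp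
      then show "(T s v y)\<^sup>2 \<le> (a * I)\<^sup>2" by (simp only: abs_le_square_iff)
    qed (use Tv in auto)
    finally have w_norm: "(\<integral>y. (w y)\<^sup>2 \<partial>\<mu>) \<le> (a * I)\<^sup>2" by (simp add: prob_space)
    have decay: "(\<integral>y. (T (real j * s) w y)\<^sup>2 \<partial>\<mu>) \<le> \<rho> ^ j * (a * I)\<^sup>2" for j
    proof (induction j)
      case 0
      have "(\<integral>y. (T 0 w y)\<^sup>2 \<partial>\<mu>) = (\<integral>y. (w y)\<^sup>2 \<partial>\<mu>)"
        by (rule Bochner_Integration.integral_cong) (auto simp: T_zero w)
      then show ?case using w_norm by simp
    next
      case (Suc j)
      have "(\<integral>y. (T (real (Suc j) * s) w y)\<^sup>2 \<partial>\<mu>) = (\<integral>y. (T s (T (real j * s) w) y)\<^sup>2 \<partial>\<mu>)"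
        using s w by (intro Bochner_Integration.integral_cong) (auto simp: T_add distrib_right)
      also have "\<dots> \<le> \<rho> * (\<integral>y. (T (real j * s) w y)\<^sup>2 \<partial>\<mu>)"
        using s w w_mean by (intro gap T_bounded) (auto simp: integral_T)
      also have "\<dots> \<le> \<rho> * (\<rho> ^ j * (a * I)\<^sup>2)" using Suc \<rho> by (intro mult_left_mono)
      finally show ?case by simp
    qed
    define z where "z = T (real k * s) w"
    have z: "bounded_measurable \<mu> z" unfolding z_def using s w by auto
    have "(\<integral>y. (z y)\<^sup>2 \<partial>\<mu>) \<le> \<rho> ^ k * (a * I)\<^sup>2" unfolding z_def by (rule decay)
    also have "\<dots> \<le> (1 / (2 * a\<^sup>2))\<^sup>2 * (a * I)\<^sup>2" using k by (intro mult_right_mono) auto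
    also have "\<dots> = (I / (2 * a))\<^sup>2"
      using a1 by (simp add: power2_eq_square)
    finally have "\<bar>T s z x\<bar> \<le> a * sqrt ((I / (2 * a))\<^sup>2)" by (rule ultracontractive_L2[OF z x])
    also have "\<dots> = I / 2" using a1 I0 by (simp add: real_sqrt_abs)
    finally have "\<bar>T s z x\<bar> \<le> I / 2" .
    moreover have "T s z x = T (real (k + 2) * s) v x - I"
    proof -
      have Iw: "T (s + real k * s) (\<lambda>y. T s v y - I) x = T (s + real k * s) (T s v) x - I"
        using s Tv x by (simp add: T_diff T_const)
      have "T s z x = T (s + real k * s) w x" unfolding z_def using s w x by (simp add: T_add)
      also have "\<dots> = T (real (k + 2) * s) v x - I"
        unfolding w_def Iw using s v x by (simp add: T_add algebra_simps)
      finally show ?thesis .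
    qed
    ultimately show ?thesis unfolding I_def by linarith
  qed
  then show ?thesis by (intro exI[of _ "k + 2"]) simp
qed

end

end


section \<open>Paths into the interior\<close>

text \<open>
  By invariance of domain the image is open. In a slightly smaller concentric ball \<open>?D\<close> the image is
  also closed, since it coincides there with the image of a compact ball: points of the bounding
  sphere are sent outside \<open>?D\<close>. Connectedness of \<open>?D\<close> then gives the claim.
\<close>

lemma ball_subset_image_of_expansion:
  fixes g :: "'a::euclidean_space \<Rightarrow> 'a"
  assumes L: "0 < L" and cont: "continuous_on (ball w s) g"
    and expand: "\<And>a b. a \<in> ball w s \<Longrightarrow> b \<in> ball w s \<Longrightarrow> dist a b \<le> L * dist (g a) (g b)"
  shows "ball (g w) (s / L) \<subseteq> g ` ball w s"
proof
  fix z assume z: "z \<in> ball (g w) (s / L)"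
  then have "L * dist (g w) z < s" using L by (simp add: field_simps)
  then obtain s' where s': "L * dist (g w) z < s'" "s' < s" using dense by blast
  moreover have "0 \<le> L * dist (g w) z" using L by simp
  ultimately have s'0: "0 < s'" by linarith
  let ?D = "ball (g w) (s' / L)"
  have inj: "inj_on g (ball w s)"
    using expand by (intro inj_onI) force
  have sub: "cball w s' \<subseteq> ball w s" "ball w s' \<subseteq> ball w s" using s' by auto
  have eq: "?D \<inter> g ` cball w s' = ?D \<inter> g ` ball w s'"
  proof (intro equalityI subsetI)
    fix v assume "v \<in> ?D \<inter> g ` cball w s'"
    then obtain a where a: "v = g a" "a \<in> cball w s'" "dist (g w) (g a) < s' / L" by auto
    have "dist w a \<le> L * dist (g w) (g a)" using a sub s'0 s' by (intro expand) auto
    also have "\<dots> < s'" using a L by (simp add: field_simps)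
    finally show "v \<in> ?D \<inter> g ` ball w s'" using a by auto
  qed auto
  have "open (g ` ball w s')"
    by (rule invariance_of_domain)
      (use cont inj sub in \<open>auto intro: continuous_on_subset inj_on_subset\<close>)
  then have "openin (top_of_set ?D) (?D \<inter> g ` ball w s')" by (rule openin_open_Int)
  moreover have "closed (g ` cball w s')"
    using cont sub by (intro compact_imp_closed compact_continuous_image continuous_on_subset[OF cont]) auto
  then have "closedin (top_of_set ?D) (?D \<inter> g ` ball w s')"
    unfolding eq[symmetric] by (rule closedin_closed_Int)
  moreover have "g w \<in> ?D \<inter> g ` ball w s'" using s'0 L by auto
  ultimately have "?D \<inter> g ` ball w s' = ?D"
    using connected_ball[of "g w" "s' / L"] unfolding connected_clopen by blast
  moreover have "z \<in> ?D" using s' L by (simp add: field_simps)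
  ultimately show "z \<in> g ` ball w s" using sub by blast
qed

text \<open>
  The balls around the points \<open>c t\<close> form a twisted cone with vertex \<open>c 0\<close>, as for John domains.
\<close>

definition inward_path :: "real \<Rightarrow> real \<Rightarrow> 'a::metric_space set \<Rightarrow> (real \<Rightarrow> 'a) \<Rightarrow> bool" where
  "inward_path \<rho> \<Lambda> M c \<longleftrightarrow>
     (\<forall>s\<in>{0..1}. \<forall>t\<in>{0..1}. dist (c s) (c t) \<le> \<Lambda> * \<bar>s - t\<bar>)
     \<and> (\<forall>t\<in>{0..1}. ball (c t) (\<rho> * t) \<subseteq> M)"

definition uniform_inward_paths :: "real \<Rightarrow> real \<Rightarrow> 'a::metric_space set \<Rightarrow> bool" where
  "uniform_inward_paths \<rho> \<Lambda> M \<longleftrightarrow> (\<forall>y\<in>M. \<exists>c. c 0 = y \<and> inward_path \<rho> \<Lambda> M c)"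

text \<open>
  In the chart the path is the segment from the image of \<open>y\<close> to the centre \<open>p\<close> of a ball inside the
  convex image; by convexity the balls around its points grow linearly.
\<close>

lemma inward_path_in_chart:
  fixes \<Psi> :: "'a::euclidean_space \<Rightarrow> 'a"
  assumes L: "1 \<le> L" and r: "0 < r" and UM: "U \<subseteq> M" and y: "y \<in> U"
    and lip: "\<And>u v. u \<in> U \<Longrightarrow> v \<in> U \<Longrightarrow> dist u v / L \<le> dist (\<Psi> u) (\<Psi> v) \<and> dist (\<Psi> u) (\<Psi> v) \<le> L * dist u v"
    and conv: "convex (\<Psi> ` U)" and core: "ball p r \<subseteq> \<Psi> ` U"
    and D: "\<And>u v. u \<in> M \<Longrightarrow> v \<in> M \<Longrightarrow> dist u v \<le> D"
  shows "\<exists>c. c 0 = y \<and> inward_path (r / L) (L * L * D) M c"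
proof -
  define g where "g = inv_into U \<Psi>"
  have inj: "inj_on \<Psi> U"
  proof (rule inj_onI)
    fix u v assume uv: "u \<in> U" "v \<in> U" "\<Psi> u = \<Psi> v"
    have "dist u v / L \<le> 0" using lip[OF uv(1,2)] uv(3) by simp
    moreover have "0 \<le> dist u v / L" using L by simp
    ultimately have "dist u v / L = 0" by (rule antisym)
    then show "u = v" using L by simp
  qed
  have gU: "g a \<in> U" and \<Psi>g: "\<Psi> (g a) = a" if "a \<in> \<Psi> ` U" for a
    using that by (auto simp: g_def inv_into_into f_inv_into_f)
  have g\<Psi>: "g (\<Psi> u) = u" if "u \<in> U" for u using that inj by (simp add: g_def)
  have upper: "dist (g a) (g b) \<le> L * dist a b" and lower: "dist a b \<le> L * dist (g a) (g b)"
    if "a \<in> \<Psi> ` U" "b \<in> \<Psi> ` U" for a b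
    using lip[OF gU[OF that(1)] gU[OF that(2)]] L that by (simp_all add: \<Psi>g field_simps)
  have cont: "continuous_on (\<Psi> ` U) g"
  proof -
    have "L-lipschitz_on (\<Psi> ` U) g" using upper L by (intro lipschitz_onI) auto
    then show ?thesis by (rule lipschitz_on_continuous_on)
  qed
  define q where "q t = (1 - t) *\<^sub>R \<Psi> y + t *\<^sub>R p" for t :: real
  have pK: "p \<in> \<Psi> ` U" using core r by auto
  have qK: "q t \<in> \<Psi> ` U" if "t \<in> {0..1}" for t
    unfolding q_def using that y pK conv by (intro convexD) auto
  have ballK: "ball (q t) (r * t) \<subseteq> \<Psi> ` U" if t: "t \<in> {0..1}" for t
  proof
    fix v assume v: "v \<in> ball (q t) (r * t)"
    then have "0 < r * t" using ball_eq_empty not_le by blast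
    then have t0: "0 < t" using r zero_less_mult_pos by blast
    define a where "a = p + (1 / t) *\<^sub>R (v - q t)"
    have "dist p a = norm (v - q t) / t" using t0 by (simp add: a_def dist_norm)
    also have "\<dots> < r" using v t0 by (simp add: dist_norm norm_minus_commute field_simps)
    finally have "a \<in> \<Psi> ` U" using core by auto
    moreover have "v = (1 - t) *\<^sub>R \<Psi> y + t *\<^sub>R a"
      using t0 by (simp add: a_def q_def algebra_simps)
    ultimately show "v \<in> \<Psi> ` U" using t y conv by (auto intro: convexD)
  qed
  define c where "c t = g (q t)" for t
  have "dist (c s) (c t) \<le> L * L * D * \<bar>s - t\<bar>" if st: "s \<in> {0..1}" "t \<in> {0..1}" for s t
  proof -
    have "q s - q t = (t - s) *\<^sub>R (\<Psi> y - p)" by (simp add: q_def algebra_simps)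
    then have "dist (q s) (q t) = \<bar>s - t\<bar> * dist (\<Psi> y) p"
      by (simp add: dist_norm abs_minus_commute)
    also have "dist (\<Psi> y) p \<le> L * D"
    proof -
      have "dist (\<Psi> y) p \<le> L * dist (g (\<Psi> y)) (g p)" using y pK by (intro lower) auto
      also have "\<dots> \<le> L * D" using L y pK gU UM by (intro mult_left_mono D) (auto simp: g\<Psi>)
      finally show ?thesis .
    qed
    finally have "dist (q s) (q t) \<le> \<bar>s - t\<bar> * (L * D)" by (simp add: mult_left_mono)
    then have "L * dist (q s) (q t) \<le> L * (\<bar>s - t\<bar> * (L * D))" using L by (intro mult_left_mono) auto
    then show ?thesis using upper[OF qK[OF st(1)] qK[OF st(2)]] by (simp add: c_def mult_ac)
  qed
  moreover have "ball (c t) (r / L * t) \<subseteq> M" if t: "t \<in> {0..1}" for t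
  proof -
    have "ball (g (q t)) (r * t / L) \<subseteq> g ` ball (q t) (r * t)"
    proof (rule ball_subset_image_of_expansion)
      show "continuous_on (ball (q t) (r * t)) g"
        using cont ballK[OF t] by (rule continuous_on_subset)
      show "dist a b \<le> L * dist (g a) (g b)" if "a \<in> ball (q t) (r * t)" "b \<in> ball (q t) (r * t)" for a b
        using that ballK[OF t] by (intro lower) blast+
    qed (use L in simp)
    also have "\<dots> \<subseteq> M" using ballK[OF t] gU UM by blast
    finally show ?thesis by (simp add: c_def)
  qed
  moreover have "c 0 = y" using y by (simp add: c_def q_def g\<Psi>)
  ultimately show ?thesis unfolding inward_path_def by blast
qed

lemma closed_domain_compact: "closed_domain M \<Longrightarrow> compact M"
  unfolding closed_domain_def by auto

lemma closed_domain_nonempty: "closed_domain M \<Longrightarrow> interior M \<noteq> {}"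
  unfolding closed_domain_def by (metis closure_subset interior_maximal subset_empty)

lemma half_ball_convex_with_interior:
  fixes c e :: "'a::euclidean_space"
  assumes R: "0 < R" and e: "norm e = 1"
  defines "K \<equiv> {v \<in> ball c R. 0 \<le> (v - c) \<bullet> e}"
  shows "convex K \<and> (\<exists>p r. 0 < r \<and> ball p r \<subseteq> K)"
proof -
  have "{v. 0 \<le> (v - c) \<bullet> e} = {v. e \<bullet> c \<le> e \<bullet> v}"
    by (auto simp: inner_diff_left inner_diff_right inner_commute)
  moreover have "K = ball c R \<inter> {v. 0 \<le> (v - c) \<bullet> e}" by (auto simp: K_def)
  ultimately have "convex K" by (simp add: convex_Int convex_halfspace_ge)
  \<comment> \<open>The centre lies halfway between the flat face and the pole of the half-ball.\<close>
  moreover have "ball (c + (R / 2) *\<^sub>R e) (R / 4) \<subseteq> K"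
  proof
    fix v assume "v \<in> ball (c + (R / 2) *\<^sub>R e) (R / 4)"
    then have v: "norm (v - (c + (R / 2) *\<^sub>R e)) < R / 4" by (simp add: dist_norm norm_minus_commute)
    have "norm (v - c) \<le> norm (v - (c + (R / 2) *\<^sub>R e)) + norm ((R / 2) *\<^sub>R e)"
      using norm_triangle_ineq[of "v - c - (R / 2) *\<^sub>R e" "(R / 2) *\<^sub>R e"]
      by (simp add: diff_diff_eq)
    then have "norm (v - c) < R" using v e R by simp
    moreover have "\<bar>(v - (c + (R / 2) *\<^sub>R e)) \<bullet> e\<bar> \<le> norm (v - (c + (R / 2) *\<^sub>R e)) * norm e"
      by (rule Cauchy_Schwarz_ineq2)
    then have "\<bar>(v - c) \<bullet> e - R / 2\<bar> < R / 4"
      using v e by (simp add: inner_diff_left inner_add_left norm_eq_1 diff_diff_eq)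
    then have "0 \<le> (v - c) \<bullet> e" using R by linarith
    ultimately show "v \<in> K" by (simp add: K_def dist_norm norm_minus_commute)
  qed
  ultimately show ?thesis using R by (metis divide_pos_pos zero_less_numeral)
qed

text \<open>
  All that the construction of paths uses of a ball or half-ball: it is convex, with interior points.
\<close>

lemma convex_charts:
  fixes M :: "(real^'n) set"
  assumes "uniform_charts M"
  shows "\<exists>L\<ge>1. \<forall>x\<in>M. \<exists>U (\<Psi> :: real^'n \<Rightarrow> real^'n). x \<in> U \<and> openin (top_of_set M) U
    \<and> (\<forall>u\<in>U. \<forall>v\<in>U. dist u v / L \<le> dist (\<Psi> u) (\<Psi> v) \<and> dist (\<Psi> u) (\<Psi> v) \<le> L * dist u v)
    \<and> convex (\<Psi> ` U) \<and> (\<exists>p r. 0 < r \<and> ball p r \<subseteq> \<Psi> ` U)"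
proof -
  from assms obtain \<rho> L J where "1 \<le> L" and all: "\<forall>x\<in>M. \<exists>U (\<Psi> :: real^'n \<Rightarrow> real^'n).
      x \<in> U \<and> openin (top_of_set M) U
      \<and> (\<forall>u\<in>U. \<forall>v\<in>U. dist u v / L \<le> dist (\<Psi> u) (\<Psi> v) \<and> dist (\<Psi> u) (\<Psi> v) \<le> L * dist u v)
      \<and> jacobian_bounded J U \<Psi> \<and> jacobian_bounded J (\<Psi> ` U) (inv_into U \<Psi>)
      \<and> (\<rho> \<le> infdist x (frontier M) \<longrightarrow> (\<exists>c. \<exists>R>0. \<Psi> ` U = ball c R))
      \<and> (infdist x (frontier M) < \<rho> \<longrightarrow>
           (\<exists>c e. \<exists>R>0. norm e = 1 \<and> \<Psi> ` U = {v \<in> ball c R. 0 \<le> (v - c) \<bullet> e}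
              \<and> \<Psi> ` (U \<inter> frontier M) \<subseteq> {v. (v - c) \<bullet> e = 0}))"
    unfolding uniform_charts_def by (elim exE conjE) (rule that)
  show ?thesis
  proof (intro exI[of _ L] conjI ballI)
    fix x assume "x \<in> M"
    from bspec[OF all this]
    show "\<exists>U (\<Psi> :: real^'n \<Rightarrow> real^'n). x \<in> U \<and> openin (top_of_set M) U
        \<and> (\<forall>u\<in>U. \<forall>v\<in>U. dist u v / L \<le> dist (\<Psi> u) (\<Psi> v) \<and> dist (\<Psi> u) (\<Psi> v) \<le> L * dist u v)
        \<and> convex (\<Psi> ` U) \<and> (\<exists>p r. 0 < r \<and> ball p r \<subseteq> \<Psi> ` U)"
    proof (elim exE conjE)
      fix U and \<Psi> :: "real^'n \<Rightarrow> real^'n"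
      assume U: "x \<in> U" "openin (top_of_set M) U" "\<forall>u\<in>U. \<forall>v\<in>U. dist u v / L \<le> dist (\<Psi> u) (\<Psi> v)
          \<and> dist (\<Psi> u) (\<Psi> v) \<le> L * dist u v"
        and A: "\<rho> \<le> infdist x (frontier M) \<longrightarrow> (\<exists>c. \<exists>R>0. \<Psi> ` U = ball c R)"
        and B: "infdist x (frontier M) < \<rho> \<longrightarrow>
             (\<exists>c e. \<exists>R>0. norm e = 1 \<and> \<Psi> ` U = {v \<in> ball c R. 0 \<le> (v - c) \<bullet> e}
                \<and> \<Psi> ` (U \<inter> frontier M) \<subseteq> {v. (v - c) \<bullet> e = 0})"
      have "convex (\<Psi> ` U) \<and> (\<exists>p r. 0 < r \<and> ball p r \<subseteq> \<Psi> ` U)"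
      proof (cases "\<rho> \<le> infdist x (frontier M)")
        case True
        with A obtain c R where "0 < R" "\<Psi> ` U = ball c R" by blast
        then show ?thesis by auto
      next
        case False
        then have "infdist x (frontier M) < \<rho>" by simp
        from mp[OF B this] show ?thesis
          using half_ball_convex_with_interior by (elim exE conjE) simp
      qed
      with U show ?thesis by (intro exI[of _ U] exI[of _ \<Psi>] conjI) blast+
    qed
  qed fact
qed

text \<open>
  By compactness finitely many charts cover \<open>M\<close>, which makes the growth rate uniform although the
  charts themselves may be arbitrarily small.
\<close>

lemma uniform_inward_paths_of_charts:
  fixes M :: "(real^'n) set"
  assumes M: "closed_domain M" and charts: "uniform_charts M"
  obtains \<rho> \<Lambda> where "0 < \<rho>" "0 < \<Lambda>" "uniform_inward_paths \<rho> \<Lambda> M"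
proof -
  obtain L where L: "1 \<le> L" and ch: "\<forall>x\<in>M. \<exists>U (\<Psi> :: real^'n \<Rightarrow> real^'n). x \<in> U \<and> openin (top_of_set M) U
    \<and> (\<forall>u\<in>U. \<forall>v\<in>U. dist u v / L \<le> dist (\<Psi> u) (\<Psi> v) \<and> dist (\<Psi> u) (\<Psi> v) \<le> L * dist u v)
    \<and> convex (\<Psi> ` U) \<and> (\<exists>p r. 0 < r \<and> ball p r \<subseteq> \<Psi> ` U)"
    using convex_charts[OF charts] by (elim exE conjE) (rule that)
  obtain D where D: "\<And>u v. u \<in> M \<Longrightarrow> v \<in> M \<Longrightarrow> dist u v \<le> D"
    using closed_domain_compact[OF M] compact_imp_bounded bounded_two_points by meson
  define good where "good y r \<longleftrightarrow> (\<exists>c. c 0 = y \<and> inward_path (r / L) (L * L * D) M c)"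
    for y :: "real^'n" and r :: real
  have "\<exists>U r. x \<in> U \<and> openin (top_of_set M) U \<and> 0 < r \<and> (\<forall>y\<in>U. good y r)" if x: "x \<in> M" for x
  proof -
    obtain U and \<Psi> :: "real^'n \<Rightarrow> real^'n" where U: "x \<in> U" "openin (top_of_set M) U"
      and lip: "\<forall>u\<in>U. \<forall>v\<in>U. dist u v / L \<le> dist (\<Psi> u) (\<Psi> v) \<and> dist (\<Psi> u) (\<Psi> v) \<le> L * dist u v"
      and conv: "convex (\<Psi> ` U)" and core: "\<exists>p r. 0 < r \<and> ball p r \<subseteq> \<Psi> ` U"
      using bspec[OF ch x] by (elim exE conjE) (rule that; blast)
    obtain p r where pr: "0 < r" "ball p r \<subseteq> \<Psi> ` U" using core by blast
    have "good y r" if "y \<in> U" for y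
      unfolding good_def using lip
      by (intro inward_path_in_chart[OF L pr(1) openin_imp_subset[OF U(2)] that _ conv pr(2) D]) auto
    with U pr(1) show ?thesis by blast
  qed
  then obtain U r where Ur: "\<And>x. x \<in> M \<Longrightarrow> x \<in> U x \<and> openin (top_of_set M) (U x) \<and> 0 < r x \<and> (\<forall>y\<in>U x. good y (r x))"
    by metis
  obtain O' where O': "\<And>x. x \<in> M \<Longrightarrow> open (O' x) \<and> U x = M \<inter> O' x"
    using Ur unfolding openin_open by metis
  obtain F where F: "F \<subseteq> M" "finite F" "M \<subseteq> (\<Union>x\<in>F. O' x)"
  proof (rule compactE_image[OF closed_domain_compact[OF M], of M O'])
    show "open (O' x)" if "x \<in> M" for x using O'[OF that] by simp
    show "M \<subseteq> (\<Union>x\<in>M. O' x)"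
    proof
      fix x assume x: "x \<in> M"
      then have "x \<in> U x" using Ur by simp
      then show "x \<in> (\<Union>x\<in>M. O' x)" using O'[OF x] x by auto
    qed
  qed
  define \<rho> where "\<rho> = Min (insert 1 (r ` F)) / L"
  have Min: "0 < Min (insert 1 (r ` F))" using F Ur by (subst Min_gr_iff) auto
  have "uniform_inward_paths \<rho> (\<bar>L * L * D\<bar> + 1) M"
    unfolding uniform_inward_paths_def
  proof
    fix y assume y: "y \<in> M"
    then obtain x where "x \<in> F" "y \<in> O' x" using F(3) by blast
    with y F(1) O' have x: "x \<in> F" "y \<in> U x" "x \<in> M" by auto
    obtain c where c: "c 0 = y" and path: "inward_path (r x / L) (L * L * D) M c"
      using Ur[OF x(3)] x(2) unfolding good_def by metis
    have "dist (c s) (c t) \<le> (\<bar>L * L * D\<bar> + 1) * \<bar>s - t\<bar>" if "s \<in> {0..1}" "t \<in> {0..1}" for s t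
    proof -
      have "L * L * D * \<bar>s - t\<bar> \<le> (\<bar>L * L * D\<bar> + 1) * \<bar>s - t\<bar>" by (intro mult_right_mono) auto
      moreover have "dist (c s) (c t) \<le> L * L * D * \<bar>s - t\<bar>"
        using path that unfolding inward_path_def by blast
      ultimately show ?thesis by linarith
    qed
    moreover have "ball (c t) (\<rho> * t) \<subseteq> M" if t: "t \<in> {0..1}" for t
    proof -
      have "Min (insert 1 (r ` F)) \<le> r x" using F x by (intro Min_le) auto
      then have "\<rho> * t \<le> r x / L * t" unfolding \<rho>_def using t L by (intro mult_right_mono divide_right_mono) auto
      then have "ball (c t) (\<rho> * t) \<subseteq> ball (c t) (r x / L * t)" by (rule subset_ball)
      also have "\<dots> \<subseteq> M" using path t unfolding inward_path_def by blast
      finally show ?thesis .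
    qed
    ultimately show "\<exists>c. c 0 = y \<and> inward_path \<rho> (\<bar>L * L * D\<bar> + 1) M c"
      using c unfolding inward_path_def by blast
  qed
  moreover have "0 < \<rho>" unfolding \<rho>_def using Min L by simp
  ultimately show ?thesis using that[of \<rho> "\<bar>L * L * D\<bar> + 1"] by simp
qed


section \<open>Bumps moving through the domain\<close>

text \<open>
  Differentiation under the integral sign, by dominated convergence.
\<close>

lemma has_field_derivative_integral:
  fixes g g' :: "real \<Rightarrow> 'a \<Rightarrow> real"
  assumes S: "convex S" "\<tau> \<in> S" and f: "integrable M f"
    and g_meas: "\<And>t. t \<in> S \<Longrightarrow> g t \<in> borel_measurable M" and g'_meas: "g' \<tau> \<in> borel_measurable M"
    and g_bdd: "\<And>t x. t \<in> S \<Longrightarrow> x \<in> space M \<Longrightarrow> \<bar>g t x\<bar> \<le> C"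
    and deriv: "\<And>t x. t \<in> S \<Longrightarrow> x \<in> space M \<Longrightarrow> ((\<lambda>t. g t x) has_real_derivative g' t x) (at t within S)"
    and bdd: "\<And>t x. t \<in> S \<Longrightarrow> x \<in> space M \<Longrightarrow> \<bar>g' t x\<bar> \<le> K"
  shows "((\<lambda>t. \<integral>x. f x * g t x \<partial>M) has_real_derivative (\<integral>x. f x * g' \<tau> x \<partial>M)) (at \<tau> within S)"
  unfolding has_field_derivative_iff tendsto_at_iff_sequentially
proof (intro allI impI)
  fix X assume X: "\<forall>i. X i \<in> S - {\<tau>}" "X \<longlonglongrightarrow> \<tau>"
  note fm[measurable] = borel_measurable_integrable[OF f]
  have int: "integrable M (\<lambda>x. f x * g t x)" if "t \<in> S" for t
  proof (rule Bochner_Integration.integrable_bound)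
    show "integrable M (\<lambda>x. C * f x)" using f by simp
    show "AE x in M. norm (f x * g t x) \<le> norm (C * f x)"
    proof (rule AE_I2)
      fix x assume "x \<in> space M"
      from g_bdd[OF that this] have "\<bar>g t x\<bar> \<le> \<bar>C\<bar>" by linarith
      then have "\<bar>g t x\<bar> * \<bar>f x\<bar> \<le> \<bar>C\<bar> * \<bar>f x\<bar>" by (rule mult_right_mono) simp
      then show "norm (f x * g t x) \<le> norm (C * f x)"
        by (simp add: abs_mult mult.commute[of "\<bar>f x\<bar>"])
    qed
  qed (use g_meas[OF that] in measurable)
  have "(\<lambda>i. \<integral>x. f x * ((g (X i) x - g \<tau> x) / (X i - \<tau>)) \<partial>M) \<longlonglongrightarrow> (\<integral>x. f x * g' \<tau> x \<partial>M)"
  proof (rule integral_dominated_convergence[where w = "\<lambda>x. K * \<bar>f x\<bar>"])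
    show "(\<lambda>x. f x * g' \<tau> x) \<in> borel_measurable M" using g'_meas by measurable
    show "(\<lambda>x. f x * ((g (X i) x - g \<tau> x) / (X i - \<tau>))) \<in> borel_measurable M" for i
    proof -
      have [measurable]: "g (X i) \<in> borel_measurable M" "g \<tau> \<in> borel_measurable M"
        using g_meas X(1) S(2) by auto
      show ?thesis by measurable
    qed
    show "integrable M (\<lambda>x. K * \<bar>f x\<bar>)" using f by simp
    show "AE x in M. (\<lambda>i. f x * ((g (X i) x - g \<tau> x) / (X i - \<tau>))) \<longlonglongrightarrow> f x * g' \<tau> x"
    proof (rule AE_I2)
      fix x assume "x \<in> space M"
      from deriv[OF S(2) this] have "((\<lambda>y. (g y x - g \<tau> x) / (y - \<tau>)) \<longlongrightarrow> g' \<tau> x) (at \<tau> within S)"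
        by (simp add: has_field_derivative_iff)
      then show "(\<lambda>i. f x * ((g (X i) x - g \<tau> x) / (X i - \<tau>))) \<longlonglongrightarrow> f x * g' \<tau> x"
        using X by (intro tendsto_mult tendsto_const) (auto simp: tendsto_at_iff_sequentially comp_def)
    qed
    show "AE x in M. norm (f x * ((g (X i) x - g \<tau> x) / (X i - \<tau>))) \<le> K * \<bar>f x\<bar>" for i
    proof (rule AE_I2)
      fix x assume x: "x \<in> space M"
      have "norm (g (X i) x - g \<tau> x) \<le> K * norm (X i - \<tau>)"
        using S(1) by (rule field_differentiable_bound[where f' = "\<lambda>t. g' t x"])
          (use deriv bdd x X S in auto)
      then have "\<bar>(g (X i) x - g \<tau> x) / (X i - \<tau>)\<bar> \<le> K"
        using X(1) by (simp add: abs_divide field_simps)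
      then have "\<bar>f x\<bar> * \<bar>(g (X i) x - g \<tau> x) / (X i - \<tau>)\<bar> \<le> \<bar>f x\<bar> * K"
        by (rule mult_left_mono) simp
      then show "norm (f x * ((g (X i) x - g \<tau> x) / (X i - \<tau>))) \<le> K * \<bar>f x\<bar>"
        by (simp only: real_norm_def abs_mult mult.commute)
    qed
  qed
  moreover have "(\<integral>x. f x * ((g (X i) x - g \<tau> x) / (X i - \<tau>)) \<partial>M)
      = ((\<integral>x. f x * g (X i) x \<partial>M) - (\<integral>x. f x * g \<tau> x \<partial>M)) / (X i - \<tau>)" for i
  proof -
    have "(\<integral>x. f x * ((g (X i) x - g \<tau> x) / (X i - \<tau>)) \<partial>M)
        = (\<integral>x. (f x * g (X i) x - f x * g \<tau> x) / (X i - \<tau>) \<partial>M)"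
      by (rule Bochner_Integration.integral_cong) (auto simp: algebra_simps)
    also have "\<dots> = ((\<integral>x. f x * g (X i) x \<partial>M) - (\<integral>x. f x * g \<tau> x \<partial>M)) / (X i - \<tau>)"
      using int[of "X i"] int[of \<tau>] X(1) S(2) by (subst integral_divide_zero) simp
    finally show ?thesis .
  qed
  ultimately show "((\<lambda>y. ((\<integral>x. f x * g y x \<partial>M) - (\<integral>x. f x * g \<tau> x \<partial>M)) / (y - \<tau>)) \<circ> X)
      \<longlonglongrightarrow> (\<integral>x. f x * g' \<tau> x \<partial>M)"
    unfolding comp_def by (simp only:)
qed

lemma DERIV_max_0_square: "((\<lambda>u::real. (max 0 u)\<^sup>2) has_real_derivative 2 * max 0 u) (at u)"
proof (cases "u = 0")
  case True
  have "(\<lambda>h. max 0 h * (max 0 h / h)) \<midarrow>0\<rightarrow> (0::real)"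
  proof (rule tendsto_0_le[where K = 1])
    show "(\<lambda>h. h) \<midarrow>0\<rightarrow> (0::real)" by (rule tendsto_ident_at)
    show "\<forall>\<^sub>F h in at (0::real). norm (max 0 h * (max 0 h / h)) \<le> norm h * (1::real)"
    proof (rule always_eventually, rule allI)
      show "norm (max 0 h * (max 0 h / h)) \<le> norm h * (1::real)" for h :: real
        by (cases "h = 0") (auto simp: max_def)
    qed
  qed
  then show ?thesis using True by (simp add: DERIV_def power2_eq_square)
next
  case False
  show ?thesis
  proof (cases "0 < u")
    case True
    have "((\<lambda>u. u\<^sup>2) has_real_derivative 2 * u) (at u)" by (auto intro!: derivative_eq_intros)
    then have "((\<lambda>u. (max 0 u)\<^sup>2) has_real_derivative 2 * u) (at u)"
      by (rule has_field_derivative_transform_within_open[of _ _ _ "{0<..}"]) (use True in auto)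
    then show ?thesis using True by simp
  next
    case u: False
    have "((\<lambda>u. 0) has_real_derivative 0) (at u)" by simp
    then have "((\<lambda>u. (max 0 u)\<^sup>2) has_real_derivative 0) (at u)"
      by (rule has_field_derivative_transform_within_open[of _ _ _ "{..<0}"]) (use u False in auto)
    then show ?thesis using u by simp
  qed
qed

text \<open>
  The square of this function is of class \<open>C\<^sup>1\<close>, which is the regularity of the test functions of a
  weak gradient.
\<close>

definition bump_root :: "real \<Rightarrow> 'a::real_inner \<Rightarrow> 'a \<Rightarrow> real" where
  "bump_root s c x = max 0 (s\<^sup>2 - (x - c) \<bullet> (x - c))"

definition bump :: "real \<Rightarrow> 'a::real_inner \<Rightarrow> 'a \<Rightarrow> real" where
  "bump s c x = (bump_root s c x)\<^sup>2"

lemma bump_root_nonneg: "0 \<le> bump_root s c x" and bump_root_le: "bump_root s c x \<le> s\<^sup>2"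
  by (auto simp: bump_root_def)

lemma bump_nonneg: "0 \<le> bump s c x"
  by (simp add: bump_def)

lemma bump_le: "bump s c x \<le> s ^ 4"
  using power_mono[OF bump_root_le bump_root_nonneg, of s c x 2] by (simp add: bump_def flip: power_mult)

lemma bump_root_eq_0:
  assumes "0 < s" "x \<notin> ball c s"
  shows "bump_root s c x = 0"
proof -
  have "s \<le> norm (x - c)" using assms by (simp add: dist_norm norm_minus_commute)
  then have "s\<^sup>2 \<le> (norm (x - c))\<^sup>2" using assms by (intro power_mono) auto
  then show ?thesis by (simp add: bump_root_def power2_norm_eq_inner)
qed

lemma bump_eq_0: "0 < s \<Longrightarrow> x \<notin> ball c s \<Longrightarrow> bump s c x = 0"
  by (simp add: bump_def bump_root_eq_0)

lemma bump_ge: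
  assumes "0 < s" "x \<in> ball c (s / 2)"
  shows "9 / 16 * s ^ 4 \<le> bump s c x"
proof -
  have "norm (x - c) \<le> s / 2" using assms by (simp add: dist_norm norm_minus_commute)
  then have "(norm (x - c))\<^sup>2 \<le> (s / 2)\<^sup>2" by (intro power_mono) auto
  then have "(x - c) \<bullet> (x - c) \<le> (s / 2)\<^sup>2" by (simp add: power2_norm_eq_inner)
  then have "3 / 4 * s\<^sup>2 \<le> s\<^sup>2 - (x - c) \<bullet> (x - c)" by (simp add: power_divide)
  then have "3 / 4 * s\<^sup>2 \<le> bump_root s c x" unfolding bump_root_def by (rule max.coboundedI2)
  from power_mono[OF this, of 2] show ?thesis
    by (simp add: bump_def power_mult_distrib power_divide flip: power_mult)
qed

lemma continuous_bump_root [continuous_intros]: "continuous_on A (bump_root s c)"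
  unfolding bump_root_def by (intro continuous_intros)

lemma continuous_bump [continuous_intros]: "continuous_on A (bump s c)"
  unfolding bump_def by (intro continuous_intros)

lemma GDERIV_bump: "GDERIV (bump s c) x :> (- 4 * bump_root s c x) *\<^sub>R (x - c)"
proof -
  have "GDERIV (\<lambda>x. s\<^sup>2 - (x - c) \<bullet> (x - c)) x :> (- 2) *\<^sub>R (x - c)"
    unfolding gderiv_def
    by (rule has_derivative_subst, (rule derivative_intros)+)
      (auto simp: fun_eq_iff inner_commute inner_diff_left inner_diff_right algebra_simps)
  from GDERIV_DERIV_compose[OF this DERIV_max_0_square]
  show ?thesis by (simp add: bump_def[abs_def] bump_root_def)
qed

lemma bump_has_time_derivative:
  fixes a e x :: "'a::real_inner" and s\<^sub>0 \<sigma> :: real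
  defines "s \<equiv> \<lambda>t. s\<^sub>0 + t * \<sigma>" and "c \<equiv> \<lambda>t. a + t *\<^sub>R e"
  shows "((\<lambda>t. bump (s t) (c t) x) has_real_derivative
      4 * bump_root (s t) (c t) x * (s t * \<sigma> + e \<bullet> (x - c t))) (at t within S)"
proof -
  have "((\<lambda>t. (s t)\<^sup>2 - (x - c t) \<bullet> (x - c t)) has_real_derivative
      2 * (s t * \<sigma> + e \<bullet> (x - c t))) (at t)"
    unfolding s_def c_def has_field_derivative_def
    by (rule has_derivative_subst, (rule derivative_intros)+)
      (auto simp: fun_eq_iff inner_commute inner_diff_left inner_diff_right algebra_simps)
  from DERIV_chain2[OF DERIV_max_0_square this]
  have "((\<lambda>t. bump (s t) (c t) x) has_real_derivative
      4 * bump_root (s t) (c t) x * (s t * \<sigma> + e \<bullet> (x - c t))) (at t)"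
    by (simp add: bump_def bump_root_def algebra_simps)
  then show ?thesis by (rule has_field_derivative_at_within)
qed

lemma borel_measurable_vol:
  "g \<in> borel_measurable borel \<Longrightarrow> g \<in> borel_measurable (vol M)"
  unfolding vol_def by (simp add: measurable_restrict_space1 measurable_cong_sets[OF sets_uniform_measure refl])

lemma continuous_borel_measurable_vol:
  "continuous_on UNIV g \<Longrightarrow> g \<in> borel_measurable (vol M)"
  by (intro borel_measurable_vol borel_measurable_continuous_onI)

lemma integrable_scaleR_bounded:
  fixes f :: "'a \<Rightarrow> real" and h :: "'a \<Rightarrow> 'b::{banach, second_countable_topology}"
  assumes "integrable M f" "h \<in> borel_measurable M" "\<And>x. norm (h x) \<le> K"
  shows "integrable M (\<lambda>x. f x *\<^sub>R h x)"
proof (rule Bochner_Integration.integrable_bound)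
  have [measurable]: "f \<in> borel_measurable M" "h \<in> borel_measurable M" using assms by auto
  show "(\<lambda>x. f x *\<^sub>R h x) \<in> borel_measurable M" by measurable
  show "integrable M (\<lambda>x. K * f x)" using assms by simp
  have "\<bar>f x\<bar> * norm (h x) \<le> \<bar>f x\<bar> * \<bar>K\<bar>" for x
    using assms(3)[of x] by (intro mult_left_mono) linarith+
  then show "AE x in M. norm (f x *\<^sub>R h x) \<le> norm (K * f x)"
    by (auto simp: abs_mult mult.commute)
qed

lemma integrable_bounded_scaleR:
  fixes k :: "'a \<Rightarrow> real" and g :: "'a \<Rightarrow> 'b::{banach, second_countable_topology}"
  assumes "integrable M g" "k \<in> borel_measurable M" "\<And>x. \<bar>k x\<bar> \<le> K"
  shows "integrable M (\<lambda>x. k x *\<^sub>R g x)"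
proof (rule Bochner_Integration.integrable_bound)
  have [measurable]: "g \<in> borel_measurable M" "k \<in> borel_measurable M" using assms by auto
  show "(\<lambda>x. k x *\<^sub>R g x) \<in> borel_measurable M" by measurable
  show "integrable M (\<lambda>x. K *\<^sub>R g x)" using assms by simp
  have "\<bar>k x\<bar> * norm (g x) \<le> \<bar>K\<bar> * norm (g x)" for x
    using assms(3)[of x] by (intro mult_right_mono) auto
  then show "AE x in M. norm (k x *\<^sub>R g x) \<le> norm (K *\<^sub>R g x)" by simp
qed

lemma continuous_bounded_of_compact_support:
  fixes h :: "'a::metric_space \<Rightarrow> 'b::real_normed_vector"
  assumes "continuous_on UNIV h" "compact C" "\<And>x. x \<notin> C \<Longrightarrow> h x = 0"
  obtains K where "\<And>x. norm (h x) \<le> K"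
proof -
  have "bounded (h ` C)"
    using assms by (intro compact_imp_bounded compact_continuous_image) (auto intro: continuous_on_subset)
  then obtain K where "\<And>x. x \<in> C \<Longrightarrow> norm (h x) \<le> K" by (auto simp: bounded_iff)
  then have "norm (h x) \<le> max K 0" for x using assms(3)[of x] by (cases "x \<in> C") (auto simp: le_max_iff_disj)
  then show ?thesis using that by blast
qed

text \<open>
  The definition of the weak gradient, tested with the components of the vector field
  \<open>bump s c x * v x\<close>. The integrand on the left is \<open>f\<close> times the divergence of this field. The affine
  field \<open>v\<close> is the velocity of a ball that moves and grows at the same time.
\<close>

lemma bump_integration_by_parts:
  fixes M :: "(real^'n) set" and G :: "real^'n \<Rightarrow> real^'n" and e c :: "real^'n" and \<kappa> :: real
  assumes wg: "weak_gradient M f G" and f: "integrable (vol M) f" and G: "integrable (vol M) G"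
    and s: "0 < s" and supp: "cball c s \<subseteq> interior M"
  defines "v \<equiv> \<lambda>x. e + \<kappa> *\<^sub>R (x - c)"
  shows "(LINT x|vol M. f x * (\<kappa> * real CARD('n) * bump s c x - 4 * bump_root s c x * (v x \<bullet> (x - c))))
       = - (LINT x|vol M. bump s c x * (G x \<bullet> v x))"
proof -
  define \<phi> where "\<phi> i x = bump s c x * v x $ i" for i x
  define d\<phi> where "d\<phi> i x = bump s c x *\<^sub>R (\<kappa> *\<^sub>R axis i 1) + (v x $ i) *\<^sub>R ((- 4 * bump_root s c x) *\<^sub>R (x - c))"
    for i :: 'n and x
  have v_cont: "continuous_on UNIV v" unfolding v_def by (intro continuous_intros)
  have \<phi>_cont: "continuous_on UNIV (\<phi> i)" for i
    unfolding \<phi>_def using v_cont by (intro continuous_intros)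
  have d\<phi>_cont: "continuous_on UNIV (d\<phi> i)" for i
    unfolding d\<phi>_def using v_cont by (intro continuous_intros)
  have deriv: "GDERIV (\<phi> i) x :> d\<phi> i x" for i x
  proof -
    have "GDERIV (\<lambda>x. v x $ i) x :> \<kappa> *\<^sub>R axis i 1"
      unfolding gderiv_def v_def
      by (rule has_derivative_subst, rule bounded_linear.has_derivative[OF bounded_linear_vec_nth],
          (rule derivative_intros)+) (auto simp: fun_eq_iff inner_axis)
    from GDERIV_mult[OF GDERIV_bump this] show ?thesis unfolding \<phi>_def d\<phi>_def .
  qed
  have zero: "\<phi> i x = 0" "d\<phi> i x = 0" if "x \<notin> cball c s" for i x
    using that s bump_eq_0[of s x c] bump_root_eq_0[of s x c] by (auto simp: \<phi>_def d\<phi>_def)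
  have sub: "closure {x. \<phi> i x \<noteq> 0} \<subseteq> cball c s" for i
  proof (rule closure_minimal)
    show "{x. \<phi> i x \<noteq> 0} \<subseteq> cball c s" using zero(1) by blast
  qed simp
  then have comp: "compact (closure {x. \<phi> i x \<noteq> 0})" for i
    by (meson bounded_cball bounded_subset closed_closure compact_eq_bounded_closed)
  have "\<exists>K. \<forall>x. norm (\<phi> i x) \<le> K" for i
    by (rule continuous_bounded_of_compact_support[OF \<phi>_cont[of i] compact_cball[of c s] zero(1)]) blast+
  then obtain K where K: "\<And>i x. norm (\<phi> i x) \<le> K i" by metis
  have "\<exists>K. \<forall>x. norm (d\<phi> i x) \<le> K" for i
    by (rule continuous_bounded_of_compact_support[OF d\<phi>_cont[of i] compact_cball[of c s] zero(2)]) blast+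
  then obtain K' where K': "\<And>i x. norm (d\<phi> i x) \<le> K' i" by metis
  have int1: "integrable (vol M) (\<lambda>x. f x *\<^sub>R d\<phi> i x)" for i
    using f continuous_borel_measurable_vol[OF d\<phi>_cont] K' by (rule integrable_scaleR_bounded)
  have int2: "integrable (vol M) (\<lambda>x. \<phi> i x *\<^sub>R G x)" for i
    using G continuous_borel_measurable_vol[OF \<phi>_cont] K[unfolded real_norm_def]
    by (rule integrable_bounded_scaleR)
  have parts: "(LINT x|vol M. f x *\<^sub>R d\<phi> i x) = - (LINT x|vol M. \<phi> i x *\<^sub>R G x)" for i
    using wg deriv d\<phi>_cont comp sub supp unfolding weak_gradient_def by blast
  have comp_i: "(LINT x|vol M. f x * d\<phi> i x $ i) = - (LINT x|vol M. \<phi> i x * G x $ i)" for i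
    using arg_cong[OF parts[of i], of "\<lambda>z. z \<bullet> axis i 1"]
      integral_inner_left[OF int1[of i], of "axis i 1"] integral_inner_left[OF int2[of i], of "axis i 1"]
    by (simp add: inner_axis)
  have int1': "integrable (vol M) (\<lambda>x. f x * d\<phi> i x $ i)" for i
    using integrable_inner_left[OF int1[of i], of "axis i 1"] by (simp add: inner_axis)
  have int2': "integrable (vol M) (\<lambda>x. \<phi> i x * G x $ i)" for i
    using integrable_inner_left[OF int2[of i], of "axis i 1"] by (simp add: inner_axis)
  have div: "(\<Sum>i\<in>UNIV. d\<phi> i x $ i)
      = \<kappa> * real CARD('n) * bump s c x - 4 * bump_root s c x * (v x \<bullet> (x - c))" for x
    by (simp add: d\<phi>_def axis_def sum.distrib sum_subtractf inner_vec_def sum_distrib_left sum_negf algebra_simps)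
  have flux: "(\<Sum>i\<in>UNIV. \<phi> i x * G x $ i) = bump s c x * (G x \<bullet> v x)" for x
    by (simp add: \<phi>_def inner_vec_def sum_distrib_left mult_ac)
  have "(LINT x|vol M. f x * (\<Sum>i\<in>UNIV. d\<phi> i x $ i)) = (\<Sum>i\<in>UNIV. LINT x|vol M. f x * d\<phi> i x $ i)"
    using int1' by (simp add: sum_distrib_left)
  also have "\<dots> = - (\<Sum>i\<in>UNIV. LINT x|vol M. \<phi> i x * G x $ i)"
    by (simp add: comp_i sum_negf)
  also have "\<dots> = - (LINT x|vol M. (\<Sum>i\<in>UNIV. \<phi> i x * G x $ i))"
    using int2' by simp
  finally show ?thesis by (simp only: div flux)
qed

lemma bump_root_mult: "bump_root s c x * (s\<^sup>2 - (x - c) \<bullet> (x - c)) = bump s c x"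
  by (simp add: bump_root_def bump_def max_def power2_eq_square)

text \<open>
  With this power of \<open>s\<close> the integral over the whole space does not depend on \<open>s\<close>.
\<close>

definition mollifier :: "real \<Rightarrow> real^'n \<Rightarrow> real^'n \<Rightarrow> real" where
  "mollifier s c x = bump s c x / s ^ (CARD('n) + 4)"

text \<open>
  Let the ball move and grow linearly from one position to the other. Its mollifier is transported by
  the velocity field \<open>v\<close>: the time derivative is minus the divergence of mollifier times \<open>v\<close>. So the
  derivative of the average of \<open>f\<close> is the integral of the mollifier against the component of the
  gradient along \<open>v\<close>.
\<close>

lemma mollifier_step:
  fixes M :: "(real^'n) set" and G :: "real^'n \<Rightarrow> real^'n" and a b :: "real^'n" and s\<^sub>0 s\<^sub>1 :: real
  assumes M: "compact M"
    and wg: "weak_gradient M f G" and f: "integrable (vol M) f" and G: "integrable (vol M) G"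
    and m: "0 < m" "m \<le> s\<^sub>0" "m \<le> s\<^sub>1"
    and cover: "\<And>t. t \<in> {0..1} \<Longrightarrow> cball (a + t *\<^sub>R (b - a)) (s\<^sub>0 + t * (s\<^sub>1 - s\<^sub>0)) \<subseteq> D"
    and D: "D \<subseteq> interior M" "open D"
  shows "\<bar>(LINT x|vol M. f x * mollifier s\<^sub>1 b x) - (LINT x|vol M. f x * mollifier s\<^sub>0 a x)\<bar>
      \<le> (norm (b - a) + \<bar>s\<^sub>1 - s\<^sub>0\<bar>) / m ^ CARD('n) * (LINT x|vol M. indicator D x * norm (G x))"
proof -
  define d where "d = CARD('n)"
  define e where "e = b - a"
  define \<sigma> where "\<sigma> = s\<^sub>1 - s\<^sub>0"
  define s where "s t = s\<^sub>0 + t * \<sigma>" for t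
  define c where "c t = a + t *\<^sub>R e" for t
  define g where "g t = mollifier (s t) (c t)" for t
  define g' where "g' t x = (4 * bump_root (s t) (c t) x * (s t * \<sigma> + e \<bullet> (x - c t))) / s t ^ (d + 4)
      - real (d + 4) * \<sigma> * bump (s t) (c t) x / s t ^ (d + 5)" for t x
  have s_ge: "m \<le> s t" if "t \<in> {0..1}" for t
  proof -
    have "(1 - t) * m + t * m \<le> (1 - t) * s\<^sub>0 + t * s\<^sub>1"
      using that m by (intro add_mono mult_left_mono) auto
    then show ?thesis by (simp add: s_def \<sigma>_def algebra_simps)
  qed
  have s_pos: "0 < s t" if "t \<in> {0..1}" for t using s_ge[OF that] m by linarith
  have deriv: "((\<lambda>t. g t x) has_real_derivative g' t x) (at t within {0..1})" if t: "t \<in> {0..1}" for t x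
  proof -
    have "((\<lambda>t. bump (s t) (c t) x / s t ^ (d + 4)) has_real_derivative
        ((4 * bump_root (s t) (c t) x * (s t * \<sigma> + e \<bullet> (x - c t))) * s t ^ (d + 4)
          - bump (s t) (c t) x * (real (d + 4) * s t ^ (d + 3) * \<sigma>)) / (s t ^ (d + 4) * s t ^ (d + 4)))
        (at t within {0..1})"
    proof (rule DERIV_divide)
      show "((\<lambda>t. bump (s t) (c t) x) has_real_derivative
          4 * bump_root (s t) (c t) x * (s t * \<sigma> + e \<bullet> (x - c t))) (at t within {0..1})"
        unfolding s_def c_def by (rule bump_has_time_derivative)
      show "((\<lambda>t. s t ^ (d + 4)) has_real_derivative real (d + 4) * s t ^ (d + 3) * \<sigma>) (at t within {0..1})"
      proof -
        have "(s has_real_derivative \<sigma>) (at t within {0..1})"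
          unfolding s_def by (auto intro!: derivative_eq_intros)
        from DERIV_power_Suc[OF this, of "d + 3"] show ?thesis by (simp add: mult_ac eval_nat_numeral)
      qed
      show "s t ^ (d + 4) \<noteq> 0" using s_pos[OF t] by simp
    qed
    moreover have "((4 * bump_root (s t) (c t) x * (s t * \<sigma> + e \<bullet> (x - c t))) * s t ^ (d + 4)
          - bump (s t) (c t) x * (real (d + 4) * s t ^ (d + 3) * \<sigma>)) / (s t ^ (d + 4) * s t ^ (d + 4)) = g' t x"
    proof -
      have "(A * P4 - B * (R * P3 * \<sigma>)) / (P4 * P4) = A / P4 - R * \<sigma> * B / P5"
        if "P4 = S * P3" "P5 = S * P4" "S \<noteq> 0" "P3 \<noteq> 0" for A B R P3 P4 P5 S :: real
        using that by (simp add: field_simps)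
      from this[of "s t ^ (d + 4)" "s t" "s t ^ (d + 3)" "s t ^ (d + 5)"] s_pos[OF t]
      show ?thesis unfolding g'_def by (simp add: numeral_eq_Suc)
    qed
    ultimately show ?thesis by (simp add: g_def mollifier_def d_def)
  qed
  have s_nz: "s\<^sub>0 + t * \<sigma> \<noteq> 0" if "0 \<le> t" "t \<le> 1" for t
    using s_pos[of t] that by (simp add: s_def)
  have cont: "continuous_on ({0..1} \<times> M) (\<lambda>(t, x). g t x)" "continuous_on ({0..1} \<times> M) (\<lambda>(t, x). g' t x)"
    unfolding g_def g'_def mollifier_def bump_def bump_root_def split_def s_def c_def
    by (auto intro!: continuous_intros simp: s_nz)
  have bounded: "\<exists>C. \<forall>t\<in>{0..1}. \<forall>x\<in>M. \<bar>h t x\<bar> \<le> C" if "continuous_on ({0..1} \<times> M) (\<lambda>(t, x). h t x)"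
    for h :: "real \<Rightarrow> real^'n \<Rightarrow> real"
  proof -
    have "bounded ((\<lambda>(t, x). h t x) ` ({0..1} \<times> M))"
      using that M by (intro compact_imp_bounded compact_continuous_image compact_Times) auto
    then show ?thesis by (fastforce simp: bounded_iff)
  qed
  obtain C where C: "\<And>t x. t \<in> {0..1} \<Longrightarrow> x \<in> M \<Longrightarrow> \<bar>g t x\<bar> \<le> C" using bounded[OF cont(1)] by blast
  obtain K where K: "\<And>t x. t \<in> {0..1} \<Longrightarrow> x \<in> M \<Longrightarrow> \<bar>g' t x\<bar> \<le> K" using bounded[OF cont(2)] by blast
  have space: "space (vol M) = M" unfolding vol_def by (simp add: space_restrict_space)
  have g_meas: "g t \<in> borel_measurable (vol M)" "g' t \<in> borel_measurable (vol M)" if t: "t \<in> {0..1}" for t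
    using s_pos[OF t] unfolding g_def g'_def mollifier_def
    by (auto intro!: continuous_borel_measurable_vol continuous_intros)
  define F where "F t = (LINT x|vol M. f x * g t x)" for t
  have F_deriv: "(F has_field_derivative (LINT x|vol M. f x * g' t x)) (at t within {0..1})"
    if t: "t \<in> {0..1}" for t
    unfolding F_def
    by (rule has_field_derivative_integral[where C = C and K = K])
      (use t f g_meas C K deriv space in auto)
  define I where "I = (LINT x|vol M. indicator D x * norm (G x))"
  have bound: "\<bar>LINT x|vol M. f x * g' t x\<bar> \<le> (norm e + \<bar>\<sigma>\<bar>) / m ^ d * I" if t: "t \<in> {0..1}" for t
  proof -
    define \<kappa> where "\<kappa> = \<sigma> / s t"
    define v where "v x = e + \<kappa> *\<^sub>R (x - c t)" for x
    define P where "P = s t ^ (d + 4)"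
    have P: "0 < P" unfolding P_def using s_pos[OF t] by simp
    \<comment> \<open>The transport equation for the mollifier.\<close>
    have g'_eq: "g' t x = - (\<kappa> * real d * bump (s t) (c t) x - 4 * bump_root (s t) (c t) x * (v x \<bullet> (x - c t))) / P" for x
    proof -
      have *: "4 * r * (S * \<sigma> + A) / P - R * \<sigma> * B / (S * P) = - (\<sigma> / S * R' * B - 4 * r * (A + \<sigma> / S * w)) / P"
        if "B = r * (S\<^sup>2 - w)" "S \<noteq> 0" "R = R' + 4" for r S A B R R' w :: real
        unfolding that(1,3) using that(2) P by (simp add: field_simps power2_eq_square)
      have "s t ^ (d + 5) = s t * P" by (simp add: P_def numeral_eq_Suc)
      moreover have "v x \<bullet> (x - c t) = e \<bullet> (x - c t) + \<sigma> / s t * ((x - c t) \<bullet> (x - c t))"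
        by (simp add: v_def \<kappa>_def inner_add_left)
      ultimately show ?thesis
        unfolding g'_def P_def[symmetric] \<kappa>_def
        using *[OF bump_root_mult[symmetric], of "s t" "real (d + 4)" "real d" "c t" x "e \<bullet> (x - c t)"] s_pos[OF t]
        by simp
    qed
    have supp: "cball (c t) (s t) \<subseteq> D" using cover[OF t] by (simp add: c_def s_def e_def \<sigma>_def)
    have "(LINT x|vol M. f x * g' t x)
        = (LINT x|vol M. (- 1 / P) * (f x * (\<kappa> * real d * bump (s t) (c t) x - 4 * bump_root (s t) (c t) x * (v x \<bullet> (x - c t)))))"
    proof (rule Bochner_Integration.integral_cong[OF refl])
      have "a * (- b / P) = - 1 / P * (a * b)" for a b :: real by simp
      then show "f x * g' t x = - 1 / P * (f x * (\<kappa> * real d * bump (s t) (c t) x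
          - 4 * bump_root (s t) (c t) x * (v x \<bullet> (x - c t))))" for x
        unfolding g'_eq .
    qed
    also have "\<dots> = 1 / P * (LINT x|vol M. bump (s t) (c t) x * (G x \<bullet> v x))"
      using bump_integration_by_parts[OF wg f G s_pos[OF t] order_trans[OF supp D(1)], of \<kappa> e]
      by (simp add: v_def d_def)
    finally have eq: "(LINT x|vol M. f x * g' t x) = 1 / P * (LINT x|vol M. bump (s t) (c t) x * (G x \<bullet> v x))" .
    have nG: "integrable (vol M) (\<lambda>x. indicator D x * norm (G x))"
    proof -
      have D_meas: "indicat_real D \<in> borel_measurable (vol M)"
        using D(2) by (intro borel_measurable_vol) auto
      have "integrable (vol M) (\<lambda>x. indicat_real D x *\<^sub>R norm (G x))"
        by (rule integrable_bounded_scaleR[OF integrable_norm[OF G] D_meas, of 1]) simp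
      then show ?thesis by simp
    qed
    have "\<bar>LINT x|vol M. bump (s t) (c t) x * (G x \<bullet> v x)\<bar>
        \<le> (LINT x|vol M. \<bar>bump (s t) (c t) x * (G x \<bullet> v x)\<bar>)"
      using integral_norm_bound[of "vol M" "\<lambda>x. bump (s t) (c t) x * (G x \<bullet> v x)"] by simp
    also have "\<dots> \<le> (LINT x|vol M. s t ^ 4 * (norm e + \<bar>\<sigma>\<bar>) * (indicator D x * norm (G x)))"
    proof (rule integral_mono')
      show "integrable (vol M) (\<lambda>x. s t ^ 4 * (norm e + \<bar>\<sigma>\<bar>) * (indicator D x * norm (G x)))"
        using nG by simp
      fix x
      show "\<bar>bump (s t) (c t) x * (G x \<bullet> v x)\<bar> \<le> s t ^ 4 * (norm e + \<bar>\<sigma>\<bar>) * (indicator D x * norm (G x))"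
      proof (cases "x \<in> ball (c t) (s t)")
        case True
        then have xD: "x \<in> D" using supp by (auto simp: subset_eq)
        have "norm (v x) \<le> norm e + \<bar>\<kappa>\<bar> * norm (x - c t)"
          unfolding v_def by (rule norm_triangle_le) simp
        also have "\<bar>\<kappa>\<bar> * norm (x - c t) \<le> \<bar>\<kappa>\<bar> * s t"
          using True by (intro mult_left_mono) (auto simp: dist_norm norm_minus_commute)
        also have "\<bar>\<kappa>\<bar> * s t = \<bar>\<sigma>\<bar>" using s_pos[OF t] by (simp add: \<kappa>_def)
        finally have v: "norm (v x) \<le> norm e + \<bar>\<sigma>\<bar>" by simp
        have "\<bar>bump (s t) (c t) x * (G x \<bullet> v x)\<bar> \<le> s t ^ 4 * (norm (G x) * norm (v x))"
          unfolding abs_mult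
          using bump_le[of "s t" "c t" x] bump_nonneg[of "s t" "c t" x] Cauchy_Schwarz_ineq2[of "G x" "v x"]
          by (intro mult_mono) auto
        also have "\<dots> \<le> s t ^ 4 * (norm (G x) * (norm e + \<bar>\<sigma>\<bar>))"
          using v by (intro mult_left_mono) auto
        finally show ?thesis using xD by (simp add: mult_ac)
      qed (simp add: bump_eq_0[OF s_pos[OF t]])
    qed simp
    also have "\<dots> = s t ^ 4 * (norm e + \<bar>\<sigma>\<bar>) * I" by (simp add: I_def)
    finally have "\<bar>LINT x|vol M. f x * g' t x\<bar> \<le> 1 / P * (s t ^ 4 * (norm e + \<bar>\<sigma>\<bar>) * I)"
      unfolding eq abs_mult using P by (simp add: divide_right_mono)
    also have "\<dots> = (norm e + \<bar>\<sigma>\<bar>) * I / s t ^ d"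
      unfolding P_def power_add using s_pos[OF t] by simp
    also have "\<dots> \<le> (norm e + \<bar>\<sigma>\<bar>) * I / m ^ d"
    proof (rule divide_left_mono)
      show "m ^ d \<le> s t ^ d" using s_ge[OF t] m by (intro power_mono) auto
      show "0 \<le> (norm e + \<bar>\<sigma>\<bar>) * I" unfolding I_def by simp
      show "0 < s t ^ d * m ^ d" using s_pos[OF t] m by simp
    qed
    finally show ?thesis by simp
  qed
  have "norm (F 1 - F 0) \<le> (norm e + \<bar>\<sigma>\<bar>) / m ^ d * I * norm (1 - 0 :: real)"
    by (rule field_differentiable_bound[OF convex_real_interval(5) F_deriv]) (use bound in auto)
  then show ?thesis
    by (simp add: F_def g_def s_def c_def e_def \<sigma>_def I_def d_def)
qed


section \<open>Capacity of a small ball\<close>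

lemma space_vol [simp]: "space (vol M) = M"
  unfolding vol_def by (simp add: space_restrict_space)

lemma sets_vol: "closed_domain M \<Longrightarrow> sets (vol M) = {A \<in> sets borel. A \<subseteq> M}"
  unfolding vol_def using borel_compact[OF closed_domain_compact, of M]
  by (auto simp: sets_restrict_space image_iff intro: exI[of _ "_ :: _ set"])

lemma measure_closed_domain_pos:
  fixes M :: "(real^'n) set"
  assumes "closed_domain M"
  shows "emeasure lborel M \<noteq> 0" "emeasure lborel M \<noteq> \<infinity>" "0 < measure lborel M"
proof -
  obtain x e where xe: "0 < e" "ball x e \<subseteq> M"
    using closed_domain_nonempty[OF assms] by (metis all_not_in_conv mem_interior)
  have M: "M \<in> sets lborel" using closed_domain_compact[OF assms] by (simp add: borel_compact)
  have fin: "emeasure lborel M < \<infinity>"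
    using closed_domain_compact[OF assms] by (intro emeasure_compact_finite)
  then show "emeasure lborel M \<noteq> \<infinity>" by simp
  have "0 < measure lborel (ball x e)" using xe by (intro content_ball_pos)
  also have "\<dots> \<le> measure lborel M"
    using xe M fin by (intro measure_mono_fmeasurable) (auto simp: fmeasurable_def)
  finally show "0 < measure lborel M" .
  then show "emeasure lborel M \<noteq> 0" by (auto simp: measure_def)
qed

lemma prob_space_vol:
  fixes M :: "(real^'n) set"
  assumes "closed_domain M" shows "prob_space (vol M)"
proof -
  have M: "M \<in> sets lborel" using closed_domain_compact[OF assms] by (simp add: borel_compact)
  then have "emeasure (restrict_space lborel M) M = emeasure lborel M"
    by (simp add: emeasure_restrict_space)
  then show ?thesis
    unfolding vol_def using measure_closed_domain_pos[OF assms]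
    by (intro prob_space_uniform_measure) simp_all
qed

lemma measure_vol:
  fixes M :: "(real^'n) set"
  assumes M: "closed_domain M" and A: "A \<in> sets borel" "A \<subseteq> M"
  shows "measure (vol M) A = measure lborel A / measure lborel M"
proof -
  have Mb: "M \<in> sets lborel" using closed_domain_compact[OF M] by (simp add: borel_compact)
  have "A \<in> sets (restrict_space lborel M)" "M \<in> sets (restrict_space lborel M)"
    using A Mb by (auto simp: sets_restrict_space_iff)
  moreover have "M \<inter> A = A" using A by auto
  ultimately have "emeasure (vol M) A = emeasure lborel A / emeasure lborel M"
    using A Mb unfolding vol_def by (simp add: emeasure_restrict_space)
  moreover have "emeasure lborel A \<le> emeasure lborel M" using A Mb by (intro emeasure_mono) auto
  then have "emeasure lborel A = ennreal (measure lborel A)"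
    using measure_closed_domain_pos(2)[OF M] by (intro emeasure_eq_ennreal_measure) (auto simp: top_unique)
  moreover have "emeasure lborel M = ennreal (measure lborel M)"
    using measure_closed_domain_pos(2)[OF M] by (intro emeasure_eq_ennreal_measure) simp
  ultimately have "emeasure (vol M) A = ennreal (measure lborel A / measure lborel M)"
    using measure_closed_domain_pos(3)[OF M] by (simp add: divide_ennreal)
  then show ?thesis by (simp add: measure_def enn2real_ennreal)
qed

lemma measure_vol_ball:
  fixes M :: "(real^'n) set"
  assumes "closed_domain M" "ball c r \<subseteq> M" "0 \<le> r"
  shows "measure (vol M) (ball c r) = unit_ball_vol (real CARD('n)) / measure lborel M * r ^ CARD('n)"
  using measure_vol[OF assms(1) _ assms(2)] content_ball[OF assms(3), of c] by simp

lemma sum_geometric_tail_le: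
  fixes q :: real
  assumes "0 < q" "q < 1"
  shows "(\<Sum>j = i..<N. q ^ j) \<le> q ^ i / (1 - q)"
proof (cases "i \<le> N")
  case True
  then have "(1 - q) * (\<Sum>j = i..<N. q ^ j) = q ^ i - q ^ N"
  proof (induction N rule: dec_induct)
    case (step n)
    then have "(1 - q) * (\<Sum>j = i..<Suc n. q ^ j) = (1 - q) * (\<Sum>j = i..<n. q ^ j) + (1 - q) * q ^ n"
      by (simp add: distrib_left)
    also have "\<dots> = q ^ i - q ^ Suc n" unfolding step.IH by (simp add: algebra_simps)
    finally show ?case .
  qed simp
  then have "(1 - q) * (\<Sum>j = i..<N. q ^ j) \<le> q ^ i" using assms by simp
  then show ?thesis using assms by (simp add: field_simps)
qed (use assms in simp)

text \<open>
  The sum of \<open>t\<^sup>2\<^sup>-\<^sup>d\<close> over the scales \<open>t = q\<^sup>i\<close>; the quotient form avoids a negative exponent.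
\<close>

definition scale_sum :: "real \<Rightarrow> nat \<Rightarrow> nat \<Rightarrow> real" where
  "scale_sum q d N = (\<Sum>i<N. (q ^ i)\<^sup>2 / (q ^ i) ^ d)"

text \<open>
  This is the Cauchy-Schwarz inequality for \<open>h\<close> and \<open>\<Theta> = \<Sum>\<^sub>i t\<^sub>i\<^sup>1\<^sup>-\<^sup>d 1\<^bsub>D i\<^esub>\<close> with \<open>t\<^sub>i = q\<^sup>i\<close>, in its
  additive form with a free parameter \<open>u\<close>. The square of \<open>\<Theta>\<close> is a double sum. Since the intersection
  of two of the sets is no larger than the smaller one, the terms decay geometrically away from the
  diagonal and the diagonal terms dominate.
\<close>

lemma (in prob_space) sum_over_shrinking_sets_le:
  fixes h :: "'a \<Rightarrow> real" and D :: "nat \<Rightarrow> 'a set"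
  assumes q: "0 < q" "q < 1" and D: "\<And>i. D i \<in> sets M" "\<And>i. prob (D i) \<le> K * (q ^ i) ^ d"
    and h: "integrable M h" "integrable M (\<lambda>x. (h x)\<^sup>2)" and u: "0 < u"
  shows "(\<Sum>i<N. q ^ i / (q ^ i) ^ d * (\<integral>x. indicator (D i) x * h x \<partial>M))
    \<le> u / 2 * (\<integral>x. (h x)\<^sup>2 \<partial>M) + K / (1 - q) / u * scale_sum q d N"
proof -
  define w where "w i = q ^ i / (q ^ i) ^ d" for i
  have w0: "0 \<le> w i" for i using q by (simp add: w_def)
  define \<Theta> where "\<Theta> x = (\<Sum>i<N. w i * indicator (D i) x)" for x
  have ind: "integrable M (\<lambda>x. indicator (D i) x * h x)" for i
    using integrable_real_mult_indicator[OF D(1) h(1)] by (simp add: mult.commute)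
  have "\<Theta> x * \<Theta> x = (\<Sum>i<N. \<Sum>j<N. w i * w j * indicator (D i \<inter> D j) x)" for x
    unfolding \<Theta>_def sum_product by (intro sum.cong refl) (simp add: indicator_def)
  then have \<Theta>2: "(\<Theta> x)\<^sup>2 = (\<Sum>i<N. \<Sum>j<N. w i * w j * indicator (D i \<inter> D j) x)" for x
    by (simp add: power2_eq_square)
  have ind2: "integrable M (\<lambda>x. w i * w j * indicator (D i \<inter> D j) x)" for i j
    using D(1) by (intro integrable_mult_right integrable_real_indicator) (auto simp: less_top[symmetric])
  have \<Theta>2_int: "integrable M (\<lambda>x. (\<Theta> x)\<^sup>2)"
    unfolding \<Theta>2 using ind2 by (intro Bochner_Integration.integrable_sum)
  have K0: "0 \<le> K" using order_trans[OF measure_nonneg D(2)[of 0]] by simp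
  have tail: "(\<Sum>j<N. if i \<le> j then K * w i * q ^ j else 0) \<le> K / (1 - q) * ((q ^ i)\<^sup>2 / (q ^ i) ^ d)" for i
  proof -
    have "(\<Sum>j<N. if i \<le> j then K * w i * q ^ j else 0) = (\<Sum>j\<in>{..<N} \<inter> {j. i \<le> j}. K * w i * q ^ j)"
      by (subst sum.inter_restrict) auto
    also have "{..<N} \<inter> {j. i \<le> j} = {i..<N}" by auto
    also have "(\<Sum>j = i..<N. K * w i * q ^ j) = K * w i * (\<Sum>j = i..<N. q ^ j)"
      by (simp add: sum_distrib_left)
    also have "\<dots> \<le> K * w i * (q ^ i / (1 - q))"
      using K0 w0 by (intro mult_left_mono sum_geometric_tail_le q) auto
    also have "\<dots> = K / (1 - q) * ((q ^ i)\<^sup>2 / (q ^ i) ^ d)"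
      by (simp add: w_def power2_eq_square mult_ac)
    finally show ?thesis .
  qed
  have "(\<integral>x. (\<Theta> x)\<^sup>2 \<partial>M) = (\<Sum>i<N. \<Sum>j<N. w i * w j * prob (D i \<inter> D j))"
  proof -
    have "(\<integral>x. (\<Theta> x)\<^sup>2 \<partial>M) = (\<Sum>i<N. \<integral>x. (\<Sum>j<N. w i * w j * indicator (D i \<inter> D j) x) \<partial>M)"
      unfolding \<Theta>2 by (intro Bochner_Integration.integral_sum Bochner_Integration.integrable_sum ind2)
    also have "\<dots> = (\<Sum>i<N. \<Sum>j<N. \<integral>x. w i * w j * indicator (D i \<inter> D j) x \<partial>M)"
      by (intro sum.cong refl Bochner_Integration.integral_sum ind2)
    also have "\<dots> = (\<Sum>i<N. \<Sum>j<N. w i * w j * prob (D i \<inter> D j))"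
      using D(1) by (intro sum.cong refl) (simp del: indicator_inter_arith indicator_simps)
    finally show ?thesis .
  qed
  also have "\<dots> \<le> (\<Sum>i<N. \<Sum>j<N. (if i \<le> j then K * w i * q ^ j else 0) + (if j \<le> i then K * w j * q ^ i else 0))"
  proof (intro sum_mono)
    fix i j :: nat
    have *: "w i * w j * prob (D i \<inter> D j) \<le> K * w i * q ^ j" for i j
    proof -
      have "prob (D i \<inter> D j) \<le> prob (D j)" using D(1) by (intro finite_measure_mono) auto
      also have "\<dots> \<le> K * (q ^ j) ^ d" by (rule D(2))
      finally have "w i * w j * prob (D i \<inter> D j) \<le> w i * w j * (K * (q ^ j) ^ d)"
        using w0 by (intro mult_left_mono) auto
      also have "\<dots> = K * w i * q ^ j" using q by (simp add: w_def)
      finally show ?thesis .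
    qed
    have "0 \<le> K * w i * q ^ j" "0 \<le> K * w j * q ^ i" for i j using K0 w0 q by simp_all
    then show "w i * w j * prob (D i \<inter> D j)
        \<le> (if i \<le> j then K * w i * q ^ j else 0) + (if j \<le> i then K * w j * q ^ i else 0)"
      using *[of i j] *[of j i] by (cases "i \<le> j") (auto simp: Int_commute mult.commute[of "w i"] add_increasing2)
  qed
  also have "\<dots> = 2 * (\<Sum>i<N. \<Sum>j<N. if i \<le> j then K * w i * q ^ j else 0)"
    unfolding sum.distrib
    by (subst (2) sum.swap) simp
  also have "\<dots> \<le> 2 * (\<Sum>i<N. K / (1 - q) * ((q ^ i)\<^sup>2 / (q ^ i) ^ d))"
    by (intro mult_left_mono sum_mono tail) simp
  finally have \<Theta>2_le: "(\<integral>x. (\<Theta> x)\<^sup>2 \<partial>M) \<le> 2 * (K / (1 - q) * scale_sum q d N)"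
    by (simp only: sum_distrib_left scale_sum_def)
  have "(\<Sum>i<N. w i * (\<integral>x. indicator (D i) x * h x \<partial>M)) = (\<integral>x. \<Theta> x * h x \<partial>M)"
  proof -
    have "(\<integral>x. \<Theta> x * h x \<partial>M) = (\<integral>x. (\<Sum>i<N. w i * (indicator (D i) x * h x)) \<partial>M)"
      unfolding \<Theta>_def sum_distrib_right mult.assoc by (rule refl)
    also have "\<dots> = (\<Sum>i<N. \<integral>x. w i * (indicator (D i) x * h x) \<partial>M)"
      using ind by (intro Bochner_Integration.integral_sum integrable_mult_right) auto
    finally show ?thesis by (simp only: integral_mult_right_zero)
  qed
  also have "\<dots> \<le> (\<integral>x. u / 2 * (h x)\<^sup>2 + 1 / (2 * u) * (\<Theta> x)\<^sup>2 \<partial>M)"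
  proof (rule integral_mono)
    show "integrable M (\<lambda>x. \<Theta> x * h x)"
      unfolding \<Theta>_def sum_distrib_right mult.assoc
      using ind by (intro Bochner_Integration.integrable_sum integrable_mult_right) auto
    show "integrable M (\<lambda>x. u / 2 * (h x)\<^sup>2 + 1 / (2 * u) * (\<Theta> x)\<^sup>2)" using h \<Theta>2_int by simp
    fix x
    have "0 \<le> (u * h x - \<Theta> x)\<^sup>2 / (2 * u)" using u by simp
    also have "(u * h x - \<Theta> x)\<^sup>2 / (2 * u) = u / 2 * (h x)\<^sup>2 + 1 / (2 * u) * (\<Theta> x)\<^sup>2 - \<Theta> x * h x"
      using u by (simp add: field_simps power2_eq_square)
    finally show "\<Theta> x * h x \<le> u / 2 * (h x)\<^sup>2 + 1 / (2 * u) * (\<Theta> x)\<^sup>2" by simp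
  qed
  also have "\<dots> = u / 2 * (\<integral>x. (h x)\<^sup>2 \<partial>M) + 1 / (2 * u) * (\<integral>x. (\<Theta> x)\<^sup>2 \<partial>M)"
    using h \<Theta>2_int by simp
  also have "\<dots> \<le> u / 2 * (\<integral>x. (h x)\<^sup>2 \<partial>M) + 1 / (2 * u) * (2 * (K / (1 - q) * scale_sum q d N))"
    using \<Theta>2_le u by (intro add_left_mono mult_left_mono) auto
  also have "\<dots> = u / 2 * (\<integral>x. (h x)\<^sup>2 \<partial>M) + K / (1 - q) / u * scale_sum q d N"
    using u by simp
  finally show ?thesis by (simp only: w_def)
qed

lemma L2_integrable:
  assumes "finite_measure N" "L2 N f" shows "integrable N f"
proof -
  interpret finite_measure N by fact
  have f: "f \<in> borel_measurable N" "integrable N (\<lambda>x. (norm (f x))\<^sup>2)"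
    using assms(2) unfolding L2_def by blast+
  have "integrable N (\<lambda>x. norm (f x))"
    by (rule square_integrable_imp_integrable) (use f in simp_all)
  then show ?thesis using f(1) by (rule integrable_norm_cancel)
qed

text \<open>
  The ratio \<open>q\<close> is so close to 1 that one step moves the centre by at most a quarter of the radius
  available there; a bump of another quarter of this radius stays inside throughout the step.
\<close>

lemma mollifier_chain:
  fixes M :: "(real^'n) set" and G :: "real^'n \<Rightarrow> real^'n"
  assumes M: "closed_domain M"
    and wg: "weak_gradient M f G" and f: "integrable (vol M) f" and G: "integrable (vol M) G"
    and q: "0 < q" "q < 1" and \<rho>: "0 < \<rho>" and \<Lambda>: "\<Lambda> * (1 - q) \<le> \<rho> / 4"
    and c_lip: "\<And>s t. s \<in> {0..1} \<Longrightarrow> t \<in> {0..1} \<Longrightarrow> dist (c s) (c t) \<le> \<Lambda> * \<bar>s - t\<bar>"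
    and c_ball: "\<And>t. t \<in> {0..1} \<Longrightarrow> ball (c t) (\<rho> * t) \<subseteq> M"
  defines "F \<equiv> \<lambda>j. LINT x|vol M. f x * mollifier (\<rho> / 4 * q ^ j) (c (q ^ j)) x"
  shows "F N - F 0 \<le> (\<rho> / 2) / (\<rho> / 4 * q) ^ CARD('n)
      * (\<Sum>j<N. q ^ j / (q ^ j) ^ CARD('n)
          * (LINT x|vol M. indicator (ball (c (q ^ j)) (\<rho> * q ^ j)) x * norm (G x)))"
proof -
  let ?d = "CARD('n)"
  define I where "I j = (LINT x|vol M. indicator (ball (c (q ^ j)) (\<rho> * q ^ j)) x * norm (G x))" for j
  have I0: "0 \<le> I j" for j unfolding I_def by simp
  have step: "F (Suc j) - F j \<le> (\<rho> / 2) / (\<rho> / 4 * q) ^ ?d * (q ^ j / (q ^ j) ^ ?d * I j)" for j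
  proof -
    define t where "t = q ^ j"
    have t: "0 < t" "t \<le> 1" unfolding t_def using q by (auto intro: power_le_one)
    have qt: "0 < q * t" "q * t \<le> t" "q * t \<le> 1" using q t by (auto simp: mult_le_one mult_left_le_one_le)
    have e: "norm (c (q * t) - c t) \<le> \<rho> / 4 * t"
    proof -
      have "norm (c (q * t) - c t) \<le> \<Lambda> * \<bar>q * t - t\<bar>"
        using c_lip[of "q * t" t] t qt by (simp add: dist_norm)
      also have "\<dots> = \<Lambda> * (1 - q) * t" using qt by (simp add: algebra_simps)
      also have "\<dots> \<le> \<rho> / 4 * t" using \<Lambda> t by (intro mult_right_mono) auto
      finally show ?thesis .
    qed
    have \<sigma>: "\<bar>\<rho> / 4 * (q * t) - \<rho> / 4 * t\<bar> \<le> \<rho> / 4 * t"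
    proof -
      have "0 \<le> \<rho> / 4 * (q * t)" "\<rho> / 4 * (q * t) \<le> \<rho> / 4 * t"
        using \<rho> qt by (auto intro!: mult_left_mono)
      then show ?thesis by linarith
    qed
    have "\<bar>(LINT x|vol M. f x * mollifier (\<rho> / 4 * (q * t)) (c (q * t)) x) - (LINT x|vol M. f x * mollifier (\<rho> / 4 * t) (c t) x)\<bar>
      \<le> (norm (c (q * t) - c t) + \<bar>\<rho> / 4 * (q * t) - \<rho> / 4 * t\<bar>) / (\<rho> / 4 * (q * t)) ^ ?d
        * (LINT x|vol M. indicator (ball (c t) (\<rho> * t)) x * norm (G x))"
    proof (rule mollifier_step[OF closed_domain_compact[OF M] wg f G])
      show "0 < \<rho> / 4 * (q * t)" "\<rho> / 4 * (q * t) \<le> \<rho> / 4 * t" using \<rho> qt by (auto intro!: mult_left_mono)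
      show "ball (c t) (\<rho> * t) \<subseteq> interior M" using c_ball[of t] t by (intro interior_maximal) auto
      fix \<tau> :: real assume \<tau>: "\<tau> \<in> {0..1}"
      show "cball (c t + \<tau> *\<^sub>R (c (q * t) - c t)) (\<rho> / 4 * t + \<tau> * (\<rho> / 4 * (q * t) - \<rho> / 4 * t)) \<subseteq> ball (c t) (\<rho> * t)"
      proof
        fix x assume x: "x \<in> cball (c t + \<tau> *\<^sub>R (c (q * t) - c t)) (\<rho> / 4 * t + \<tau> * (\<rho> / 4 * (q * t) - \<rho> / 4 * t))"
        have "dist (c t) x \<le> dist (c t) (c t + \<tau> *\<^sub>R (c (q * t) - c t)) + dist (c t + \<tau> *\<^sub>R (c (q * t) - c t)) x"
          by (rule dist_triangle)
        also have "dist (c t) (c t + \<tau> *\<^sub>R (c (q * t) - c t)) = \<tau> * norm (c (q * t) - c t)"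
          using \<tau> by (simp add: dist_norm)
        also have "\<dots> \<le> 1 * (\<rho> / 4 * t)" using e \<tau> by (intro mult_mono) auto
        also have "dist (c t + \<tau> *\<^sub>R (c (q * t) - c t)) x \<le> \<rho> / 4 * t"
        proof -
          have "\<tau> * (\<rho> / 4 * (q * t) - \<rho> / 4 * t) \<le> 0"
            using \<tau> \<rho> qt by (intro mult_nonneg_nonpos) auto
          then show ?thesis using x by simp
        qed
        finally have "dist (c t) x \<le> \<rho> / 2 * t" by simp
        also have "\<dots> < \<rho> * t" using \<rho> t by simp
        finally show "x \<in> ball (c t) (\<rho> * t)" by simp
      qed
    qed simp_all
    also have "\<dots> \<le> (\<rho> / 4 * t + \<rho> / 4 * t) / (\<rho> / 4 * (q * t)) ^ ?d * I j"
      unfolding I_def t_def[symmetric] using e \<sigma> \<rho> qt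
      by (intro mult_right_mono divide_right_mono add_mono) auto
    also have "\<dots> = (\<rho> / 2) / (\<rho> / 4 * q) ^ ?d * (t / t ^ ?d * I j)"
      by (simp add: power_mult_distrib field_simps)
    finally show ?thesis unfolding F_def t_def by (simp add: mult.commute)
  qed
  have "F N - F 0 \<le> (\<Sum>j<N. (\<rho> / 2) / (\<rho> / 4 * q) ^ ?d * (q ^ j / (q ^ j) ^ ?d * I j))"
  proof (induction N)
    case (Suc N)
    then show ?case using step[of N] by simp
  qed simp
  then show ?thesis by (simp add: I_def sum_distrib_left)
qed

lemma mollifier_bounds:
  fixes c :: "real^'n"
  assumes "0 < s"
  shows "0 \<le> mollifier s c x" "mollifier s c x \<le> 1 / s ^ CARD('n)"
  using assms bump_nonneg[of s c x] bump_le[of s c x]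
  by (simp_all add: mollifier_def power_add field_simps)

lemma mollifier_measurable: "0 < s \<Longrightarrow> mollifier s c \<in> borel_measurable (vol M)"
  unfolding mollifier_def by (auto intro!: continuous_borel_measurable_vol continuous_intros)

text \<open>
  The condition satisfied by the hitting functions, up to time 1, of the set \<open>B\<close>.
\<close>

definition energy_bounded_potential ::
    "(real^'n) set \<Rightarrow> (real^'n) set \<Rightarrow> (real^'n \<Rightarrow> real) \<Rightarrow> bool" where
  "energy_bounded_potential M B f \<longleftrightarrow>
     L2 (vol M) f \<and> (\<forall>x\<in>M. 0 \<le> f x) \<and> (\<forall>x\<in>B. f x = 1)
     \<and> (\<exists>G. L2 (vol M) G \<and> weak_gradient M f G
           \<and> 1 / 2 * (LINT x|vol M. (norm (G x))\<^sup>2) \<le> (LINT x|vol M. f x))"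

text \<open>
  The average against the last bump is at least \<open>\<beta>\<close>, since \<open>f = 1\<close> there; the average against the first
  one is at most a constant times \<open>\<integral>f\<close>. The difference is bounded by the sum over the scales, whose
  energy term is again at most a multiple of \<open>\<integral>f\<close> by hypothesis.
\<close>

lemma energy_lower_bound:
  fixes M :: "(real^'n) set"
  assumes M: "closed_domain M" and \<rho>: "0 < \<rho>" and \<Lambda>: "0 < \<Lambda>"
    and q: "0 < q" "q < 1" "\<Lambda> * (1 - q) \<le> \<rho> / 4"
  obtains \<alpha> where "0 < \<alpha>"
    "\<forall>c N f. inward_path \<rho> \<Lambda> M c \<longrightarrow> 0 < N
      \<longrightarrow> energy_bounded_potential M (ball (c (q ^ N)) (\<rho> / 4 * q ^ N)) f
      \<longrightarrow> \<alpha> \<le> scale_sum q CARD('n) N * (LINT x|vol M. f x)"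
proof -
  let ?d = "CARD('n)"
  define \<omega> where "\<omega> = unit_ball_vol (real ?d) / measure lborel M"
  have \<omega>: "0 < \<omega>" unfolding \<omega>_def using measure_closed_domain_pos[OF M] by simp
  define \<beta> where "\<beta> = 9 / 16 * \<omega> / 2 ^ ?d"
  have \<beta>: "0 < \<beta>" unfolding \<beta>_def using \<omega> by simp
  define A where "A = (\<rho> / 2) / (\<rho> / 4 * q) ^ ?d"
  have A: "0 < A" unfolding A_def using \<rho> q by simp
  define A1 where "A1 = 1 / (\<rho> / 4) ^ ?d"
  have A1: "0 < A1" unfolding A1_def using \<rho> by simp
  define Q where "Q = \<omega> * \<rho> ^ ?d / (1 - q)"
  have Q: "0 < Q" unfolding Q_def using \<omega> \<rho> q by simp
  define \<alpha> where "\<alpha> = (\<beta> / 2) / (A1 + 2 * A\<^sup>2 * Q / \<beta>)"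
  have den: "0 < A1 + 2 * A\<^sup>2 * Q / \<beta>" using A A1 Q \<beta> by (simp add: add_pos_pos)
  have "0 < \<alpha>" unfolding \<alpha>_def using \<beta> den by simp
  moreover have "\<alpha> \<le> scale_sum q ?d N * (LINT x|vol M. f x)"
    if path: "inward_path \<rho> \<Lambda> M c" and N: "0 < N"
      and pot: "energy_bounded_potential M (ball (c (q ^ N)) (\<rho> / 4 * q ^ N)) f" for c N f
  proof -
    have c_lip: "dist (c s) (c t) \<le> \<Lambda> * \<bar>s - t\<bar>" if "s \<in> {0..1}" "t \<in> {0..1}" for s t
      using path that unfolding inward_path_def by blast
    have c_ball: "ball (c t) (\<rho> * t) \<subseteq> M" if "t \<in> {0..1}" for t
      using path that unfolding inward_path_def by blast
    obtain G where f: "L2 (vol M) f" and G: "L2 (vol M) G" and wg: "weak_gradient M f G"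
      and f0: "\<And>x. x \<in> M \<Longrightarrow> 0 \<le> f x"
      and f1: "\<And>x. x \<in> ball (c (q ^ N)) (\<rho> / 4 * q ^ N) \<Longrightarrow> f x = 1"
      and energy: "1 / 2 * (LINT x|vol M. (norm (G x))\<^sup>2) \<le> (LINT x|vol M. f x)"
      using pot unfolding energy_bounded_potential_def by blast
    interpret prob_space "vol M" by (rule prob_space_vol[OF M])
    have fi: "integrable (vol M) f" and Gi: "integrable (vol M) G"
      using f G by (auto intro: L2_integrable finite_measure_axioms)
    define I where "I = (LINT x|vol M. f x)"
    define S where "S = scale_sum q ?d N"
    define F where "F j = (LINT x|vol M. f x * mollifier (\<rho> / 4 * q ^ j) (c (q ^ j)) x)" for j
    have I0: "0 \<le> I" unfolding I_def using f0 by (intro integral_nonneg_AE) auto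
    have S1: "1 \<le> S"
    proof -
      have "(\<Sum>i\<in>{0}. (q ^ i)\<^sup>2 / (q ^ i) ^ ?d) \<le> S"
        unfolding S_def scale_sum_def using N q by (intro sum_mono2) auto
      then show ?thesis by simp
    qed
    have q_power: "q ^ j \<in> {0..1}" for j using q by (simp add: power_le_one)
    have s_pos: "0 < \<rho> / 4 * q ^ j" for j using \<rho> q by simp
    have Fi: "integrable (vol M) (\<lambda>x. f x * mollifier (\<rho> / 4 * q ^ j) (c (q ^ j)) x)" for j
    proof -
      have "norm (mollifier (\<rho> / 4 * q ^ j) (c (q ^ j)) x) \<le> 1 / (\<rho> / 4 * q ^ j) ^ ?d" for x
        using mollifier_bounds[OF s_pos[of j], of "c (q ^ j)" x] by (simp only: real_norm_def abs_of_nonneg)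
      from integrable_scaleR_bounded[OF fi mollifier_measurable[OF s_pos[of j]] this]
      show ?thesis by (simp only: real_scaleR_def)
    qed
    have F0: "F 0 \<le> A1 * I"
    proof -
      have "F 0 \<le> (LINT x|vol M. A1 * f x)"
        unfolding F_def
      proof (rule integral_mono[OF Fi])
        fix x assume "x \<in> space (vol M)"
        then have "0 \<le> f x" using f0 by simp
        moreover have "mollifier (\<rho> / 4 * q ^ 0) (c (q ^ 0)) x \<le> A1"
          using mollifier_bounds(2)[OF s_pos[of 0], of "c (q ^ 0)" x] unfolding A1_def by simp
        ultimately show "f x * mollifier (\<rho> / 4 * q ^ 0) (c (q ^ 0)) x \<le> A1 * f x"
          by (subst mult.commute) (rule mult_right_mono)
      qed (use fi in simp)
      then show ?thesis by (simp add: I_def)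
    qed
    have FN: "\<beta> \<le> F N"
    proof -
      define s where "s = \<rho> / 4 * q ^ N"
      define p where "p = c (q ^ N)"
      have s: "0 < s" unfolding s_def by (rule s_pos)
      have "ball p (s / 2) \<subseteq> ball p (\<rho> * q ^ N)"
        unfolding s_def using \<rho> q by (intro subset_ball) simp
      then have sub: "ball p (s / 2) \<subseteq> M" using c_ball[OF q_power[of N]] by (simp add: p_def)
      have "\<beta> = 9 / 16 / s ^ ?d * measure (vol M) (ball p (s / 2))"
        using measure_vol_ball[OF M sub] s by (simp add: \<beta>_def \<omega>_def power_divide)
      also have "\<dots> = (LINT x|vol M. 9 / 16 / s ^ ?d * indicator (ball p (s / 2)) x)"
        using sub by simp (metis Int_absorb2 space_vol)
      also have "\<dots> \<le> (LINT x|vol M. f x * mollifier s p x)"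
      proof (rule integral_mono)
        show "integrable (vol M) (\<lambda>x. 9 / 16 / s ^ ?d * indicator (ball p (s / 2)) x)"
          using sub M by (intro integrable_mult_right integrable_real_indicator)
            (auto simp: sets_vol less_top[symmetric])
        show "integrable (vol M) (\<lambda>x. f x * mollifier s p x)" unfolding s_def p_def by (rule Fi)
        fix x assume x: "x \<in> space (vol M)"
        show "9 / 16 / s ^ ?d * indicator (ball p (s / 2)) x \<le> f x * mollifier s p x"
        proof (cases "x \<in> ball p (s / 2)")
          case True
          then have "x \<in> ball p s" using s by simp
          then have "f x = 1" using f1 by (simp add: p_def s_def)
          moreover have "9 / 16 / s ^ ?d \<le> mollifier s p x"
            using bump_ge[OF s True] s by (simp add: mollifier_def power_add field_simps)
          ultimately show ?thesis using True by simp
        next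
          case False
          then show ?thesis using f0[of x] x mollifier_bounds(1)[OF s, of p x] by simp
        qed
      qed
      finally show ?thesis by (simp add: F_def s_def p_def)
    qed
    define D where "D i = ball (c (q ^ i)) (\<rho> * q ^ i)" for i
    have D_sub: "D i \<subseteq> M" for i unfolding D_def by (rule c_ball[OF q_power])
    have D_meas: "measure (vol M) (D i) \<le> \<omega> * \<rho> ^ ?d * (q ^ i) ^ ?d" for i
      using measure_vol_ball[OF M D_sub[of i, unfolded D_def]] \<rho> q
      by (simp add: D_def \<omega>_def power_mult_distrib)
    \<comment> \<open>With this parameter the sum over the scales contributes exactly \<open>\<beta> / 2\<close>.\<close>
    define u where "u = 2 * A * Q * S / \<beta>"
    have u: "0 < u" unfolding u_def using A Q S1 \<beta> by simp
    have "F N - F 0 \<le> A * (\<Sum>j<N. q ^ j / (q ^ j) ^ ?d * (LINT x|vol M. indicator (D j) x * norm (G x)))"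
      unfolding F_def A_def D_def
      by (rule mollifier_chain[OF M wg fi Gi q(1,2) \<rho> q(3) c_lip c_ball])
    also have "\<dots> \<le> A * (u / 2 * (LINT x|vol M. (norm (G x))\<^sup>2) + \<omega> * \<rho> ^ ?d / (1 - q) / u * S)"
      unfolding S_def
    proof (intro mult_left_mono sum_over_shrinking_sets_le[OF q(1,2)] D_meas u)
      show "D i \<in> events" for i using D_sub M by (auto simp: sets_vol D_def)
      show "integrable (vol M) (\<lambda>x. norm (G x))" using Gi by (rule integrable_norm)
      show "integrable (vol M) (\<lambda>x. (norm (G x))\<^sup>2)" using G by (simp add: L2_def)
      show "0 \<le> A" using A by simp
    qed
    also have "\<dots> = A * (u * (1 / 2 * (LINT x|vol M. (norm (G x))\<^sup>2)) + Q / u * S)"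
      by (simp add: Q_def)
    also have "\<dots> \<le> A * (u * I + Q / u * S)"
      using A u energy by (intro mult_left_mono add_right_mono) (auto simp: I_def)
    also have "\<dots> = A * u * I + \<beta> / 2"
      using A Q S1 \<beta> by (simp add: u_def field_simps)
    finally have "\<beta> / 2 \<le> A1 * I + A * u * I" using F0 FN by linarith
    also have "A * u * I = 2 * A\<^sup>2 * Q / \<beta> * (S * I)" by (simp add: u_def power2_eq_square)
    also have "A1 * I \<le> A1 * (S * I)" using A1 I0 S1 by (intro mult_left_mono) (auto simp: mult_le_cancel_right1)
    finally have "\<beta> / 2 \<le> (A1 + 2 * A\<^sup>2 * Q / \<beta>) * (S * I)" by (simp add: distrib_right)
    then show ?thesis
      unfolding \<alpha>_def S_def[symmetric] I_def[symmetric] pos_divide_le_eq[OF den]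
      by (subst mult.commute)
  qed
  ultimately show ?thesis by (intro that) blast+
qed

text \<open>
  The smallest scale is the first power of \<open>q\<close> below \<open>\<theta> * \<epsilon>\<close>. In dimension 2 all terms are 1 and their
  number is of order \<open>ln (1 / \<epsilon>)\<close>; in higher dimension the sum is geometric and its largest term is of
  order \<open>\<epsilon>\<^sup>2\<^sup>-\<^sup>d\<close>.
\<close>

lemma scale_sum_le_kappa:
  fixes q \<theta> :: real
  assumes d: "2 \<le> d" and q: "0 < q" "q < 1" and \<theta>: "0 < \<theta>" "\<theta> < 1"
  obtains K where "0 < K"
    "\<forall>\<epsilon>. 0 < \<epsilon> \<longrightarrow> \<epsilon> < min \<theta> (exp (- 1)) \<longrightarrow> (\<exists>N>0. q ^ N \<le> \<theta> * \<epsilon>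
        \<and> scale_sum q d N * kappa d \<epsilon> \<le> K)"
proof -
  define K where "K = (if d = 2 then 1 + 2 / ln (1 / q) else 1 / \<theta> ^ (d - 2) / (1 - q))"
  have lnq: "0 < ln (1 / q)" using q by (simp add: ln_div)
  have "0 < K" unfolding K_def using lnq q \<theta> by (auto intro: add_pos_pos)
  moreover have "\<exists>N>0. q ^ N \<le> \<theta> * \<epsilon> \<and> scale_sum q d N * kappa d \<epsilon> \<le> K"
    if \<epsilon>: "0 < \<epsilon>" "\<epsilon> < min \<theta> (exp (- 1))" for \<epsilon>
  proof -
    have \<theta>\<epsilon>: "0 < \<theta> * \<epsilon>" "\<theta> * \<epsilon> < 1"
    proof -
      have "\<epsilon> < 1" using \<epsilon> \<theta> by linarith
      then show "\<theta> * \<epsilon> < 1" using \<epsilon> \<theta> mult_strict_mono[of \<theta> 1 \<epsilon> 1] by simp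
    qed (use \<epsilon> \<theta> in simp)
    define N where "N = (LEAST N. q ^ N \<le> \<theta> * \<epsilon>)"
    have ex: "\<exists>N. q ^ N \<le> \<theta> * \<epsilon>" using real_arch_pow_inv[OF \<theta>\<epsilon>(1) q(2)] less_imp_le by blast
    then have N: "q ^ N \<le> \<theta> * \<epsilon>" unfolding N_def by (rule LeastI_ex)
    have N0: "0 < N" using N \<theta>\<epsilon> by (cases N) auto
    have N': "\<theta> * \<epsilon> < q ^ (N - 1)"
      using N0 not_less_Least[of "N - 1" "\<lambda>N. q ^ N \<le> \<theta> * \<epsilon>"] unfolding N_def by simp
    have "scale_sum q d N * kappa d \<epsilon> \<le> K"
    proof (cases "d = 2")
      case True
      have ln1: "1 \<le> ln (1 / \<epsilon>)"
      proof -
        have "ln \<epsilon> \<le> ln (exp (- 1))" using \<epsilon> by (subst ln_le_cancel_iff) auto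
        then show ?thesis using \<epsilon> by (simp add: ln_div)
      qed
      have "ln (\<theta> * \<epsilon>) < ln (q ^ (N - 1))" using N' \<theta>\<epsilon> q by (subst ln_less_cancel_iff) auto
      then have "ln \<theta> + ln \<epsilon> < real (N - 1) * ln q" using \<theta> \<epsilon> q by (simp add: ln_mult ln_realpow)
      moreover have "ln \<epsilon> < ln \<theta>" using \<epsilon> \<theta> by (subst ln_less_cancel_iff) auto
      moreover have "ln (1 / q) = - ln q" "ln (1 / \<epsilon>) = - ln \<epsilon>" using \<epsilon> q by (simp_all add: ln_div)
      ultimately have "real (N - 1) * ln (1 / q) \<le> 2 * ln (1 / \<epsilon>)"
        by (simp only: mult_minus_right)
      then have "real (N - 1) \<le> 2 / ln (1 / q) * ln (1 / \<epsilon>)" using lnq by (simp add: field_simps)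
      moreover have "real N = real (N - 1) + 1" using N0 by simp
      ultimately have "real N \<le> 2 / ln (1 / q) * ln (1 / \<epsilon>) + 1 * ln (1 / \<epsilon>)" using ln1 by linarith
      then have "real N \<le> K * ln (1 / \<epsilon>)" using True by (simp add: K_def distrib_right)
      then have "real N * inverse (ln (1 / \<epsilon>)) \<le> K" using ln1 by (simp add: field_simps)
      moreover have "(q ^ i)\<^sup>2 / (q ^ i) ^ d = 1" for i using True q by simp
      ultimately show ?thesis using True by (simp add: scale_sum_def kappa_def inverse_eq_divide)
    next
      case False
      define e where "e = d - 2"
      have e: "d = e + 2" "1 \<le> e" using d False by (auto simp: e_def)
      have summand: "(q ^ i)\<^sup>2 / (q ^ i) ^ d \<le> 1 / (\<theta> * \<epsilon>) ^ e * q ^ (N - Suc i)" if i: "i < N" for i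
      proof -
        have "(q ^ i)\<^sup>2 / (q ^ i) ^ d = 1 / (q ^ i) ^ e" unfolding e(1) power_add using q by simp
        also have "\<dots> = (q ^ (N - Suc i)) ^ e / (q ^ (N - 1)) ^ e"
        proof -
          have "q ^ (N - 1) = q ^ i * q ^ (N - Suc i)" using i by (simp flip: power_add)
          then show ?thesis using q by (simp add: power_mult_distrib)
        qed
        also have "\<dots> \<le> (q ^ (N - Suc i)) ^ e / (\<theta> * \<epsilon>) ^ e"
          using N' \<theta>\<epsilon> q by (intro divide_left_mono power_mono mult_pos_pos) auto
        also have "\<dots> \<le> q ^ (N - Suc i) / (\<theta> * \<epsilon>) ^ e"
        proof (rule divide_right_mono)
          have "(q ^ (N - Suc i)) ^ e \<le> (q ^ (N - Suc i)) ^ 1"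
            using q e by (intro power_decreasing) (auto intro: power_le_one)
          then show "(q ^ (N - Suc i)) ^ e \<le> q ^ (N - Suc i)" by simp
        qed (use \<theta>\<epsilon> in simp)
        finally show ?thesis by simp
      qed
      have "scale_sum q d N \<le> (\<Sum>i<N. 1 / (\<theta> * \<epsilon>) ^ e * q ^ (N - Suc i))"
        unfolding scale_sum_def by (intro sum_mono summand) simp
      also have "\<dots> = 1 / (\<theta> * \<epsilon>) ^ e * (\<Sum>i<N. q ^ i)"
        unfolding sum_distrib_left[symmetric] by (subst sum.nat_diff_reindex) simp
      also have "\<dots> \<le> 1 / (\<theta> * \<epsilon>) ^ e * (1 / (1 - q))"
        using sum_geometric_tail_le[OF q, of 0 N] \<theta>\<epsilon>
        by (intro mult_left_mono) (auto simp: lessThan_atLeast0)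
      finally have "scale_sum q d N * \<epsilon> ^ e \<le> 1 / (\<theta> * \<epsilon>) ^ e * (1 / (1 - q)) * \<epsilon> ^ e"
        using \<epsilon> by (intro mult_right_mono) auto
      also have "\<dots> = K" using False \<epsilon> by (simp add: K_def e_def power_mult_distrib)
      finally show ?thesis using False by (simp add: kappa_def e_def)
    qed
    then show ?thesis using N N0 by blast
  qed
  ultimately show ?thesis by (intro that) blast+
qed

lemma kappa_pos: "0 < \<epsilon> \<Longrightarrow> \<epsilon> < 1 \<Longrightarrow> 0 < kappa d \<epsilon>"
  by (simp add: kappa_def ln_inverse)

text \<open>
  The intrinsic ball is replaced by a Euclidean ball in the interior of \<open>M\<close> of comparable radius, the
  ball around the point of an inward path at a time proportional to \<open>\<epsilon>\<close>.
\<close>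

lemma small_ball_capacity:
  fixes M :: "(real^'n) set"
  assumes d: "2 \<le> CARD('n)" and M: "closed_domain M" and comparable: "intrinsic_comparable M"
    and charts: "uniform_charts M"
  obtains a \<epsilon>\<^sub>0 where "0 < a" "0 < \<epsilon>\<^sub>0" "\<epsilon>\<^sub>0 \<le> 1"
    "\<forall>\<epsilon> y. 0 < \<epsilon> \<longrightarrow> \<epsilon> < \<epsilon>\<^sub>0 \<longrightarrow> y \<in> M \<longrightarrow>
       (\<exists>p s. 0 < s \<and> ball p s \<subseteq> intrinsic_ball M y \<epsilon>
          \<and> (\<forall>f. energy_bounded_potential M (ball p s) f
                \<longrightarrow> a * kappa CARD('n) \<epsilon> \<le> (LINT x|vol M. f x)))"
proof -
  let ?d = "CARD('n)"
  obtain \<rho> \<Lambda> where \<rho>: "0 < \<rho>" and \<Lambda>: "0 < \<Lambda>" and paths: "uniform_inward_paths \<rho> \<Lambda> M"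
    using uniform_inward_paths_of_charts[OF M charts] .
  obtain k r where k: "1 \<le> k" and r: "0 < r"
    and comp: "\<And>x y. x \<in> M \<Longrightarrow> y \<in> M \<Longrightarrow> norm (x - y) < r \<Longrightarrow> intrinsic_dist M x y \<le> ennreal (k * norm (x - y))"
    using comparable unfolding intrinsic_comparable_def by blast
  \<comment> \<open>Close enough to 1 for one step of the chain; the maximum keeps it positive.\<close>
  define q where "q = max (1 / 2) (1 - \<rho> / (4 * \<Lambda>))"
  have q: "0 < q" "q < 1" "\<Lambda> * (1 - q) \<le> \<rho> / 4"
  proof -
    have "1 - q \<le> \<rho> / (4 * \<Lambda>)" unfolding q_def by simp
    then have "\<Lambda> * (1 - q) \<le> \<Lambda> * (\<rho> / (4 * \<Lambda>))" using \<Lambda> by (intro mult_left_mono) auto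
    then show "\<Lambda> * (1 - q) \<le> \<rho> / 4" using \<Lambda> by simp
  qed (use \<rho> \<Lambda> in \<open>auto simp: q_def\<close>)
  define \<theta> where "\<theta> = min (1 / 2) (1 / (2 * k * (\<Lambda> + \<rho>)))"
  have \<theta>: "0 < \<theta>" "\<theta> < 1" unfolding \<theta>_def using k \<rho> \<Lambda> by auto
  have \<theta>': "k * ((\<Lambda> + \<rho>) * \<theta>) \<le> 1 / 2"
  proof -
    have "k * ((\<Lambda> + \<rho>) * \<theta>) \<le> k * ((\<Lambda> + \<rho>) * (1 / (2 * k * (\<Lambda> + \<rho>))))"
      unfolding \<theta>_def using k \<rho> \<Lambda> by (intro mult_left_mono) auto
    also have "\<dots> = 1 / 2"
    proof -
      have "k \<noteq> 0" "\<Lambda> + \<rho> \<noteq> 0" using k \<rho> \<Lambda> by auto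
      then show ?thesis by simp
    qed
    finally show ?thesis .
  qed
  obtain \<alpha> where \<alpha>: "0 < \<alpha>" and lower: "\<forall>c N f. inward_path \<rho> \<Lambda> M c \<longrightarrow> 0 < N
      \<longrightarrow> energy_bounded_potential M (ball (c (q ^ N)) (\<rho> / 4 * q ^ N)) f
      \<longrightarrow> \<alpha> \<le> scale_sum q ?d N * (LINT x|vol M. f x)"
    by (rule energy_lower_bound[OF M \<rho> \<Lambda> q])
  obtain K where K: "0 < K" and scales: "\<forall>\<epsilon>. 0 < \<epsilon> \<longrightarrow> \<epsilon> < min \<theta> (exp (- 1)) \<longrightarrow>
      (\<exists>N>0. q ^ N \<le> \<theta> * \<epsilon> \<and> scale_sum q ?d N * kappa ?d \<epsilon> \<le> K)"
    by (rule scale_sum_le_kappa[OF d q(1,2) \<theta>])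
  define \<epsilon>\<^sub>0 where "\<epsilon>\<^sub>0 = min r (min \<theta> (exp (- 1)))"
  have "\<exists>p s. 0 < s \<and> ball p s \<subseteq> intrinsic_ball M y \<epsilon>
        \<and> (\<forall>f. energy_bounded_potential M (ball p s) f
              \<longrightarrow> \<alpha> / K * kappa ?d \<epsilon> \<le> (LINT x|vol M. f x))"
    if \<epsilon>: "0 < \<epsilon>" "\<epsilon> < \<epsilon>\<^sub>0" and y: "y \<in> M" for \<epsilon> y
  proof -
    obtain c where c0: "c 0 = y" and path: "inward_path \<rho> \<Lambda> M c"
      using paths y unfolding uniform_inward_paths_def by blast
    have c_lip: "dist (c s) (c t) \<le> \<Lambda> * \<bar>s - t\<bar>" if "s \<in> {0..1}" "t \<in> {0..1}" for s t
      using path that unfolding inward_path_def by blast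
    have c_ball: "ball (c t) (\<rho> * t) \<subseteq> M" if "t \<in> {0..1}" for t
      using path that unfolding inward_path_def by blast
    obtain N where N: "0 < N" "q ^ N \<le> \<theta> * \<epsilon>"
      and sum: "scale_sum q ?d N * kappa ?d \<epsilon> \<le> K"
      using scales[rule_format, of \<epsilon>] \<epsilon> unfolding \<epsilon>\<^sub>0_def by auto
    have qN: "0 < q ^ N" "q ^ N \<in> {0..1}" using q by (auto intro: power_le_one)
    define S where "S = scale_sum q ?d N"
    have "\<epsilon> < \<theta>" using \<epsilon> by (simp add: \<epsilon>\<^sub>0_def)
    then have kap: "0 < kappa ?d \<epsilon>" using \<theta> \<epsilon>(1) by (intro kappa_pos) auto
    have "ball (c (q ^ N)) (\<rho> / 4 * q ^ N) \<subseteq> intrinsic_ball M y \<epsilon>"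
    proof
      fix x assume x: "x \<in> ball (c (q ^ N)) (\<rho> / 4 * q ^ N)"
      have "\<rho> / 4 * q ^ N \<le> \<rho> * q ^ N" using \<rho> qN by simp
      then have x': "x \<in> ball (c (q ^ N)) (\<rho> * q ^ N)" using x by simp
      then have xM: "x \<in> M" using c_ball[OF qN(2)] by blast
      have "dist y x \<le> dist y (c (q ^ N)) + dist (c (q ^ N)) x" by (rule dist_triangle)
      also have "dist y (c (q ^ N)) \<le> \<Lambda> * q ^ N" using c_lip[of 0 "q ^ N"] qN c0 by simp
      finally have yx: "dist y x \<le> (\<Lambda> + \<rho>) * q ^ N" using x' by (simp add: distrib_right)
      also have "\<dots> \<le> (\<Lambda> + \<rho>) * (\<theta> * \<epsilon>)" using N \<rho> \<Lambda> by (intro mult_left_mono) auto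
      finally have "k * dist y x \<le> k * ((\<Lambda> + \<rho>) * (\<theta> * \<epsilon>))" using k by (intro mult_left_mono) auto
      also have "\<dots> = k * ((\<Lambda> + \<rho>) * \<theta>) * \<epsilon>" by simp
      also have "\<dots> \<le> 1 / 2 * \<epsilon>" using \<theta>' \<epsilon> by (intro mult_right_mono) auto
      finally have *: "k * dist y x < \<epsilon>" using \<epsilon> by simp
      have "1 * dist y x \<le> k * dist y x" using k by (intro mult_right_mono) auto
      then have "norm (y - x) < r" using * \<epsilon> by (simp add: \<epsilon>\<^sub>0_def dist_norm)
      then have "intrinsic_dist M y x \<le> ennreal (k * norm (y - x))" using y xM by (intro comp)
      also have "\<dots> < ennreal \<epsilon>" using * \<epsilon> by (intro ennreal_lessI) (auto simp: dist_norm)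
      finally show "x \<in> intrinsic_ball M y \<epsilon>" using xM by (simp add: intrinsic_ball_def)
    qed
    moreover have "0 < \<rho> / 4 * q ^ N" using \<rho> qN by simp
    moreover have "\<alpha> / K * kappa ?d \<epsilon> \<le> (LINT x|vol M. f x)"
      if f: "energy_bounded_potential M (ball (c (q ^ N)) (\<rho> / 4 * q ^ N)) f" for f
    proof -
      have f0: "\<forall>x\<in>M. 0 \<le> f x" using f by (simp add: energy_bounded_potential_def)
      have "\<alpha> \<le> S * (LINT x|vol M. f x)"
        using lower path N(1) f unfolding S_def by blast
      then have "kappa ?d \<epsilon> * \<alpha> \<le> kappa ?d \<epsilon> * (S * (LINT x|vol M. f x))"
        using kap by (intro mult_left_mono) auto
      also have "\<dots> = (S * kappa ?d \<epsilon>) * (LINT x|vol M. f x)" by simp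
      also have "\<dots> \<le> K * (LINT x|vol M. f x)"
        using sum f0 unfolding S_def by (intro mult_right_mono integral_nonneg_AE) auto
      finally show ?thesis using K by (simp add: field_simps)
    qed
    ultimately show ?thesis by blast
  qed
  moreover have "0 < \<epsilon>\<^sub>0" "\<epsilon>\<^sub>0 \<le> 1" unfolding \<epsilon>\<^sub>0_def using r \<theta> by auto
  moreover have "0 < \<alpha> / K" using \<alpha> K by simp
  ultimately show ?thesis using that by blast
qed


section \<open>Reflected Brownian motion\<close>

lemma sets_vol_restrict [measurable_cong]: "sets (vol M) = sets (restrict_space borel M)"
  unfolding vol_def by (simp add: sets_restrict_space)

lemma space_path_space: "space (path_space M) = {\<omega> \<in> extensional {0..}. continuous_on {0..} \<omega> \<and> \<omega> ` {0..} \<subseteq> M}"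
  unfolding path_space_def by (auto simp: space_restrict_space space_PiM PiE_def)

lemma evaluation_measurable_borel:
  assumes "0 \<le> t" shows "(\<lambda>\<omega>. \<omega> t) \<in> path_space M \<rightarrow>\<^sub>M borel"
  unfolding path_space_def using assms by (intro measurable_restrict_space1 measurable_component_singleton) auto

lemma evaluation_in: "\<omega> \<in> space (path_space M) \<Longrightarrow> 0 \<le> t \<Longrightarrow> \<omega> t \<in> M"
  by (auto simp: space_path_space)

lemma evaluation_measurable:
  assumes "0 \<le> t" shows "(\<lambda>\<omega>. \<omega> t) \<in> path_space M \<rightarrow>\<^sub>M vol M"
  unfolding measurable_cong_sets[OF refl sets_vol_restrict]
  using assms by (intro measurable_restrict_space2 evaluation_measurable_borel) (auto intro: evaluation_in)

lemma path_shift_measurable: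
  assumes s: "0 \<le> s" shows "path_shift s \<in> path_space M \<rightarrow>\<^sub>M path_space M"
proof -
  have "path_shift s \<in> path_space M \<rightarrow>\<^sub>M (\<Pi>\<^sub>M t\<in>{0..}. borel)"
    unfolding path_shift_def
    by (rule measurable_restrict) (use s in \<open>auto intro!: evaluation_measurable_borel\<close>)
  moreover have "path_shift s \<omega> \<in> {\<omega>. continuous_on {0..} \<omega> \<and> \<omega> ` {0..} \<subseteq> M}"
    if "\<omega> \<in> space (path_space M)" for \<omega>
  proof -
    have "continuous_on {0..} \<omega>" "\<omega> ` {0..} \<subseteq> M" using that by (auto simp: space_path_space)
    then have "continuous_on {0..} (\<lambda>t. \<omega> (s + t))"
      using s by (intro continuous_on_compose2[of "{0..}" \<omega> "{0..}" "\<lambda>t. s + t"] continuous_intros) auto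
    then have "continuous_on {0..} (path_shift s \<omega>)"
      by (rule continuous_on_eq) (simp add: path_shift_def)
    then show ?thesis using \<open>\<omega> ` {0..} \<subseteq> M\<close> s by (auto simp: path_shift_def)
  qed
  ultimately show ?thesis
    unfolding path_space_def[of M] by (intro measurable_restrict_space2) (auto simp: path_space_def)
qed

context
  fixes M :: "(real^'n) set" and P :: "real^'n \<Rightarrow> (real \<Rightarrow> real^'n) measure"
  assumes M: "closed_domain M" and P: "reflected_BM M P"
begin

lemma law_measurable: "P \<in> vol M \<rightarrow>\<^sub>M prob_algebra (path_space M)"
  using P unfolding reflected_BM_def continuous_hunt_process_def
  by (simp add: measurable_cong_sets[OF sets_vol_restrict refl])

lemma law:
  assumes "z \<in> M"
  shows prob_space_law: "prob_space (P z)" and sets_law: "sets (P z) = sets (path_space M)"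
    and space_law: "space (P z) = space (path_space M)"
proof -
  have "P z \<in> space (prob_algebra (path_space M))"
    using measurable_space[OF law_measurable, of z] assms by simp
  then show "prob_space (P z)" "sets (P z) = sets (path_space M)"
    by (auto simp: space_prob_algebra)
  then show "space (P z) = space (path_space M)" by (intro sets_eq_imp_space_eq) simp
qed

lemma measurable_law: "z \<in> M \<Longrightarrow> f \<in> path_space M \<rightarrow>\<^sub>M N \<Longrightarrow> f \<in> P z \<rightarrow>\<^sub>M N"
  by (simp add: measurable_cong_sets[OF sets_law refl])

lemma law_start: "z \<in> M \<Longrightarrow> AE \<omega> in P z. \<omega> 0 = z"
  using P unfolding reflected_BM_def continuous_hunt_process_def by blast

lemma law_bind_measurable:
  assumes "z \<in> M" "0 \<le> s"
  shows "(\<lambda>\<omega>. P (\<omega> s)) \<in> P z \<rightarrow>\<^sub>M subprob_algebra (path_space M)"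
  by (rule measurable_compose[OF measurable_law[OF assms(1) evaluation_measurable[OF assms(2)]]
        measurable_prob_algebraD[OF law_measurable]])

text \<open>
  The strong Markov property at a constant time.
\<close>

lemma markov:
  assumes z: "z \<in> M" and s: "0 \<le> s"
  shows "distr (P z) (path_space M) (path_shift s) = P z \<bind> (\<lambda>\<omega>. P (\<omega> s))"
proof (rule measure_eqI)
  interpret prob_space "P z" by (rule prob_space_law[OF z])
  show "sets (distr (P z) (path_space M) (path_shift s)) = sets (P z \<bind> (\<lambda>\<omega>. P (\<omega> s)))"
    using sets_bind[OF _ not_empty, of "\<lambda>\<omega>. P (\<omega> s)" "path_space M"]
      sets_kernel[OF law_bind_measurable[OF z s]] by simp
  fix B assume "B \<in> sets (distr (P z) (path_space M) (path_shift s))"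
  then have B: "B \<in> sets (path_space M)" by simp
  let ?\<tau> = "\<lambda>_ :: real \<Rightarrow> real^'n. ennreal s"
  let ?\<Lambda> = "space (path_space M)"
  have stop: "stopping_time (right_filtration M) ?\<tau>" by (rule stopping_time_const)
  interpret filtration ?\<Lambda> "right_filtration M" by (rule filtration_right_filtration)
  have "?\<Lambda> \<in> sets (filtration.pre_sigma ?\<Lambda> (right_filtration M) ?\<tau>)"
    using sets.top[of "pre_sigma ?\<tau>"] by (simp add: space_pre_sigma)
  then have "emeasure (P z) {\<omega> \<in> ?\<Lambda>. ?\<tau> \<omega> < \<top> \<and> path_shift (enn2real (?\<tau> \<omega>)) \<omega> \<in> B}
      = (\<integral>\<^sup>+\<omega>. indicator {\<omega> \<in> ?\<Lambda>. ?\<tau> \<omega> < \<top>} \<omega> * emeasure (P (\<omega> (enn2real (?\<tau> \<omega>)))) B \<partial>P z)"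
    using P z stop B unfolding reflected_BM_def continuous_hunt_process_def by blast
  then have "emeasure (P z) {\<omega> \<in> ?\<Lambda>. path_shift s \<omega> \<in> B}
      = (\<integral>\<^sup>+\<omega>. indicator ?\<Lambda> \<omega> * emeasure (P (\<omega> s)) B \<partial>P z)"
    using s by (simp add: ennreal_less_top)
  also have "\<dots> = (\<integral>\<^sup>+\<omega>. emeasure (P (\<omega> s)) B \<partial>P z)"
    by (rule nn_integral_cong) (simp add: space_law[OF z])
  also have "\<dots> = emeasure (P z \<bind> (\<lambda>\<omega>. P (\<omega> s))) B"
    by (rule emeasure_bind[OF not_empty law_bind_measurable[OF z s] B, symmetric])
  finally show "emeasure (distr (P z) (path_space M) (path_shift s)) B = emeasure (P z \<bind> (\<lambda>\<omega>. P (\<omega> s))) B"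
    using measurable_law[OF z path_shift_measurable[OF s]] B
    by (simp add: emeasure_distr vimage_def Int_def space_law[OF z] conj_commute)
qed

lemma markov_integral:
  fixes F :: "(real \<Rightarrow> real^'n) \<Rightarrow> real"
  assumes z: "z \<in> M" and s: "0 \<le> s" and F: "F \<in> borel_measurable (path_space M)"
    and bdd: "\<And>\<omega>. \<omega> \<in> space (path_space M) \<Longrightarrow> \<bar>F \<omega>\<bar> \<le> c"
  shows "(LINT \<omega>|P z. F (path_shift s \<omega>)) = (LINT \<omega>|P z. LINT \<omega>'|P (\<omega> s). F \<omega>')"
proof -
  interpret prob_space "P z" by (rule prob_space_law[OF z])
  have "(LINT \<omega>|P z. F (path_shift s \<omega>)) = (LINT \<omega>|distr (P z) (path_space M) (path_shift s). F \<omega>)"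
    using F by (intro integral_distr[symmetric] measurable_law[OF z path_shift_measurable[OF s]])
  also have "\<dots> = (LINT \<omega>|P z. LINT \<omega>'|P (\<omega> s). F \<omega>')"
    unfolding markov[OF z s]
  proof (rule integral_bind)
    show "(\<lambda>\<omega>. P (\<omega> s)) \<in> P z \<rightarrow>\<^sub>M subprob_algebra (path_space M)" by (rule law_bind_measurable[OF z s])
    show "AE \<omega> in P z. emeasure (P (\<omega> s)) (space (P (\<omega> s))) \<le> ennreal 1"
      using s by (intro AE_I2) (simp add: space_law[OF z] prob_space.emeasure_space_1[OF prob_space_law] evaluation_in)
  qed (use F bdd not_empty in auto)
  finally show ?thesis .
qed

end

lemma bounded_measurable_vol_iff: "bounded_measurable (vol M) f \<longleftrightarrow>
    f \<in> borel_measurable (vol M) \<and> (\<exists>c. \<forall>x\<in>M. \<bar>f x\<bar> \<le> c)"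
  by (simp add: bounded_measurable_def)

lemma (in prob_space) bounded_measurable_L2: "bounded_measurable M f \<Longrightarrow> L2 M f"
  unfolding L2_def by (auto intro!: bounded_measurableD bounded_measurable_integrable bounded_measurable_intros)

lemma bounded_measurable_along_path:
  fixes M :: "(real^'n) set"
  assumes "closed_domain M" "reflected_BM M P" "z \<in> M" "0 \<le> t" "bounded_measurable (vol M) f"
  shows "bounded_measurable (P z) (\<lambda>\<omega>. f (\<omega> t))"
proof -
  obtain c where "\<forall>x\<in>M. \<bar>f x\<bar> \<le> c" using assms(5) by (auto simp: bounded_measurable_vol_iff)
  then show ?thesis
    using assms evaluation_in[of _ M t] space_law[OF assms(1-3)]
      measurable_compose[OF measurable_law[OF assms(1-3) evaluation_measurable[OF assms(4)]] assms(5)[THEN bounded_measurableD]]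
    by (intro bounded_measurableI[where c = c]) auto
qed

definition grid_hits :: "(real^'n) set \<Rightarrow> real \<Rightarrow> (real^'n) set \<Rightarrow> nat \<Rightarrow> (real \<Rightarrow> real^'n) set" where
  "grid_hits M h B k = {\<omega> \<in> space (path_space M). \<exists>j\<le>k. \<omega> (real j * h) \<in> B}"

context
  fixes M :: "(real^'n) set" and P :: "real^'n \<Rightarrow> (real \<Rightarrow> real^'n) measure"
  assumes M: "closed_domain M" and P: "reflected_BM M P"
begin

text \<open>
  Everything is a property of integration with respect to the laws, except the semigroup law, which is
  the Markov property, and the symmetry, which is assumed of the process.
\<close>

lemma transition_semigroup_markov: "symmetric_markov_semigroup (vol M) (transition_semigroup P)"
proof -
  interpret vol: prob_space "vol M" by (rule prob_space_vol[OF M])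
  note path_bm = bounded_measurable_along_path[OF M P]
  have path_int: "integrable (P z) (\<lambda>\<omega>. f (\<omega> t))"
    if "z \<in> M" "0 \<le> t" "bounded_measurable (vol M) f" for z t f
  proof -
    interpret prob_space "P z" by (rule prob_space_law[OF M P that(1)])
    show ?thesis using path_bm[OF that] by (rule bounded_measurable_integrable)
  qed
  have bounded: "bounded_measurable (vol M) (transition_semigroup P t f)"
    if t: "0 \<le> t" and f: "bounded_measurable (vol M) f" for t f
  proof -
    obtain c where c: "\<forall>x\<in>M. \<bar>f x\<bar> \<le> c" using f by (auto simp: bounded_measurable_vol_iff)
    have "transition_semigroup P t f \<in> borel_measurable (vol M)"
      unfolding transition_semigroup_def
      using measurable_compose[OF measurable_prob_algebraD[OF law_measurable[OF M P]]
          integral_measurable_subprob_algebra[OF measurable_compose[OF evaluation_measurable[OF t] f[THEN bounded_measurableD]]]] .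
    moreover have "\<bar>transition_semigroup P t f x\<bar> \<le> c" if x: "x \<in> M" for x
    proof -
      interpret prob_space "P x" by (rule prob_space_law[OF M P x])
      have "\<bar>transition_semigroup P t f x\<bar> \<le> (LINT \<omega>|P x. \<bar>f (\<omega> t)\<bar>)"
        unfolding transition_semigroup_def by (rule integral_abs_bound)
      also have "\<dots> \<le> (LINT \<omega>|P x. c)"
        using path_int[OF x t f] c evaluation_in[OF _ t, of _ M]
        by (intro integral_mono integrable_abs) (auto simp: space_law[OF M P x])
      finally show ?thesis by (simp add: prob_space)
    qed
    ultimately show ?thesis by (intro bounded_measurableI[where c = c]) auto
  qed
  show ?thesis
  proof (unfold_locales, goal_cases)
    case (1 t f) then show ?case by (rule bounded)
  next
    case (2 t f g x a b)
    then show ?case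
      using path_int[of x t f] path_int[of x t g] by (simp add: transition_semigroup_def)
  next
    case (3 t f x)
    then show ?case unfolding transition_semigroup_def
      using evaluation_in[OF _ 3(1), of _ M] by (intro integral_nonneg_AE AE_I2) (auto simp: space_law[OF M P])
  next
    case (4 t x)
    then interpret prob_space "P x" by (intro prob_space_law[OF M P]) simp
    show ?case by (simp add: transition_semigroup_def prob_space)
  next
    case (5 f x)
    then have x: "x \<in> M" by simp
    interpret prob_space "P x" by (rule prob_space_law[OF M P x])
    have "(LINT \<omega>|P x. f (\<omega> 0)) = (LINT \<omega>|P x. f x)"
      using law_start[OF M P x] path_bm[OF x order_refl 5(1), THEN bounded_measurableD]
      by (intro integral_cong_AE) auto
    then show ?case by (simp add: transition_semigroup_def prob_space)
  next
    case (6 s t f x)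
    then have x: "x \<in> M" by simp
    obtain c where c: "\<forall>x\<in>M. \<bar>f x\<bar> \<le> c" using 6(3) by (auto simp: bounded_measurable_vol_iff)
    have "(LINT \<omega>|P x. f (path_shift s \<omega> t)) = (LINT \<omega>|P x. LINT \<omega>'|P (\<omega> s). f (\<omega>' t))"
      by (rule markov_integral[OF M P x 6(1), where c = c])
        (use c 6 evaluation_in in \<open>auto intro: measurable_compose[OF evaluation_measurable] bounded_measurableD\<close>)
    then show ?case using 6(1,2) by (simp add: transition_semigroup_def path_shift_def)
  next
    case (7 t f g)
    then show ?case
      using P vol.bounded_measurable_L2 unfolding reflected_BM_def symmetric_process_def by blast
  next
    case (8 t F f c x)
    then have x: "x \<in> M" by simp
    interpret prob_space "P x" by (rule prob_space_law[OF M P x])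
    show ?case unfolding transition_semigroup_def
    proof (rule integral_dominated_convergence[where w = "\<lambda>_. c"])
      show "(\<lambda>\<omega>. f (\<omega> t)) \<in> borel_measurable (P x)" "(\<lambda>\<omega>. F n (\<omega> t)) \<in> borel_measurable (P x)" for n
        using path_bm[OF x 8(1)] 8(2,3) by (auto intro: bounded_measurableD)
    qed (use 8 evaluation_in[OF _ 8(1), of _ M] in \<open>auto simp: space_law[OF M P x]\<close>)
  qed
qed

interpretation S: symmetric_markov_semigroup "vol M" "transition_semigroup P"
  by (rule transition_semigroup_markov)

lemma grid_hits_measurable:
  assumes B: "B \<in> sets (vol M)" and h: "0 \<le> h"
  shows "grid_hits M h B k \<in> sets (path_space M)"
proof -
  have "grid_hits M h B k = (\<Union>j\<le>k. (\<lambda>\<omega>. \<omega> (real j * h)) -` B \<inter> space (path_space M))"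
    by (auto simp: grid_hits_def)
  also have "\<dots> \<in> sets (path_space M)"
    using h by (intro sets.finite_UN measurable_sets[OF evaluation_measurable B]) auto
  finally show ?thesis .
qed

text \<open>
  Almost surely the path starts at \<open>z\<close>. If \<open>z\<close> is not in \<open>B\<close>, a visit at one of the times
  \<open>0, h, \<dots>, (k + 1) h\<close> is a visit of the path shifted by \<open>h\<close> at one of the times \<open>0, h, \<dots>, k h\<close>.
\<close>

lemma hit_probability:
  assumes B: "B \<in> sets (vol M)" and h: "0 \<le> h" and z: "z \<in> M"
  shows "measure (P z) (grid_hits M h B k) = S.hit h B k z"
  using z
proof (induction k arbitrary: z)
  case 0
  interpret prob_space "P z" by (rule prob_space_law[OF M P 0])
  let ?E = "grid_hits M h B 0"
  have E: "?E \<in> sets (P z)"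
    unfolding sets_law[OF M P 0] by (rule grid_hits_measurable[OF B h])
  have "prob ?E = expectation (indicator ?E)" using E by simp
  also have "\<dots> = expectation (\<lambda>_. indicator B z)"
  proof (rule integral_cong_AE)
    show "AE \<omega> in P z. indicat_real ?E \<omega> = indicator B z"
      using law_start[OF M P 0]
      by (rule AE_mp) (rule AE_I2, unfold space_law[OF M P 0], auto simp: grid_hits_def indicator_def)
  qed (use E in auto)
  finally show ?case by (simp add: prob_space)
next
  case (Suc k)
  note z = Suc.prems
  interpret prob_space "P z" by (rule prob_space_law[OF M P z])
  define E where "E = grid_hits M h B"
  have E: "E k \<in> sets (path_space M)" for k unfolding E_def by (rule grid_hits_measurable[OF B h])
  have EP: "E k \<in> sets (P z)" for k unfolding sets_law[OF M P z] by (rule E)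
  have "prob (E (Suc k)) = S.hit h B (Suc k) z"
  proof (cases "z \<in> B")
    case True
    have "AE \<omega> in P z. \<omega> \<in> E (Suc k)"
      using law_start[OF M P z]
    proof (rule AE_mp, intro AE_I2 impI)
      fix \<omega> assume "\<omega> \<in> space (P z)" "\<omega> 0 = z"
      then show "\<omega> \<in> E (Suc k)"
        using True unfolding E_def grid_hits_def space_law[OF M P z] by (auto intro!: exI[of _ 0])
    qed
    then have "prob (E (Suc k)) = 1" using EP by (subst prob_eq_1)
    then show ?thesis using True by simp
  next
    case False
    have "prob (E (Suc k)) = expectation (indicator (E (Suc k)))" using EP by simp
    also have "\<dots> = expectation (\<lambda>\<omega>. indicat_real (E k) (path_shift h \<omega>))"
    proof (rule integral_cong_AE)
      show "(\<lambda>\<omega>. indicat_real (E k) (path_shift h \<omega>)) \<in> borel_measurable (P z)"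
        using E by (intro measurable_law[OF M P z] measurable_compose[OF path_shift_measurable[OF h]]) auto
      have eq: "indicat_real (E (Suc k)) \<omega> = indicat_real (E k) (path_shift h \<omega>)"
        if \<omega>: "\<omega> \<in> space (path_space M)" and \<omega>0: "\<omega> 0 = z" for \<omega>
      proof -
        have shift: "path_shift h \<omega> \<in> space (path_space M)"
          using measurable_space[OF path_shift_measurable[OF h] \<omega>] .
        have "(\<exists>j\<le>Suc k. \<omega> (real j * h) \<in> B) \<longleftrightarrow> (\<exists>j\<le>k. \<omega> (real (Suc j) * h) \<in> B)"
        proof
          assume "\<exists>j\<le>Suc k. \<omega> (real j * h) \<in> B"
          then obtain j where j: "j \<le> Suc k" "\<omega> (real j * h) \<in> B" by blast
          then have "j \<noteq> 0" using False \<omega>0 by (intro notI) simp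
          then show "\<exists>j\<le>k. \<omega> (real (Suc j) * h) \<in> B" using j by (cases j) auto
        qed auto
        moreover have "path_shift h \<omega> (real j * h) = \<omega> (real (Suc j) * h)" for j
          using h by (simp add: path_shift_def algebra_simps)
        ultimately show ?thesis using \<omega> shift by (simp add: E_def grid_hits_def indicator_def)
      qed
      show "AE \<omega> in P z. indicat_real (E (Suc k)) \<omega> = indicat_real (E k) (path_shift h \<omega>)"
        using law_start[OF M P z]
        by (rule AE_mp) (intro AE_I2 impI eq, simp_all only: space_law[OF M P z])
    qed (use EP in auto)
    also have "\<dots> = (LINT \<omega>|P z. LINT \<omega>'|P (\<omega> h). indicat_real (E k) \<omega>')"
      by (rule markov_integral[OF M P z h, where c = 1]) (use E in auto)
    also have "\<dots> = (LINT \<omega>|P z. S.hit h B k (\<omega> h))"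
    proof (rule Bochner_Integration.integral_cong[OF refl])
      fix \<omega> assume "\<omega> \<in> space (P z)"
      then have w: "\<omega> h \<in> M" using evaluation_in[OF _ h] by (simp add: space_law[OF M P z])
      have "(LINT \<omega>'|P (\<omega> h). indicat_real (E k) \<omega>') = measure (P (\<omega> h)) (E k)"
      proof -
        have "E k \<subseteq> space (P (\<omega> h))"
          unfolding space_law[OF M P w] E_def grid_hits_def by (rule Collect_restrict)
        then have "E k \<inter> space (P (\<omega> h)) = E k" by (rule Int_absorb2)
        then show ?thesis by (simp only: Bochner_Integration.integral_indicator)
      qed
      also have "\<dots> = S.hit h B k (\<omega> h)" unfolding E_def by (rule Suc.IH[OF w])
      finally show "(LINT \<omega>'|P (\<omega> h). indicat_real (E k) \<omega>') = S.hit h B k (\<omega> h)" .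
    qed
    finally show ?thesis using False by (simp add: transition_semigroup_def)
  qed
  then show ?case unfolding E_def .
qed

text \<open>
  A bounded function whose energy quotients converge is in the domain of the form, and the limit is
  its Dirichlet energy.
\<close>

lemma hit_limit_energy_bounded:
  assumes u: "bounded_measurable (vol M) u" "\<And>x. x \<in> M \<Longrightarrow> 0 \<le> u x" "\<And>x. x \<in> B \<Longrightarrow> u x = 1"
    and loss: "\<And>t. 0 < t \<Longrightarrow> S.loss t u / t \<le> (LINT x|vol M. u x)"
  shows "energy_bounded_potential M B u"
proof -
  have L2: "L2 (vol M) u" using u(1) by (rule S.bounded_measurable_L2)
  have form: "approx_form M P t u u = S.loss t u / t" for t
    by (simp add: approx_form_def S.loss_def)
  obtain l where l: "((\<lambda>t. approx_form M P t u u) \<longlongrightarrow> l) (at_right 0)" "l \<le> (LINT x|vol M. u x)"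
    using S.loss_quotient_tendsto[OF u(1) loss] unfolding form by blast
  have assoc: "associated_neumann_form M P" using P by (simp add: reflected_BM_def)
  then have sob: "u \<in> sobolev M" using L2 l(1) unfolding associated_neumann_form_def by blast
  then have "((\<lambda>t. approx_form M P t u u) \<longlongrightarrow> dirichlet_form M u u) (at_right 0)"
    using assoc unfolding associated_neumann_form_def by blast
  then have "dirichlet_form M u u = l" using l(1) by (rule tendsto_unique[OF trivial_limit_at_right_real])
  then have "1 / 2 * (LINT x|vol M. (norm (grad M u x))\<^sup>2) \<le> (LINT x|vol M. u x)"
    using l(2) by (simp add: dirichlet_form_def power2_norm_eq_inner)
  moreover have "L2 (vol M) (grad M u) \<and> weak_gradient M u (grad M u)"
    using sob unfolding sobolev_def grad_def by (metis (mono_tags, lifting) mem_Collect_eq someI_ex)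
  ultimately show ?thesis
    using L2 u unfolding energy_bounded_potential_def by blast
qed

text \<open>
  The energy quotients of an invariant function vanish for small times, so its Dirichlet form with
  every function is 0 and it is an eigenfunction for the eigenvalue 0.
\<close>

lemma invariant_imp_constant:
  assumes gap: "positive_spectral_gap M" and s: "0 < s"
    and f: "bounded_measurable (vol M) f"
    and inv: "\<And>t. 0 \<le> t \<Longrightarrow> t \<le> s \<Longrightarrow> AE x in vol M. transition_semigroup P t f x = f x"
  shows "\<exists>c. AE x in vol M. f x = c"
proof -
  have L2: "L2 (vol M) f" using f by (rule S.bounded_measurable_L2)
  have assoc: "associated_neumann_form M P" using P by (simp add: reflected_BM_def)
  have zero: "approx_form M P t f g = 0" if t: "0 < t" "t < s" for t g
  proof -
    have "AE x in vol M. (f x - transition_semigroup P t f x) * g x = 0"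
      using inv[of t] t by (auto elim!: AE_mp)
    then have "(LINT x|vol M. (f x - transition_semigroup P t f x) * g x) = 0"
      by (rule integral_eq_zero_AE)
    then show ?thesis by (simp add: approx_form_def)
  qed
  have lim: "((\<lambda>t. approx_form M P t f g) \<longlongrightarrow> 0) (at_right 0)" for g
  proof (rule tendsto_eventually)
    show "\<forall>\<^sub>F t in at_right 0. approx_form M P t f g = 0"
      using eventually_at_right_less[of 0] eventually_at_right_real[OF s]
      by eventually_elim (use zero in auto)
  qed
  then have sob: "f \<in> sobolev M" using assoc L2 unfolding associated_neumann_form_def by blast
  have "dirichlet_form M f v = 0" if "v \<in> sobolev M" for v
    using assoc sob that lim[of v] tendsto_unique[OF trivial_limit_at_right_real]
    unfolding associated_neumann_form_def by blast
  then have "f \<in> neumann_eigenspace M 0"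
    using sob by (simp add: neumann_eigenspace_def neumann_operator_def L2_def)
  then show ?thesis using gap unfolding positive_spectral_gap_def by blast
qed

lemma kernel_bound:
  assumes p: "neumann_heat_kernel M P p" and t: "0 < t" and a: "\<And>x y. x \<in> M \<Longrightarrow> y \<in> M \<Longrightarrow> p t x y \<le> a"
    and f: "bounded_measurable (vol M) f" and x: "x \<in> M"
  shows "\<bar>transition_semigroup P t f x\<bar> \<le> a * (LINT y|vol M. \<bar>f y\<bar>)"
proof -
  have p_meas: "(\<lambda>(x, y). p t x y) \<in> borel_measurable (vol M \<Otimes>\<^sub>M vol M)"
    and p_nonneg: "\<And>y. y \<in> M \<Longrightarrow> 0 \<le> p t x y"
    and p_density: "distr (P x) (vol M) (\<lambda>\<omega>. \<omega> t) = density (vol M) (\<lambda>y. ennreal (p t x y))"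
    using p t x unfolding neumann_heat_kernel_def by blast+
  have p_x: "p t x \<in> borel_measurable (vol M)"
    using measurable_compose[OF measurable_Pair1'[of x "vol M" "vol M"] p_meas] x by simp
  have f_meas: "f \<in> borel_measurable (vol M)" using f by (rule bounded_measurableD)
  have "transition_semigroup P t f x = (LINT y|distr (P x) (vol M) (\<lambda>\<omega>. \<omega> t). f y)"
    unfolding transition_semigroup_def
    using t f_meas by (intro integral_distr[symmetric] measurable_law[OF M P x] evaluation_measurable) auto
  also have "\<dots> = (LINT y|vol M. p t x y * f y)"
    unfolding p_density using p_x f_meas p_nonneg by (subst integral_real_density) auto
  finally have "\<bar>transition_semigroup P t f x\<bar> \<le> (LINT y|vol M. \<bar>p t x y * f y\<bar>)"
    by (simp add: integral_abs_bound)
  also have "\<dots> \<le> (LINT y|vol M. a * \<bar>f y\<bar>)"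
  proof (rule integral_mono')
    show "integrable (vol M) (\<lambda>y. a * \<bar>f y\<bar>)"
      using f by (intro S.bounded_measurable_integrable bounded_measurable_intros)
    fix y assume "y \<in> space (vol M)"
    then show "\<bar>p t x y * f y\<bar> \<le> a * \<bar>f y\<bar>"
      using p_nonneg[of y] a[OF x, of y] by (simp add: abs_mult mult_right_mono)
    then show "0 \<le> a * \<bar>f y\<bar>" by (rule order_trans[OF abs_ge_zero])
  qed
  finally show ?thesis by simp
qed

end


section \<open>Hitting all balls of a certificate\<close>

text \<open>
  A block consists of \<open>J\<close> units of time for mixing and one more for hitting the ball from an
  approximately stationary start. The mesh \<open>n\<close> of the grid may depend on the ball, since the bound
  does not.
\<close>

lemma uniform_hitting_bound:
  fixes M :: "(real^'n) set"
  assumes d: "2 \<le> CARD('n)" and M: "closed_domain M" and comparable: "intrinsic_comparable M"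
    and charts: "uniform_charts M" and gap: "positive_spectral_gap M"
    and P: "reflected_BM M P" and compact: "\<forall>t>0. L2_compact (vol M) (transition_semigroup P t)"
    and p: "neumann_heat_kernel M P p" and bdd: "\<forall>t\<ge>s\<^sub>0. \<forall>x\<in>M. \<forall>y\<in>M. p t x y \<le> a"
  obtains c \<epsilon>\<^sub>0 and t\<^sub>1 :: nat where "0 < c" "0 < \<epsilon>\<^sub>0" "\<epsilon>\<^sub>0 \<le> 1" "0 < t\<^sub>1"
    "\<forall>\<epsilon> y. 0 < \<epsilon> \<longrightarrow> \<epsilon> < \<epsilon>\<^sub>0 \<longrightarrow> y \<in> M \<longrightarrow>
       (\<exists>B n. B \<in> sets (vol M) \<and> B \<subseteq> intrinsic_ball M y \<epsilon>
          \<and> (\<forall>z\<in>M. \<forall>j. 1 - exp (- (c * kappa CARD('n) \<epsilon> * real j))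
                \<le> measure (P z) (grid_hits M (1 / 2 ^ n) B (j * (t\<^sub>1 * 2 ^ n)))))"
proof -
  interpret S: symmetric_markov_semigroup "vol M" "transition_semigroup P"
    by (rule transition_semigroup_markov[OF M P])
  \<comment> \<open>An integer time, so that multiples of it lie on every dyadic grid.\<close>
  define s where "s = real (max 1 (nat \<lceil>s\<^sub>0\<rceil>))"
  have s: "0 < s" "s\<^sub>0 \<le> s" unfolding s_def by (simp, linarith)
  have ultra: "\<bar>transition_semigroup P s f x\<bar> \<le> a * (LINT y|vol M. \<bar>f y\<bar>)"
    if "bounded_measurable (vol M) f" "x \<in> space (vol M)" for f x
    using that bdd s by (intro kernel_bound[OF M P p]) auto
  have "\<exists>\<rho>\<ge>0. \<rho> < 1 \<and> (\<forall>f. bounded_measurable (vol M) f \<longrightarrow> (LINT x|vol M. f x) = 0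
        \<longrightarrow> (LINT x|vol M. (transition_semigroup P s f x)\<^sup>2) \<le> \<rho> * (LINT x|vol M. (f x)\<^sup>2))"
  proof (rule S.spectral_gap[OF s(1) ultra])
    fix F :: "nat \<Rightarrow> real^'n \<Rightarrow> real"
    assume F: "\<And>n. bounded_measurable (vol M) (F n)" "\<And>n. (LINT x|vol M. (F n x)\<^sup>2) \<le> 1"
    have "L2_compact (vol M) (transition_semigroup P s)" using compact s by blast
    moreover have "\<forall>n. L2 (vol M) (F n) \<and> (LINT x|vol M. (F n x)\<^sup>2) \<le> 1"
      using F by (auto intro: S.bounded_measurable_L2)
    ultimately obtain g r where g: "L2 (vol M) g" and r: "strict_mono (r :: nat \<Rightarrow> nat)"
      and lim: "(\<lambda>n. LINT x|vol M. (transition_semigroup P s (F (r n)) x - g x)\<^sup>2) \<longlonglongrightarrow> 0"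
      unfolding L2_compact_def by blast
    have "g \<in> borel_measurable (vol M)" "integrable (vol M) (\<lambda>x. (g x)\<^sup>2)"
      using g by (simp_all add: L2_def)
    with r lim show "\<exists>g r. g \<in> borel_measurable (vol M) \<and> integrable (vol M) (\<lambda>x. (g x)\<^sup>2) \<and> strict_mono (r :: nat \<Rightarrow> nat)
        \<and> (\<lambda>n. LINT x|vol M. (transition_semigroup P s (F (r n)) x - g x)\<^sup>2) \<longlonglongrightarrow> 0"
      by (intro exI[of _ g] exI[of _ r] conjI)
  next
    fix f assume "bounded_measurable (vol M) f"
      and "\<And>t. 0 \<le> t \<Longrightarrow> t \<le> s \<Longrightarrow> AE x in vol M. transition_semigroup P t f x = f x"
    then show "\<exists>c. AE x in vol M. f x = c" by (rule invariant_imp_constant[OF M P gap s(1)])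
  qed
  then obtain \<rho> where \<rho>: "0 \<le> \<rho>" "\<rho> < 1"
    and contract: "\<forall>f. bounded_measurable (vol M) f \<longrightarrow> (LINT x|vol M. f x) = 0
        \<longrightarrow> (LINT x|vol M. (transition_semigroup P s f x)\<^sup>2) \<le> \<rho> * (LINT x|vol M. (f x)\<^sup>2)"
    by (elim exE conjE) (rule that)
  have "\<exists>n. \<forall>v. bounded_measurable (vol M) v \<longrightarrow> (\<forall>y\<in>space (vol M). 0 \<le> v y)
      \<longrightarrow> (\<forall>x\<in>space (vol M). (LINT y|vol M. v y) / 2 \<le> transition_semigroup P (real n * s) v x)"
    by (rule S.minorization[OF s(1) _ \<rho>]) (rule ultra contract[rule_format]; assumption)+
  then obtain N :: nat where minor: "\<forall>v. bounded_measurable (vol M) v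
      \<longrightarrow> (\<forall>y\<in>space (vol M). 0 \<le> v y)
      \<longrightarrow> (\<forall>x\<in>space (vol M). (LINT y|vol M. v y) / 2 \<le> transition_semigroup P (real N * s) v x)"
    by (elim exE) (rule that)
  define J where "J = N * max 1 (nat \<lceil>s\<^sub>0\<rceil>)"
  have J: "real J = real N * s" by (simp add: J_def s_def)
  obtain b \<epsilon>\<^sub>0 where b: "0 < b" and \<epsilon>\<^sub>0: "0 < \<epsilon>\<^sub>0" "\<epsilon>\<^sub>0 \<le> 1"
    and cap: "\<forall>\<epsilon> y. 0 < \<epsilon> \<longrightarrow> \<epsilon> < \<epsilon>\<^sub>0 \<longrightarrow> y \<in> M \<longrightarrow>
       (\<exists>p s. 0 < s \<and> ball p s \<subseteq> intrinsic_ball M y \<epsilon>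
          \<and> (\<forall>f. energy_bounded_potential M (ball p s) f
                \<longrightarrow> b * kappa CARD('n) \<epsilon> \<le> (LINT x|vol M. f x)))"
    by (rule small_ball_capacity[OF d M comparable charts])
  have main: "\<exists>B n. B \<in> sets (vol M) \<and> B \<subseteq> intrinsic_ball M y \<epsilon>
          \<and> (\<forall>z\<in>M. \<forall>j. 1 - exp (- (b / 4 * kappa CARD('n) \<epsilon> * real j))
                \<le> measure (P z) (grid_hits M (1 / 2 ^ n) B (j * ((J + 1) * 2 ^ n))))"
    if \<epsilon>: "0 < \<epsilon>" "\<epsilon> < \<epsilon>\<^sub>0" and y: "y \<in> M" for \<epsilon> y
  proof -
    obtain q r where qr: "ball q r \<subseteq> intrinsic_ball M y \<epsilon>"
      and lower: "\<forall>f. energy_bounded_potential M (ball q r) f \<longrightarrow> b * kappa CARD('n) \<epsilon> \<le> (LINT x|vol M. f x)"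
      using cap \<epsilon> y by blast
    define B where "B = ball q r"
    define \<kappa> where "\<kappa> = kappa CARD('n) \<epsilon>"
    have \<kappa>: "0 < \<kappa>" unfolding \<kappa>_def using \<epsilon> \<epsilon>\<^sub>0 by (intro kappa_pos) auto
    have "B \<subseteq> M" using qr by (auto simp: B_def intrinsic_ball_def)
    then have B: "B \<in> sets (vol M)" using M by (simp add: sets_vol B_def)
    obtain u where u: "bounded_measurable (vol M) u" "\<forall>x\<in>space (vol M). 0 \<le> u x \<and> u x \<le> 1"
        "\<forall>x\<in>B. u x = 1"
      and lim: "(\<lambda>n. LINT x|vol M. S.hit (1 / 2 ^ n) B (2 ^ n) x) \<longlonglongrightarrow> (LINT x|vol M. u x)"
      and loss: "\<forall>t>0. S.loss t u / t \<le> (LINT x|vol M. u x)"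
      by (rule S.dyadic_hit_limit[OF B])
    have "energy_bounded_potential M B u"
      using u loss by (intro hit_limit_energy_bounded[OF M P]) auto
    then have "b * \<kappa> \<le> (LINT x|vol M. u x)" using lower by (simp add: B_def \<kappa>_def)
    moreover have "b * \<kappa> / 2 < b * \<kappa>" using b \<kappa> by simp
    ultimately have "b * \<kappa> / 2 < (LINT x|vol M. u x)" by linarith
    then have "\<forall>\<^sub>F n in sequentially. b * \<kappa> / 2 < (LINT x|vol M. S.hit (1 / 2 ^ n) B (2 ^ n) x)"
      using lim by (rule order_tendstoD[rotated])
    then obtain n where n: "b * \<kappa> / 2 < (LINT x|vol M. S.hit (1 / 2 ^ n) B (2 ^ n) x)"
      by (auto simp: eventually_sequentially)
    let ?h = "1 / 2 ^ n :: real"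
    let ?K = "(J + 1) * 2 ^ n"
    have h: "0 \<le> ?h" by simp
    have once: "b / 4 * \<kappa> \<le> S.hit ?h B ?K x" if x: "x \<in> space (vol M)" for x
    proof -
      have "b / 4 * \<kappa> \<le> (LINT x|vol M. S.hit ?h B (2 ^ n) x) / 2" using n by linarith
      also have "\<dots> \<le> transition_semigroup P (real N * s) (S.hit ?h B (2 ^ n)) x"
        using S.hit_range[OF h B] x by (intro minor[rule_format] S.hit_bounded_measurable[OF h B]) auto
      also have "real N * s = real (J * 2 ^ n) * ?h" by (simp add: J[symmetric])
      also have "transition_semigroup P (real (J * 2 ^ n) * ?h) (S.hit ?h B (2 ^ n)) x
          \<le> S.hit ?h B (J * 2 ^ n + 2 ^ n) x"
        by (rule S.T_hit_le_hit[OF h B x])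
      also have "J * 2 ^ n + 2 ^ n = ?K" by simp
      finally show ?thesis .
    qed
    have "1 - exp (- (b / 4 * \<kappa> * real j))
        \<le> measure (P z) (grid_hits M ?h B (j * ?K))"
      if z: "z \<in> M" for z j
    proof -
      have "b / 4 * \<kappa> \<le> 1" using once[of z] S.hit_range[OF h B, of z ?K] z by auto
      have "1 - S.hit ?h B (j * ?K) z \<le> (1 - b / 4 * \<kappa>) ^ j"
        using z by (intro S.miss_le_power[OF h B once]) auto
      also have "\<dots> \<le> exp (- (b / 4 * \<kappa>)) ^ j"
        using \<open>b / 4 * \<kappa> \<le> 1\<close> exp_ge_add_one_self[of "- (b / 4 * \<kappa>)"] by (intro power_mono) auto
      also have "\<dots> = exp (- (b / 4 * \<kappa> * real j))"
        by (simp add: exp_of_nat_mult[symmetric] mult.commute)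
      finally show ?thesis by (simp only: hit_probability[OF M P B h z])
    qed
    then show ?thesis using B qr unfolding B_def \<kappa>_def by blast
  qed
  show ?thesis
    by (rule that[of "b / 4" \<epsilon>\<^sub>0 "J + 1"]) (use b \<epsilon>\<^sub>0 main in auto)
qed

lemma le_inner_prob:
  assumes "prob_space N" "E \<in> sets N" "E \<subseteq> A"
  shows "measure N E \<le> inner_prob N A"
  unfolding inner_prob_def
  using assms prob_space.prob_le_1[OF assms(1)]
  by (intro cSup_upper) (auto intro!: bdd_aboveI[of _ 1])

text \<open>
  The event that every ball is hit at a time of its grid is measurable and contained in \<open>R\<close>, so it
  bounds the inner probability of \<open>R\<close> from below.
\<close>

lemma recovery_of_hitting_bound:
  fixes M :: "(real^'n) set" and y :: "nat \<Rightarrow> real^'n" and A :: "nat \<Rightarrow> (real^'n) set"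
  assumes M: "closed_domain M" and P: "reflected_BM M P" and z: "z \<in> M"
    and m: "1 \<le> m" and \<delta>: "0 < \<delta>"
    and B: "\<And>i. i \<in> {1..m} \<Longrightarrow> B i \<in> sets (vol M) \<and> B i \<subseteq> A i"
    and hit: "\<And>i. i \<in> {1..m} \<Longrightarrow> 1 - \<delta> / real m \<le> measure (P z) (grid_hits M (h i) (B i) (K i))"
    and h: "\<And>i. i \<in> {1..m} \<Longrightarrow> 0 \<le> h i \<and> real (K i) * h i \<le> T"
    and R: "\<And>\<omega>. \<omega> \<in> space (path_space M) \<Longrightarrow> (\<forall>i\<in>{1..m}. \<omega> ` {0..T} \<inter> A i \<noteq> {}) \<Longrightarrow> \<omega> \<in> R"
  shows "1 - \<delta> \<le> inner_prob (P z) R"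
proof -
  interpret prob_space "P z" by (rule prob_space_law[OF M P z])
  define E where "E i = grid_hits M (h i) (B i) (K i)" for i
  have E: "E i \<in> sets (P z)" if "i \<in> {1..m}" for i
    unfolding E_def sets_law[OF M P z] using B[OF that] h[OF that]
    by (intro grid_hits_measurable[OF M P]) auto
  have all: "(\<Inter>i\<in>{1..m}. E i) \<in> sets (P z)" using E m by (intro sets.finite_INT) auto
  have "prob (space (P z) - (\<Inter>i\<in>{1..m}. E i)) \<le> prob (\<Union>i\<in>{1..m}. space (P z) - E i)"
    using E all by (intro finite_measure_mono) auto
  also have "\<dots> \<le> (\<Sum>i\<in>{1..m}. prob (space (P z) - E i))"
    using E by (intro finite_measure_subadditive_finite) auto
  also have "\<dots> \<le> (\<Sum>i\<in>{1..m}. \<delta> / real m)"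
  proof (rule sum_mono)
    fix i assume i: "i \<in> {1..m}"
    show "prob (space (P z) - E i) \<le> \<delta> / real m"
      using hit[OF i] prob_compl[OF E[OF i]] by (simp add: E_def)
  qed
  also have "\<dots> = \<delta>" using m by simp
  finally have "1 - \<delta> \<le> prob (\<Inter>i\<in>{1..m}. E i)" using prob_compl[OF all] by simp
  also have "\<dots> \<le> inner_prob (P z) R"
  proof (rule le_inner_prob[OF prob_space_axioms all], rule subsetI)
    fix \<omega> assume \<omega>: "\<omega> \<in> (\<Inter>i\<in>{1..m}. E i)"
    have "\<omega> ` {0..T} \<inter> A i \<noteq> {}" if i: "i \<in> {1..m}" for i
    proof -
      have "\<omega> \<in> E i" using \<omega> i by blast
      then obtain k where k: "k \<le> K i" "\<omega> (real k * h i) \<in> B i" unfolding E_def grid_hits_def by blast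
      have "real k * h i \<le> real (K i) * h i" using k h[OF i] by (intro mult_right_mono) auto
      then have "real k * h i \<in> {0..T}" using h[OF i] by auto
      then show ?thesis using k(2) B[OF i] by blast
    qed
    moreover have "1 \<in> {1..m}" using m by simp
    with \<omega> have "\<omega> \<in> space (path_space M)" unfolding E_def grid_hits_def by blast
    ultimately show "\<omega> \<in> R" using R by blast
  qed
  finally show ?thesis .
qed

theorem corollary6p2:
  fixes M :: "(real^'n) set" and s\<^sub>0 a\<^sub>h\<^sub>k :: real
  assumes "2 \<le> CARD('n)"
    and "closed_domain M"
    and "0 < reach M"
    and "intrinsic_comparable M"
    and "volume_regular M"
    and "admissible_reflecting_domain M"
    and "0 < s\<^sub>0" and "1 \<le> a\<^sub>h\<^sub>k"
  shows "\<exists>C>0. \<exists>\<epsilon>\<^sub>0>0. \<forall>P p.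
    reflected_BM M P \<longrightarrow> neumann_heat_kernel M P p \<longrightarrow>
    (\<forall>t\<ge>s\<^sub>0. \<forall>x\<in>M. \<forall>y\<in>M. p t x y \<le> a\<^sub>h\<^sub>k) \<longrightarrow>
    (\<forall>\<epsilon> q r (m::nat) (y :: nat \<Rightarrow> real^'n) z \<delta> T.
       0 < \<epsilon> \<longrightarrow> \<epsilon> < \<epsilon>\<^sub>0 \<longrightarrow> q \<le> CARD('n) \<longrightarrow> 0 < r \<longrightarrow>
       1 \<le> m \<longrightarrow> (\<forall>i\<in>{1..m}. y i \<in> M) \<longrightarrow>
       z \<in> M \<longrightarrow> 0 < \<delta> \<longrightarrow> \<delta> < 1 \<longrightarrow>
       C * (s\<^sub>0 + inverse (kappa CARD('n) \<epsilon>) * (ln (real m) + ln (1 / \<delta>))) \<le> T \<longrightarrow>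
       (homological_certificate TYPE('k::field) q r M {1..m} (\<lambda>i. intrinsic_ball M (y i) \<epsilon>) \<longrightarrow>
          1 - \<delta> \<le> inner_prob (P z)
            {\<omega> \<in> space (P z). homology_iso TYPE('k) q (thickening (\<omega> ` {0..T}) r) M})
       \<and> (full_homological_certificate TYPE('k) r M {1..m} (\<lambda>i. intrinsic_ball M (y i) \<epsilon>) \<longrightarrow>
          1 - \<delta> \<le> inner_prob (P z)
            {\<omega> \<in> space (P z). \<forall>q'\<le>CARD('n).
               homology_iso TYPE('k) q' (thickening (\<omega> ` {0..T}) r) M}))"
proof -
  let ?d = "CARD('n)"
  note M = assms(2)
  from assms(6) obtain P\<^sub>0 where P\<^sub>0: "reflected_BM M P\<^sub>0"
    and unique: "\<forall>P'. reflected_BM M P' \<longrightarrow> (\<forall>z\<in>M. P' z = P\<^sub>0 z)"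
    and compact: "\<forall>t>0. L2_compact (vol M) (transition_semigroup P\<^sub>0 t)"
    and gap: "positive_spectral_gap M" and charts: "uniform_charts M"
    unfolding admissible_reflecting_domain_def by blast
  have heat: "neumann_heat_kernel M P\<^sub>0 p" if "reflected_BM M P" "neumann_heat_kernel M P p" for P p
    using that unique unfolding neumann_heat_kernel_def by simp
  \<comment> \<open>The constants may depend on the process, which is unique, and on the existence of a dominated heat
    kernel. Without one the statement is vacuous.\<close>
  show ?thesis
  proof (cases "\<exists>p. neumann_heat_kernel M P\<^sub>0 p \<and> (\<forall>t\<ge>s\<^sub>0. \<forall>x\<in>M. \<forall>y\<in>M. p t x y \<le> a\<^sub>h\<^sub>k)")
    case False
    then have "\<not> (\<forall>t\<ge>s\<^sub>0. \<forall>x\<in>M. \<forall>y\<in>M. p t x y \<le> a\<^sub>h\<^sub>k)"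
      if "reflected_BM M P" "neumann_heat_kernel M P p" for P p
      using heat[OF that] by blast
    then show ?thesis by (intro exI[of _ 1] conjI allI impI zero_less_one) (blast, blast)
  next
    case True
    then obtain p\<^sub>0 where p\<^sub>0: "neumann_heat_kernel M P\<^sub>0 p\<^sub>0"
      and bdd: "\<forall>t\<ge>s\<^sub>0. \<forall>x\<in>M. \<forall>y\<in>M. p\<^sub>0 t x y \<le> a\<^sub>h\<^sub>k" by blast
    obtain c \<epsilon>\<^sub>0 and t\<^sub>1 :: nat where c: "0 < c" and \<epsilon>\<^sub>0: "0 < \<epsilon>\<^sub>0" "\<epsilon>\<^sub>0 \<le> 1" and t\<^sub>1: "0 < t\<^sub>1"
      and hitting: "\<forall>\<epsilon> y. 0 < \<epsilon> \<longrightarrow> \<epsilon> < \<epsilon>\<^sub>0 \<longrightarrow> y \<in> M \<longrightarrow>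
       (\<exists>B n. B \<in> sets (vol M) \<and> B \<subseteq> intrinsic_ball M y \<epsilon>
          \<and> (\<forall>z\<in>M. \<forall>j. 1 - exp (- (c * kappa ?d \<epsilon> * real j))
                \<le> measure (P\<^sub>0 z) (grid_hits M (1 / 2 ^ n) B (j * (t\<^sub>1 * 2 ^ n)))))"
      by (rule uniform_hitting_bound[OF assms(1) M assms(4) charts gap P\<^sub>0 compact p\<^sub>0 bdd])
    \<comment> \<open>The first summand pays for the last, incomplete block, the second one for the blocks needed.\<close>
    define C where "C = real t\<^sub>1 / s\<^sub>0 + real t\<^sub>1 / c"
    have C: "0 < C" unfolding C_def using t\<^sub>1 c assms(7) by (simp add: add_pos_pos)
    have recovery: "1 - \<delta> \<le> inner_prob (P\<^sub>0 z) R"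
      if \<epsilon>: "0 < \<epsilon>" "\<epsilon> < \<epsilon>\<^sub>0" and m: "1 \<le> m" and y: "\<forall>i\<in>{1..m}. y i \<in> M" and z: "z \<in> M"
        and \<delta>: "0 < \<delta>" "\<delta> < 1"
        and T: "C * (s\<^sub>0 + inverse (kappa ?d \<epsilon>) * (ln (real m) + ln (1 / \<delta>))) \<le> T"
        and R: "\<And>\<omega>. \<omega> \<in> space (path_space M)
            \<Longrightarrow> (\<forall>i\<in>{1..m}. \<omega> ` {0..T} \<inter> intrinsic_ball M (y i) \<epsilon> \<noteq> {}) \<Longrightarrow> \<omega> \<in> R"
      for \<epsilon> m and y :: "nat \<Rightarrow> real^'n" and z \<delta> T R
    proof -
      define \<kappa> where "\<kappa> = kappa ?d \<epsilon>"
      define l where "l = ln (real m) + ln (1 / \<delta>)"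
      have \<kappa>: "0 < \<kappa>" unfolding \<kappa>_def using \<epsilon> \<epsilon>\<^sub>0 by (intro kappa_pos) auto
      have l: "0 \<le> l" unfolding l_def using m \<delta> by (intro add_nonneg_nonneg ln_ge_zero) auto
      define j where "j = nat \<lfloor>T / real t\<^sub>1\<rfloor>"
      have "real t\<^sub>1 + real t\<^sub>1 / (c * \<kappa>) * l \<le> C * (s\<^sub>0 + inverse \<kappa> * l)"
      proof -
        have "real t\<^sub>1 / s\<^sub>0 * s\<^sub>0 + real t\<^sub>1 / c * (inverse \<kappa> * l)
            \<le> C * s\<^sub>0 + C * (inverse \<kappa> * l)"
          unfolding C_def using assms(7) c \<kappa> l t\<^sub>1 by (intro add_mono mult_right_mono) auto
        then show ?thesis using assms(7) by (simp add: distrib_left inverse_eq_divide)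
      qed
      also have "\<dots> \<le> T" using T by (simp add: \<kappa>_def l_def)
      finally have T': "real t\<^sub>1 + real t\<^sub>1 / (c * \<kappa>) * l \<le> T" .
      have "0 \<le> real t\<^sub>1 / (c * \<kappa>) * l" using c \<kappa> l by simp
      then have T0: "0 \<le> T" using T' by linarith
      have j_le: "real j * real t\<^sub>1 \<le> T"
      proof -
        have "real j \<le> T / real t\<^sub>1" unfolding j_def using T0 t\<^sub>1 by (simp add: of_nat_nat)
        then show ?thesis using t\<^sub>1 by (simp add: field_simps)
      qed
      have j_ge: "l \<le> c * \<kappa> * real j"
      proof -
        have "T / real t\<^sub>1 - 1 \<le> real j" unfolding j_def by linarith
        moreover have "1 + l / (c * \<kappa>) \<le> T / real t\<^sub>1" using T' t\<^sub>1 by (simp add: field_simps)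
        ultimately have "l / (c * \<kappa>) \<le> real j" by linarith
        then show ?thesis using c \<kappa> by (simp add: field_simps)
      qed
      define good where "good i B n \<longleftrightarrow> B \<in> sets (vol M) \<and> B \<subseteq> intrinsic_ball M (y i) \<epsilon>
          \<and> (\<forall>z\<in>M. \<forall>j. 1 - exp (- (c * kappa ?d \<epsilon> * real j))
                \<le> measure (P\<^sub>0 z) (grid_hits M (1 / 2 ^ n) B (j * (t\<^sub>1 * 2 ^ n))))" for i B and n :: nat
      have "\<forall>i\<in>{1..m}. \<exists>B n. good i B n"
        using hitting \<epsilon> y unfolding good_def by blast
      then obtain B n where good: "\<And>i. i \<in> {1..m} \<Longrightarrow> good i (B i) (n i)" by metis
      have B: "B i \<in> sets (vol M) \<and> B i \<subseteq> intrinsic_ball M (y i) \<epsilon>" if "i \<in> {1..m}" for i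
        using good[OF that] unfolding good_def by blast
      have hit: "1 - exp (- (c * \<kappa> * real j))
          \<le> measure (P\<^sub>0 z) (grid_hits M (1 / 2 ^ n i) (B i) (j * (t\<^sub>1 * 2 ^ n i)))" if "i \<in> {1..m}" for i
        using good[OF that] z unfolding good_def \<kappa>_def by blast
      have exp_le: "exp (- (c * \<kappa> * real j)) \<le> \<delta> / real m"
      proof -
        have "exp (- (c * \<kappa> * real j)) \<le> exp (- l)" using j_ge by simp
        also have "- l = ln (\<delta> / real m)" unfolding l_def using m \<delta> by (simp add: ln_div)
        also have "exp \<dots> = \<delta> / real m" using m \<delta> by simp
        finally show ?thesis .
      qed
      show ?thesis
      proof (rule recovery_of_hitting_bound[OF M P\<^sub>0 z m \<delta>(1) B])
        show "1 - \<delta> / real m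
            \<le> measure (P\<^sub>0 z) (grid_hits M (1 / 2 ^ n i) (B i) (j * (t\<^sub>1 * 2 ^ n i)))" if "i \<in> {1..m}" for i
          using hit[OF that] exp_le by linarith
        show "0 \<le> (1 / 2 ^ n i :: real) \<and> real (j * (t\<^sub>1 * 2 ^ n i)) * (1 / 2 ^ n i) \<le> T" for i
          using j_le by simp
      qed (use R in auto)
    qed
    have "(homological_certificate TYPE('k::field) q r M {1..m} (\<lambda>i. intrinsic_ball M (y i) \<epsilon>) \<longrightarrow>
          1 - \<delta> \<le> inner_prob (P z)
            {\<omega> \<in> space (P z). homology_iso TYPE('k) q (thickening (\<omega> ` {0..T}) r) M})
       \<and> (full_homological_certificate TYPE('k) r M {1..m} (\<lambda>i. intrinsic_ball M (y i) \<epsilon>) \<longrightarrow>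
          1 - \<delta> \<le> inner_prob (P z)
            {\<omega> \<in> space (P z). \<forall>q'\<le>?d.
               homology_iso TYPE('k) q' (thickening (\<omega> ` {0..T}) r) M})"
      if P: "reflected_BM M P" and \<epsilon>: "0 < \<epsilon>" "\<epsilon> < \<epsilon>\<^sub>0" and m: "1 \<le> m" and y: "\<forall>i\<in>{1..m}. y i \<in> M"
        and z: "z \<in> M" and \<delta>: "0 < \<delta>" "\<delta> < 1"
        and T: "C * (s\<^sub>0 + inverse (kappa ?d \<epsilon>) * (ln (real m) + ln (1 / \<delta>))) \<le> T"
      for P \<epsilon> q r m and y :: "nat \<Rightarrow> real^'n" and z \<delta> T
    proof -
      have Pz: "P z = P\<^sub>0 z" using unique P z by blast
      have space: "space (P\<^sub>0 z) = space (path_space M)" by (rule space_law[OF M P\<^sub>0 z])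
      have "0 \<le> C * (s\<^sub>0 + inverse (kappa ?d \<epsilon>) * (ln (real m) + ln (1 / \<delta>)))"
      proof -
        have "0 < kappa ?d \<epsilon>" using \<epsilon> \<epsilon>\<^sub>0 by (intro kappa_pos) auto
        then show ?thesis using C m \<delta> assms(7)
          by (intro mult_nonneg_nonneg add_nonneg_nonneg ln_ge_zero) auto
      qed
      then have T0: "0 \<le> T" using T by linarith
      have iso: "homology_iso TYPE('k) q' (thickening (\<omega> ` {0..T}) r) M"
        if "homological_certificate TYPE('k) q' r M {1..m} (\<lambda>i. intrinsic_ball M (y i) \<epsilon>)"
          and "\<omega> \<in> space (path_space M)" "\<forall>i\<in>{1..m}. \<omega> ` {0..T} \<inter> intrinsic_ball M (y i) \<epsilon> \<noteq> {}"
        for q' \<omega>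
      proof -
        have "continuous_on {0..T} \<omega>" "\<omega> ` {0..T} \<subseteq> M"
          using that(2) by (auto simp: space_path_space elim!: continuous_on_subset)
        then show ?thesis using that(1,3) T0 unfolding homological_certificate_def by blast
      qed
      show ?thesis
        unfolding Pz space full_homological_certificate_def
        by (intro conjI impI recovery[OF \<epsilon> m y z \<delta> T]) (auto intro: iso)
    qed
    then show ?thesis using C \<epsilon>\<^sub>0(1) by (intro exI[of _ C] exI[of _ \<epsilon>\<^sub>0] conjI allI impI) blast+
  qed
qed

end
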